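(* Let $H$ be a Hilbert space, $T\in\mathcal{L}(H)$ and $n\in\mathbb{N}$ such that $(1-T^*T)^n-(1-TT^* )^n\in\mathcal{L}^1(H)$. Let $\pi:\mathcal{A}\to\mathcal{L}(H)$ be the unital algebra homomorphism with $\pi(x)=T$, $\pi(y)=T^*$, where $\mathcal{A}$ is the free unital $\mathbb{C}$-algebra on the generators $x,y$, and let $\gamma=(\gamma_2,\gamma_0)$ be the 2-cycle and $S$ the periodicity operator described in the context. Then the homological index coincides with the pairing in cyclic theory: $$\langle \mathrm{Tr},(\pi\circ S)(\gamma)\rangle=\mathrm{Tr}\big((1-T^*T)^n-(1-TT^* )^n\big)=\mathrm{H\text{-}Ind}_n(T),$$ where $\langle\cdot,\cdot\rangle:HC^0(K)\times HC_0(K)\to\mathbb{C}$.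
   Context: $\mathcal{L}(H)$: bounded operators; $\mathcal{L}^1(H)$: trace class operators with trace norm $\|\cdot\|_1$; $\mathbb{N}=\{1,2,\dots\}$. If $(1-T^*T)^n-(1-TT^* )^n\in\mathcal{L}^1(H)$, then $\mathrm{H\text{-}Ind}_n(T):=\mathrm{Tr}((1-T^*T)^n-(1-TT^* )^n)$. Boundaries. On $C_k(\mathcal{A})=\mathcal{A}^{\otimes(k+1)}$ (for a unital algebra $\mathcal A$): $b(x_0\otimes\cdots\otimes x_k)=\sum_{i=0}^{k-1}(-1)^ix_0\otimes\cdots\otimes x_ix_{i+1}\otimes\cdots\otimes x_k+(-1)^kx_kx_0\otimes x_1\otimes\cdots\otimes x_{k-1}$; $t(x_0\otimes\cdots\otimes x_k)=(-1)^kx_k\otimes x_0\otimes\cdots\otimes x_{k-1}$; $N=1+t+\cdots+t^k$; $s(x_0\otimes\cdots\otimes x_k)=1\otimes x_0\otimes\cdots\otimes x_k$; $B=(1-t)sN$. The cycle. In the free algebra $\mathcal{A}$ put $v=1-xy$, $w=1-yx$, $\omega_n=x+vx+\cdots+v^{n-1}x$; $\mathcal{I}_n$ is the smallest (two-sided) ideal containing $v^n$ and $w^n$, and $\mathcal{J}_n\subset\mathcal{I}_n$ the ideal generated by $w^n-v^n$. For an ideal $\mathcal{I}$, $C_k(\mathcal{A},\mathcal{I})\subset C_k(\mathcal{A})$ is the sum of the subspaces $\mathcal{A}\otimes\cdots\otimes\mathcal{I}\otimes\cdots\otimes\mathcal{A}$ with one factor $\mathcal{I}$ and $k$ factors $\mathcal{A}$.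 The complex $\mathcal{B}_*(\mathcal{I}_n,\mathcal{J}_n,\mathcal{A})$ has chains $C_k(\mathcal{A},\mathcal{I}_n)\oplus C_{k-2}(\mathcal{A},\mathcal{J}_n)\oplus C_{k-4}(\mathcal{A},\mathcal{J}_n)\oplus\cdots$ in degree $k$ and boundary $b+B$; $\mathcal{B}_*(\mathcal{J}_n,\mathcal{A})$ has chains $C_k(\mathcal{A},\mathcal{J}_n)\oplus C_{k-2}(\mathcal{A},\mathcal{J}_n)\oplus\cdots$ and boundary $b+B$. The periodicity operator $S:\mathcal{B}_*(\mathcal{I}_n,\mathcal{J}_n,\mathcal{A})\to\mathcal{B}_{*-2}(\mathcal{J}_n,\mathcal{A})$ is $S(z_k,z_{k-2},\dots)=(z_{k-2},z_{k-4},\dots)$. The 2-cycle is $\gamma=(\gamma_2,\gamma_0)$ with $\gamma_0=w^n-v^n$ and $\gamma_2=-w^n\otimes y\otimes\omega_n+v^n\otimes\omega_n\otimes y-\omega_n\otimes w^n\otimes y+\omega_n\otimes y\otimes v^n-2(w^n-v^n)\otimes1\otimes1$. Since $\pi(\gamma_0)\in\mathcal{L}^1(H)$, $\pi$ restricts to a homomorphism $\mathcal{J}_n\to\mathcal{L}^1(H)$. The complex $K$. $\mathcal{K}_m\subset\mathcal{L}(H)^{\otimes(m+1)}$ is the span of elementary tensors $x_0\otimes\cdots\otimes x_m$ with $x_i\cdots x_mx_0\cdots x_{i-1}\in\mathcal{L}^1(H)$ for all $i\in\{0,\dots,m\}$, with norm $\|x\|_1=\inf\sum_j\big(\sum_{i=0}^m\|M(t^i(x_0^j\otimes\cdots\otimes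 x_m^j))\|_1+\|x_0^j\|\cdots\|x_m^j\|\big)$, the infimum over finite representations $x=\sum_jx_0^j\otimes\cdots\otimes x_m^j$ by such tensors, where $M(x_0\otimes\cdots\otimes x_m)=x_0\cdots x_m$. $K_m$ is its completion ($K_0=\mathcal{L}^1(H)$), $K^m=K_m^*$ its Banach space dual; $b,B$ extend continuously to $K_*$ and dualize to $K^*$. $HC_*(K)$ is the homology of the complex with chains $K_k\oplus K_{k-2}\oplus\cdots$ and boundary $b+B$, and $HC^*(K)$ the cohomology of the dual complex; so $HC_0(K)=K_0/b(K_1)$, $HC^0(K)=\{\varphi\in K^0:\varphi\circ b=0 \text{ on } K_1\}$, and the pairing is evaluation. $\mathrm{Tr}\in K^0$ denotes the operator trace on $K_0=\mathcal{L}^1(H)$, which is a cocycle. *)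

theory Defs
  imports "HOL-Analysis.Analysis" "HOL-Library.Poly_Mapping"
begin

section \<open>Complex vector spaces, algebras and Hilbert spaces\<close>

class scaleC =
  fixes scaleC :: "complex \<Rightarrow> 'a \<Rightarrow> 'a" (infixr \<open>*\<^sub>C\<close> 75)

class complex_vector = scaleC + ab_group_add +
  assumes scaleC_add_right: "c *\<^sub>C (x + y) = c *\<^sub>C x + c *\<^sub>C y"
    and scaleC_add_left: "(c + d) *\<^sub>C x = c *\<^sub>C x + d *\<^sub>C x"
    and scaleC_scaleC: "c *\<^sub>C (d *\<^sub>C x) = (c * d) *\<^sub>C x"
    and scaleC_one: "1 *\<^sub>C x = x"

interpretation cvec: vector_space "scaleC :: complex \<Rightarrow> 'a \<Rightarrow> 'a::complex_vector"
  by unfold_locales (rule scaleC_add_right scaleC_add_left scaleC_scaleC scaleC_one)+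

text \<open>Unital algebras. The class \<^class>\<open>ring_1\<close> is avoided because it demands \<open>0 \<noteq> 1\<close>, which would
  exclude the operator algebra of the zero Hilbert space.\<close>

class complex_algebra_1 = complex_vector + ring + monoid_mult +
  assumes scaleC_mult_left: "(c *\<^sub>C x) * y = c *\<^sub>C (x * y)"
    and scaleC_mult_right: "x * (c *\<^sub>C y) = c *\<^sub>C (x * y)"

class complex_hilbert = complex_vector + banach +
  fixes cinner :: "'a \<Rightarrow> 'a \<Rightarrow> complex"
  assumes scaleR_scaleC: "r *\<^sub>R x = complex_of_real r *\<^sub>C x"
    and cinner_commute: "cinner x y = cnj (cinner y x)"
    and cinner_add_left: "cinner (x + y) z = cinner x z + cinner y z"
    and cinner_scaleC_left: "cinner (c *\<^sub>C x) y = c * cinner x y"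
    and cinner_self: "cinner x x = complex_of_real ((norm x)\<^sup>2)"

instantiation complex :: complex_algebra_1
begin
definition scaleC_complex :: "complex \<Rightarrow> complex \<Rightarrow> complex" where
  "scaleC_complex c x = c * x"
instance by standard (simp_all add: scaleC_complex_def algebra_simps)
end

instantiation poly_mapping :: (type, complex_vector) complex_vector
begin
lift_definition scaleC_poly_mapping :: "complex \<Rightarrow> ('a \<Rightarrow>\<^sub>0 'b) \<Rightarrow> ('a \<Rightarrow>\<^sub>0 'b)"
  is "\<lambda>c f k. c *\<^sub>C f k"
  by (erule finite_subset[rotated]) auto
instance
  by standard
    (transfer; simp add: fun_eq_iff scaleC_add_right scaleC_add_left scaleC_scaleC scaleC_one)+
end

lemma scaleC_single: "c *\<^sub>C Poly_Mapping.single k a = Poly_Mapping.single k (c *\<^sub>C a)"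
  by (transfer) (auto simp: when_def fun_eq_iff)

lemma poly_mapping_additive_eq:
  fixes f g :: "('a \<Rightarrow>\<^sub>0 'b::ab_group_add) \<Rightarrow> 'c::ab_group_add"
  assumes "\<And>p q. f (p + q) = f p + f q" "\<And>p q. g (p + q) = g p + g q"
    and "\<And>k a. f (Poly_Mapping.single k a) = g (Poly_Mapping.single k a)"
  shows "f p = g p"
proof -
  have p: "p = (\<Sum>k\<in>Poly_Mapping.keys p. Poly_Mapping.single k (Poly_Mapping.lookup p k))"
    by (rule poly_mapping_eqI) (auto simp: lookup_sum lookup_single when_def in_keys_iff)
  have zero: "f 0 = 0" "g 0 = 0"
    using assms(1)[of 0 0] assms(2)[of 0 0] by simp_all
  have "f (\<Sum>k\<in>K. Poly_Mapping.single k (Poly_Mapping.lookup p k)) =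
      g (\<Sum>k\<in>K. Poly_Mapping.single k (Poly_Mapping.lookup p k))" if "finite K" for K
    using that by (induction K rule: finite_induct) (simp_all add: zero assms)
  from this[OF finite_keys[of p]] show ?thesis
    by (simp only: p[symmetric])
qed

instance poly_mapping :: (monoid_add, "{ring_1, complex_algebra_1}") complex_algebra_1
proof
  fix c :: complex and p q :: "'a \<Rightarrow>\<^sub>0 'b"
  have *: "(c *\<^sub>C p) * Poly_Mapping.single k a = c *\<^sub>C (p * Poly_Mapping.single k a)" for k a
    by (rule poly_mapping_additive_eq[where p = p])
      (simp_all add: scaleC_add_right distrib_right scaleC_single mult_single scaleC_mult_left)
  show "(c *\<^sub>C p) * q = c *\<^sub>C (p * q)"
    by (rule poly_mapping_additive_eq[where p = q])
      (simp_all add: scaleC_add_right distrib_left *)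
  have *: "p * (c *\<^sub>C Poly_Mapping.single k a) = c *\<^sub>C (p * Poly_Mapping.single k a)" for k a
    by (rule poly_mapping_additive_eq[where p = p])
      (simp_all add: scaleC_add_right distrib_right scaleC_single mult_single scaleC_mult_right)
  show "p * (c *\<^sub>C q) = c *\<^sub>C (p * q)"
    by (rule poly_mapping_additive_eq[where p = q])
      (simp_all add: scaleC_add_right distrib_left *)
qed

definition algebra_hom :: "('a::complex_algebra_1 \<Rightarrow> 'b::complex_algebra_1) \<Rightarrow> bool" where
  "algebra_hom f \<longleftrightarrow> (\<forall>x y. f (x + y) = f x + f y) \<and> (\<forall>c x. f (c *\<^sub>C x) = c *\<^sub>C f x) \<and>
     (\<forall>x y. f (x * y) = f x * f y) \<and> f 1 = 1"

section \<open>Bounded operators\<close>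

typedef (overloaded) 'h bounded_op =
  "{f :: 'h::complex_hilbert \<Rightarrow> 'h. bounded_linear f \<and> (\<forall>c x. f (c *\<^sub>C x) = c *\<^sub>C f x)}"
  morphisms op_apply Bounded_op
  by (rule exI[of _ "\<lambda>x. x"]) (simp add: bounded_linear_ident)

setup_lifting type_definition_bounded_op

lemma norm_scaleC: "norm (c *\<^sub>C x) = cmod c * norm (x :: 'h::complex_hilbert)"
proof -
  have "complex_of_real ((norm (c *\<^sub>C x))\<^sup>2) = cinner (c *\<^sub>C x) (c *\<^sub>C x)"
    by (rule cinner_self[symmetric])
  also have "\<dots> = c * cnj (c * cinner x x)"
    by (metis cinner_scaleC_left cinner_commute)
  also have "\<dots> = (c * cnj c) * complex_of_real ((norm x)\<^sup>2)"
    by (simp add: cinner_self)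
  also have "\<dots> = complex_of_real ((cmod c * norm x)\<^sup>2)"
    by (simp add: complex_norm_square[symmetric] power_mult_distrib)
  finally have "(norm (c *\<^sub>C x))\<^sup>2 = (cmod c * norm x)\<^sup>2"
    using of_real_eq_iff by blast
  then show ?thesis by simp
qed

lemma bounded_linear_scaleC:
  "bounded_linear (\<lambda>x :: 'h::complex_hilbert. c *\<^sub>C x)"
  by (rule bounded_linear_intro[where K = "cmod c"])
    (simp_all add: scaleC_add_right scaleR_scaleC scaleC_scaleC mult.commute norm_scaleC)

instantiation bounded_op :: (complex_hilbert) complex_algebra_1
begin
lift_definition zero_bounded_op :: "'a bounded_op" is "\<lambda>x. 0"
  by simp
lift_definition one_bounded_op :: "'a bounded_op" is "\<lambda>x. x"
  by (simp add: bounded_linear_ident)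
lift_definition plus_bounded_op :: "'a bounded_op \<Rightarrow> 'a bounded_op \<Rightarrow> 'a bounded_op"
  is "\<lambda>f g x. f x + g x"
  by (simp add: bounded_linear_add scaleC_add_right)
lift_definition uminus_bounded_op :: "'a bounded_op \<Rightarrow> 'a bounded_op" is "\<lambda>f x. - f x"
  by (simp add: bounded_linear_minus)
lift_definition minus_bounded_op :: "'a bounded_op \<Rightarrow> 'a bounded_op \<Rightarrow> 'a bounded_op"
  is "\<lambda>f g x. f x - g x"
  by (simp add: bounded_linear_sub cvec.scale_right_diff_distrib)
lift_definition times_bounded_op :: "'a bounded_op \<Rightarrow> 'a bounded_op \<Rightarrow> 'a bounded_op"
  is "\<lambda>f g x. f (g x)"
  by (simp add: bounded_linear_compose)
lift_definition scaleC_bounded_op :: "complex \<Rightarrow> 'a bounded_op \<Rightarrow> 'a bounded_op"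
  is "\<lambda>c f x. c *\<^sub>C f x"
  by (simp add: bounded_linear_compose[OF bounded_linear_scaleC] scaleC_scaleC mult.commute)
instance
  by standard
    (transfer; simp add: fun_eq_iff scaleC_add_right scaleC_add_left add.assoc
       linear_add[OF bounded_linear.linear])+
end

definition op_norm :: "'h::complex_hilbert bounded_op \<Rightarrow> real" where
  "op_norm A = onorm (op_apply A)"

definition adj :: "'h::complex_hilbert bounded_op \<Rightarrow> 'h bounded_op" where
  "adj A = (THE B. \<forall>x y. cinner (op_apply A x) y = cinner x (op_apply B y))"

definition positive_op :: "'h::complex_hilbert bounded_op \<Rightarrow> bool" where
  "positive_op A \<longleftrightarrow> (\<forall>x. cinner (op_apply A x) x \<in> \<real>\<^sub>\<ge>\<^sub>0)"

definition abs_op :: "'h::complex_hilbert bounded_op \<Rightarrow> 'h bounded_op" where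
  "abs_op A = (THE P. positive_op P \<and> P * P = adj A * A)"

definition is_onb :: "'h::complex_hilbert set \<Rightarrow> bool" where
  "is_onb E \<longleftrightarrow> (\<forall>e\<in>E. norm e = 1) \<and> (\<forall>e\<in>E. \<forall>f\<in>E. e \<noteq> f \<longrightarrow> cinner e f = 0) \<and>
     closure (cvec.span E) = UNIV"

definition some_onb :: "'h::complex_hilbert set" where
  "some_onb = (SOME E. is_onb E)"

definition trace_class :: "'h::complex_hilbert bounded_op set" where
  "trace_class = {A. \<exists>E. is_onb E \<and> (\<lambda>e. cinner (op_apply (abs_op A) e) e) summable_on E}"

definition trace_norm :: "'h::complex_hilbert bounded_op \<Rightarrow> real" where
  "trace_norm A = Re (\<Sum>\<^sub>\<infinity>e\<in>some_onb. cinner (op_apply (abs_op A) e) e)"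

definition op_trace :: "'h::complex_hilbert bounded_op \<Rightarrow> complex" where
  "op_trace A = (\<Sum>\<^sub>\<infinity>e\<in>some_onb. cinner (op_apply A e) e)"

definition H_Ind :: "nat \<Rightarrow> 'h::complex_hilbert bounded_op \<Rightarrow> complex" where
  "H_Ind n T = op_trace ((1 - adj T * T) ^ n - (1 - T * adj T) ^ n)"

section \<open>Tensors\<close>

text \<open>The type \<open>'a tensor\<close> is the direct sum of all tensor powers over the complex numbers: the free
  vector space on lists, modulo multilinearity. Lists of length \<open>k + 1\<close> span the power with
  \<open>k + 1\<close> factors.\<close>

definition tensor_relations :: "('a::complex_vector list \<Rightarrow>\<^sub>0 complex) set" where
  "tensor_relations =
     {Poly_Mapping.single (xs @ (a + b) # ys) 1 - Poly_Mapping.single (xs @ a # ys) 1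
        - Poly_Mapping.single (xs @ b # ys) 1 | xs a b ys. True} \<union>
     {Poly_Mapping.single (xs @ (c *\<^sub>C a) # ys) 1 - c *\<^sub>C Poly_Mapping.single (xs @ a # ys) 1
        | xs c a ys. True}"

definition tensor_eq ::
  "('a::complex_vector list \<Rightarrow>\<^sub>0 complex) \<Rightarrow> ('a list \<Rightarrow>\<^sub>0 complex) \<Rightarrow> bool" where
  "tensor_eq p q \<longleftrightarrow> p - q \<in> cvec.span tensor_relations"

lemma equivp_tensor_eq: "equivp (tensor_eq :: ('a::complex_vector list \<Rightarrow>\<^sub>0 complex) \<Rightarrow> _)"
  (is "equivp ?R")
proof (rule equivpI)
  show "reflp ?R"
    by (simp add: reflp_def tensor_eq_def cvec.span_zero)
  show "symp ?R"
  proof (rule sympI)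
    fix p q :: "'a list \<Rightarrow>\<^sub>0 complex"
    assume "tensor_eq p q"
    then have "- (p - q) \<in> cvec.span tensor_relations"
      unfolding tensor_eq_def by (rule cvec.span_neg)
    then show "tensor_eq q p" by (simp add: tensor_eq_def)
  qed
  show "transp ?R"
  proof (rule transpI)
    fix p q r :: "'a list \<Rightarrow>\<^sub>0 complex"
    assume "tensor_eq p q" "tensor_eq q r"
    then have "(p - q) + (q - r) \<in> cvec.span tensor_relations"
      unfolding tensor_eq_def by (rule cvec.span_add)
    then show "tensor_eq p r" by (simp add: tensor_eq_def)
  qed
qed

quotient_type (overloaded) 'a tensor = "'a::complex_vector list \<Rightarrow>\<^sub>0 complex" / tensor_eq
  by (rule equivp_tensor_eq)

lemma tensor_eq_refl: "p = q \<Longrightarrow> tensor_eq p q"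
  by (simp add: tensor_eq_def cvec.span_zero)

instantiation tensor :: (complex_vector) complex_vector
begin
lift_definition zero_tensor :: "'a tensor" is 0 .
lift_definition plus_tensor :: "'a tensor \<Rightarrow> 'a tensor \<Rightarrow> 'a tensor" is "(+)"
proof -
  fix p p' q q' :: "'a list \<Rightarrow>\<^sub>0 complex"
  assume "tensor_eq p p'" "tensor_eq q q'"
  then have "(p - p') + (q - q') \<in> cvec.span tensor_relations"
    unfolding tensor_eq_def by (rule cvec.span_add)
  then show "tensor_eq (p + q) (p' + q')"
    by (simp add: tensor_eq_def add_diff_add)
qed
lift_definition uminus_tensor :: "'a tensor \<Rightarrow> 'a tensor" is uminus
proof -
  fix p p' :: "'a list \<Rightarrow>\<^sub>0 complex"
  assume "tensor_eq p p'"
  then have "- (p - p') \<in> cvec.span tensor_relations"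
    unfolding tensor_eq_def by (rule cvec.span_neg)
  then show "tensor_eq (- p) (- p')"
    by (simp add: tensor_eq_def)
qed
lift_definition minus_tensor :: "'a tensor \<Rightarrow> 'a tensor \<Rightarrow> 'a tensor" is "(-)"
proof -
  fix p p' q q' :: "'a list \<Rightarrow>\<^sub>0 complex"
  assume "tensor_eq p p'" "tensor_eq q q'"
  then have "(p - p') - (q - q') \<in> cvec.span tensor_relations"
    unfolding tensor_eq_def by (rule cvec.span_diff)
  then show "tensor_eq (p - q) (p' - q')"
    by (simp add: tensor_eq_def algebra_simps)
qed
lift_definition scaleC_tensor :: "complex \<Rightarrow> 'a tensor \<Rightarrow> 'a tensor" is "scaleC"
  unfolding tensor_eq_def by (simp only: cvec.scale_right_diff_distrib[symmetric] cvec.span_scale)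
instance
  by standard (transfer, rule tensor_eq_refl,
      simp add: scaleC_add_right scaleC_add_left scaleC_scaleC)+
end

lift_definition elem :: "'a::complex_vector list \<Rightarrow> 'a tensor"
  is "\<lambda>xs. Poly_Mapping.single xs 1" .

text \<open>The linear extension of a function on elementary tensors. It is computed from a representative
  and hence meaningful for multilinear functions only, see \<open>tensor_lift_elem\<close>.\<close>

definition free_extension ::
  "('a list \<Rightarrow> 'b) \<Rightarrow> ('a list \<Rightarrow>\<^sub>0 complex) \<Rightarrow> 'b::complex_vector" where
  "free_extension g p = (\<Sum>xs\<in>Poly_Mapping.keys p. Poly_Mapping.lookup p xs *\<^sub>C g xs)"

definition tensor_lift :: "('a::complex_vector list \<Rightarrow> 'b) \<Rightarrow> 'a tensor \<Rightarrow> 'b::complex_vector" where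
  "tensor_lift g z = free_extension g (rep_tensor z)"

definition multilinear :: "('a::complex_vector list \<Rightarrow> 'b::complex_vector) \<Rightarrow> bool" where
  "multilinear g \<longleftrightarrow>
     (\<forall>xs a b ys. g (xs @ (a + b) # ys) = g (xs @ a # ys) + g (xs @ b # ys)) \<and>
     (\<forall>xs c a ys. g (xs @ (c *\<^sub>C a) # ys) = c *\<^sub>C g (xs @ a # ys))"

lemma free_extension_superset:
  assumes "finite K" "Poly_Mapping.keys p \<subseteq> K"
  shows "free_extension g p = (\<Sum>xs\<in>K. Poly_Mapping.lookup p xs *\<^sub>C g xs)"
  unfolding free_extension_def
  using assms by (intro sum.mono_neutral_left) (auto simp: in_keys_iff)

lemma free_extension_add: "free_extension g (p + q) = free_extension g p + free_extension g q"
proof -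
  let ?K = "Poly_Mapping.keys p \<union> Poly_Mapping.keys q"
  have "Poly_Mapping.keys (p + q) \<subseteq> ?K" by (rule Poly_Mapping.keys_add)
  then show ?thesis
    by (simp add: free_extension_superset[of ?K] lookup_add scaleC_add_left sum.distrib)
qed

lemma free_extension_scaleC: "free_extension g (c *\<^sub>C p) = c *\<^sub>C free_extension g p"
proof -
  have *: "Poly_Mapping.lookup (c *\<^sub>C p) k = c * Poly_Mapping.lookup p k" for k
    by (simp add: scaleC_poly_mapping.rep_eq scaleC_complex_def)
  then have "Poly_Mapping.keys (c *\<^sub>C p) \<subseteq> Poly_Mapping.keys p"
    by (auto simp: in_keys_iff)
  then show ?thesis
    by (simp add: free_extension_superset[of "Poly_Mapping.keys p"] * cvec.scale_sum_right)
qed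

lemma free_extension_diff: "free_extension g (p - q) = free_extension g p - free_extension g q"
  using free_extension_add[of g "p - q" q] by simp

lemma free_extension_single: "free_extension g (Poly_Mapping.single xs c) = c *\<^sub>C g xs"
  by (simp add: free_extension_superset[of "{xs}"])

lemma free_extension_tensor_eq:
  assumes "multilinear g" "tensor_eq p q"
  shows "free_extension g p = free_extension g q"
proof -
  have "free_extension g r = 0" if "r \<in> cvec.span tensor_relations" for r
    using that
  proof (induction rule: cvec.span_induct_alt)
    case base
    then show ?case by (simp add: free_extension_def)
  next
    case (step c x y)
    have "free_extension g x = 0"
      using step(1) assms(1)
      by (auto simp: tensor_relations_def multilinear_def free_extension_diff
          free_extension_single free_extension_scaleC scaleC_one)
    with step show ?case by (simp add: free_extension_add free_extension_scaleC)
  qed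
  then have "free_extension g (p - q) = 0"
    using assms(2) by (simp add: tensor_eq_def)
  then show ?thesis by (simp add: free_extension_diff)
qed

lemma tensor_lift_elem:
  assumes "multilinear g"
  shows "tensor_lift g (elem xs) = g xs"
proof -
  have "tensor_eq (rep_tensor (elem xs)) (Poly_Mapping.single xs 1)"
    by (simp add: tensor.abs_eq_iff[symmetric] elem.abs_eq[symmetric]
        Quotient3_abs_rep[OF Quotient3_tensor])
  then show ?thesis
    using free_extension_tensor_eq[OF assms]
    by (simp add: tensor_lift_def free_extension_single scaleC_one)
qed

definition tensor_map ::
  "('a::complex_vector \<Rightarrow> 'b::complex_vector) \<Rightarrow> 'a tensor \<Rightarrow> 'b tensor" where
  "tensor_map f = tensor_lift (\<lambda>xs. elem (map f xs))"

definition tensor_mult :: "'a::complex_algebra_1 tensor \<Rightarrow> 'a" where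
  "tensor_mult = tensor_lift prod_list"

section \<open>Cyclic boundaries\<close>

text \<open>The degree of \<open>elem xs\<close> is \<open>k = length xs - 1\<close>; the boundary \<open>b\<close> vanishes in degree \<open>0\<close>.\<close>

definition hochschild_b :: "'a::complex_algebra_1 tensor \<Rightarrow> 'a tensor" where
  "hochschild_b = tensor_lift (\<lambda>xs. if length xs \<le> 1 then 0 else
     let k = length xs - 1 in
       (\<Sum>i<k. (-1) ^ i *\<^sub>C elem (take i xs @ (xs ! i * xs ! (i + 1)) # drop (i + 2) xs))
       + (-1) ^ k *\<^sub>C elem ((xs ! k * xs ! 0) # take (k - 1) (drop 1 xs)))"

definition cyclic_t :: "'a::complex_vector tensor \<Rightarrow> 'a tensor" where
  "cyclic_t = tensor_lift (\<lambda>xs. (-1) ^ (length xs - 1) *\<^sub>C elem (last xs # butlast xs))"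

definition cyclic_N :: "'a::complex_vector tensor \<Rightarrow> 'a tensor" where
  "cyclic_N = tensor_lift (\<lambda>xs. \<Sum>i<length xs. (cyclic_t ^^ i) (elem xs))"

definition cyclic_s :: "'a::complex_algebra_1 tensor \<Rightarrow> 'a tensor" where
  "cyclic_s = tensor_lift (\<lambda>xs. elem (1 # xs))"

definition connes_B :: "'a::complex_algebra_1 tensor \<Rightarrow> 'a tensor" where
  "connes_B z = cyclic_s (cyclic_N z) - cyclic_t (cyclic_s (cyclic_N z))"

section \<open>The relative complexes\<close>

definition two_sided_ideal :: "'a::complex_algebra_1 set \<Rightarrow> bool" where
  "two_sided_ideal I \<longleftrightarrow> 0 \<in> I \<and> (\<forall>a\<in>I. \<forall>b\<in>I. a + b \<in> I) \<and> (\<forall>a. \<forall>b\<in>I. a * b \<in> I \<and> b * a \<in> I)"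

definition rel_chains :: "nat \<Rightarrow> 'a::complex_algebra_1 set \<Rightarrow> 'a tensor set" where
  "rel_chains k I = cvec.span {elem xs | xs. length xs = k + 1 \<and> (\<exists>i\<le>k. xs ! i \<in> I)}"

text \<open>A chain \<open>(z\<^sub>k, z\<^sub>k\<^sub>-\<^sub>2, \<dots>)\<close> of degree \<open>k\<close> is the function mapping \<open>j\<close> to its component of
  tensor degree \<open>k - 2 * j\<close>, extended by zero. The complex of the triple \<open>(I, J, A)\<close> is
  \<open>B_chains I J\<close>, the complex of the pair \<open>(J, A)\<close> is \<open>B_chains J J\<close>.\<close>

definition B_chains ::
  "'a::complex_algebra_1 set \<Rightarrow> 'a set \<Rightarrow> nat \<Rightarrow> (nat \<Rightarrow> 'a tensor) set" where
  "B_chains I J k = {z. z 0 \<in> rel_chains k I \<and>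
     (\<forall>j\<ge>1. if 2 * j \<le> k then z j \<in> rel_chains (k - 2 * j) J else z j = 0)}"

definition B_boundary :: "(nat \<Rightarrow> 'a::complex_algebra_1 tensor) \<Rightarrow> nat \<Rightarrow> 'a tensor" where
  "B_boundary z = (\<lambda>j. hochschild_b (z j) + connes_B (z (j + 1)))"

definition B_cycles ::
  "'a::complex_algebra_1 set \<Rightarrow> 'a set \<Rightarrow> nat \<Rightarrow> (nat \<Rightarrow> 'a tensor) set" where
  "B_cycles I J k = {z \<in> B_chains I J k. B_boundary z = (\<lambda>_. 0)}"

definition periodicity_S :: "(nat \<Rightarrow> 'a tensor) \<Rightarrow> nat \<Rightarrow> 'a::complex_vector tensor" where
  "periodicity_S z = (\<lambda>j. z (j + 1))"

section \<open>The free algebra and the cycle\<close>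

text \<open>The free algebra is the monoid algebra of the free monoid; \<^typ>\<open>'a \<Rightarrow>\<^sub>0 'b\<close> takes its
  convolution product from the additively written (here: noncommutative) monoid structure
  of \<open>'a\<close>.\<close>

datatype 'g word = Word "'g list"

instantiation word :: (type) monoid_add
begin
definition zero_word :: "'a word" where "zero_word = Word []"
fun plus_word :: "'a word \<Rightarrow> 'a word \<Rightarrow> 'a word" where
  "plus_word (Word xs) (Word ys) = Word (xs @ ys)"
instance
proof
  fix a b c :: "'a word"
  show "a + b + c = a + (b + c)" by (cases a; cases b; cases c) simp
  show "0 + a = a" "a + 0 = a" by (cases a; simp add: zero_word_def)+
qed
end

datatype gen = Gen_x | Gen_y

type_synonym free_alg = "gen word \<Rightarrow>\<^sub>0 complex"

definition fx :: free_alg where "fx = Poly_Mapping.single (Word [Gen_x]) 1"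
definition fy :: free_alg where "fy = Poly_Mapping.single (Word [Gen_y]) 1"
definition fv :: free_alg where "fv = 1 - fx * fy"
definition fw :: free_alg where "fw = 1 - fy * fx"
definition omega :: "nat \<Rightarrow> free_alg" where "omega n = (\<Sum>i<n. fv ^ i * fx)"

definition ideal_I :: "nat \<Rightarrow> free_alg set" where
  "ideal_I n = two_sided_ideal hull {fv ^ n, fw ^ n}"

definition ideal_J :: "nat \<Rightarrow> free_alg set" where
  "ideal_J n = two_sided_ideal hull {fw ^ n - fv ^ n}"

definition gamma0 :: "nat \<Rightarrow> free_alg tensor" where
  "gamma0 n = elem [fw ^ n - fv ^ n]"

definition gamma2 :: "nat \<Rightarrow> free_alg tensor" where
  "gamma2 n = - elem [fw ^ n, fy, omega n] + elem [fv ^ n, omega n, fy]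
     - elem [omega n, fw ^ n, fy] + elem [omega n, fy, fv ^ n]
     - 2 *\<^sub>C elem [fw ^ n - fv ^ n, 1, 1]"

definition gamma :: "nat \<Rightarrow> nat \<Rightarrow> free_alg tensor" where
  "gamma n = (\<lambda>j. if j = 0 then gamma2 n else if j = 1 then gamma0 n else 0)"

section \<open>Completion of a seminormed space\<close>

text \<open>For a subspace \<open>V\<close> of a complex vector space with a seminorm \<open>\<nu>\<close> on \<open>V\<close>, the elements of the
  completion are the Cauchy sequences in \<open>V\<close> modulo null sequences.\<close>

definition cauchy_seqs :: "'a::complex_vector set \<Rightarrow> ('a \<Rightarrow> real) \<Rightarrow> (nat \<Rightarrow> 'a) set" where
  "cauchy_seqs V \<nu> = {s. (\<forall>i. s i \<in> V) \<and> (\<forall>e>0. \<exists>N. \<forall>i\<ge>N. \<forall>j\<ge>N. \<nu> (s i - s j) < e)}"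

definition null_rel ::
  "'a::complex_vector set \<Rightarrow> ('a \<Rightarrow> real) \<Rightarrow> ((nat \<Rightarrow> 'a) \<times> (nat \<Rightarrow> 'a)) set" where
  "null_rel V \<nu> = {(s, s'). s \<in> cauchy_seqs V \<nu> \<and> s' \<in> cauchy_seqs V \<nu> \<and>
     (\<lambda>i. \<nu> (s i - s' i)) \<longlonglongrightarrow> 0}"

definition completion :: "'a::complex_vector set \<Rightarrow> ('a \<Rightarrow> real) \<Rightarrow> (nat \<Rightarrow> 'a) set set" where
  "completion V \<nu> = cauchy_seqs V \<nu> // null_rel V \<nu>"

definition completion_emb ::
  "'a::complex_vector set \<Rightarrow> ('a \<Rightarrow> real) \<Rightarrow> 'a \<Rightarrow> (nat \<Rightarrow> 'a) set" where
  "completion_emb V \<nu> x = null_rel V \<nu> `` {\<lambda>_. x}"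

definition completion_add :: "'a::complex_vector set \<Rightarrow> ('a \<Rightarrow> real) \<Rightarrow>
    (nat \<Rightarrow> 'a) set \<Rightarrow> (nat \<Rightarrow> 'a) set \<Rightarrow> (nat \<Rightarrow> 'a) set" where
  "completion_add V \<nu> c d = null_rel V \<nu> `` {\<lambda>i. s i + s' i | s s'. s \<in> c \<and> s' \<in> d}"

definition completion_scale :: "'a::complex_vector set \<Rightarrow> ('a \<Rightarrow> real) \<Rightarrow>
    complex \<Rightarrow> (nat \<Rightarrow> 'a) set \<Rightarrow> (nat \<Rightarrow> 'a) set" where
  "completion_scale V \<nu> a c = null_rel V \<nu> `` {\<lambda>i. a *\<^sub>C s i | s. s \<in> c}"

definition completion_norm :: "('a \<Rightarrow> real) \<Rightarrow> (nat \<Rightarrow> 'a) set \<Rightarrow> real" where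
  "completion_norm \<nu> c = (THE r. \<forall>s\<in>c. (\<lambda>i. \<nu> (s i)) \<longlonglongrightarrow> r)"

text \<open>The continuous extension to completions of a bounded linear map \<open>f\<close>, with target \<open>(W, \<mu>)\<close>.\<close>

definition completion_map :: "'b::complex_vector set \<Rightarrow> ('b \<Rightarrow> real) \<Rightarrow>
    ('a \<Rightarrow> 'b) \<Rightarrow> (nat \<Rightarrow> 'a) set \<Rightarrow> (nat \<Rightarrow> 'b) set" where
  "completion_map W \<mu> f c = null_rel W \<mu> `` ((\<lambda>s i. f (s i)) ` c)"

definition completion_dual ::
  "'a::complex_vector set \<Rightarrow> ('a \<Rightarrow> real) \<Rightarrow> ((nat \<Rightarrow> 'a) set \<Rightarrow> complex) set" where
  "completion_dual V \<nu> = {\<phi> \<in> extensional (completion V \<nu>).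
     (\<forall>c\<in>completion V \<nu>. \<forall>d\<in>completion V \<nu>. \<phi> (completion_add V \<nu> c d) = \<phi> c + \<phi> d) \<and>
     (\<forall>a. \<forall>c\<in>completion V \<nu>. \<phi> (completion_scale V \<nu> a c) = a * \<phi> c) \<and>
     (\<exists>C. \<forall>c\<in>completion V \<nu>. cmod (\<phi> c) \<le> C * completion_norm \<nu> c)}"

section \<open>The complex K\<close>

definition admissible :: "nat \<Rightarrow> 'h::complex_hilbert bounded_op list \<Rightarrow> bool" where
  "admissible m xs \<longleftrightarrow> length xs = m + 1 \<and> (\<forall>i\<le>m. prod_list (drop i xs @ take i xs) \<in> trace_class)"

definition K_pre :: "nat \<Rightarrow> 'h::complex_hilbert bounded_op tensor set" where
  "K_pre m = cvec.span {elem xs | xs. admissible m xs}"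

definition K_weight :: "'h::complex_hilbert bounded_op list \<Rightarrow> real" where
  "K_weight xs = (\<Sum>i<length xs. trace_norm (tensor_mult ((cyclic_t ^^ i) (elem xs))))
     + prod_list (map op_norm xs)"

definition K_norm :: "nat \<Rightarrow> 'h::complex_hilbert bounded_op tensor \<Rightarrow> real" where
  "K_norm m x = Inf {\<Sum>xs\<leftarrow>L. K_weight xs | L. (\<forall>xs\<in>set L. admissible m xs) \<and> x = (\<Sum>xs\<leftarrow>L. elem xs)}"

type_synonym 'h K_elt = "(nat \<Rightarrow> 'h bounded_op tensor) set"

definition K_space :: "nat \<Rightarrow> 'h::complex_hilbert K_elt set" where
  "K_space m = completion (K_pre m) (K_norm m)"

definition K_emb :: "nat \<Rightarrow> 'h::complex_hilbert bounded_op tensor \<Rightarrow> 'h K_elt" where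
  "K_emb m = completion_emb (K_pre m) (K_norm m)"

text \<open>\<open>K_b m\<close> is the boundary from degree \<open>m + 1\<close> to degree \<open>m\<close>.\<close>

definition K_b :: "nat \<Rightarrow> 'h::complex_hilbert K_elt \<Rightarrow> 'h K_elt" where
  "K_b m = completion_map (K_pre m) (K_norm m) hochschild_b"

definition K_dual :: "nat \<Rightarrow> ('h::complex_hilbert K_elt \<Rightarrow> complex) set" where
  "K_dual m = completion_dual (K_pre m) (K_norm m)"

text \<open>The total complex is \<open>K\<^sub>0\<close> in degree \<open>0\<close> and \<open>K\<^sub>1\<close> in degree \<open>1\<close>, so that
  \<open>HC\<^sub>0(K) = K\<^sub>0 / b(K\<^sub>1)\<close> and \<open>HC\<^sup>0(K)\<close> consists of the functionals vanishing on \<open>b(K\<^sub>1)\<close>.\<close>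

definition HC0_rel :: "('h::complex_hilbert K_elt \<times> 'h K_elt) set" where
  "HC0_rel = {(c, d). c \<in> K_space 0 \<and> d \<in> K_space 0 \<and>
     (\<exists>e\<in>K_space 1. d = completion_add (K_pre 0) (K_norm 0) c (K_b 0 e))}"

definition HC_lower_0 :: "'h::complex_hilbert K_elt set set" where
  "HC_lower_0 = K_space 0 // HC0_rel"

definition HC0_class :: "'h::complex_hilbert K_elt \<Rightarrow> 'h K_elt set" where
  "HC0_class c = HC0_rel `` {c}"

definition HC_upper_0 :: "('h::complex_hilbert K_elt \<Rightarrow> complex) set" where
  "HC_upper_0 = {\<phi> \<in> K_dual 0. \<forall>c\<in>K_space 1. \<phi> (K_b 0 c) = 0}"

definition HC_pairing :: "('h::complex_hilbert K_elt \<Rightarrow> complex) \<Rightarrow> 'h K_elt set \<Rightarrow> complex" where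
  "HC_pairing \<phi> h = the_elem (\<phi> ` h)"

text \<open>The operator trace on \<open>K\<^sub>0\<close>, i.e. the continuous extension of \<open>x \<mapsto> Tr x\<close> from \<open>K_pre 0\<close>, which
  \<open>tensor_mult\<close> identifies with the trace class operators.\<close>

definition Tr_K :: "'h::complex_hilbert K_elt \<Rightarrow> complex" where
  "Tr_K = (\<lambda>c\<in>K_space 0. THE z. \<forall>s\<in>c. (\<lambda>i. op_trace (tensor_mult (s i))) \<longlonglongrightarrow> z)"

text \<open>The map induced by \<open>\<pi>\<close> from degree \<open>0\<close> chains, whose only component is the one with
  index \<open>0\<close>, to \<open>K\<^sub>0\<close>.\<close>

definition pi_K :: "(free_alg \<Rightarrow> 'h::complex_hilbert bounded_op) \<Rightarrow> (nat \<Rightarrow> free_alg tensor) \<Rightarrow> 'h K_elt"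
  where "pi_K \<pi> z = K_emb 0 (tensor_map \<pi> (z 0))"

end

theory Submission
  imports Defs
begin

text \<open>
  The class of \<open>(\<pi> \<circ> S) \<gamma>\<close> is represented by the operator \<open>\<pi> (w\<^sup>n - v\<^sup>n) = (1 - T\<^sup>* T)\<^sup>n - (1 - T T\<^sup>*)\<^sup>n\<close>,
  so evaluating the trace on it gives the homological index. What has to be proved is that the
  objects involved are of the required kind: \<open>\<gamma>\<close> is a cycle, the trace is a bounded functional on the
  completion \<open>K\<^sub>0\<close>, and it vanishes on \<open>b (K\<^sub>1)\<close>, so that its value depends only on the homology class.

  The cycle property (\<open>gamma_cycle\<close>) is a computation with elementary tensors. It rests on the
  intertwining relations \<open>w\<^sup>n y = y v\<^sup>n\<close> and \<open>v\<^sup>n x = x w\<^sup>n\<close> and on the telescoping products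
  \<open>\<omega>\<^sub>n y = 1 - v\<^sup>n\<close> and \<open>y \<omega>\<^sub>n = 1 - w\<^sup>n\<close>.

  The analytic core is \<open>op_trace_commute\<close>: \<open>Tr (A B) = Tr (B A)\<close> for bounded \<open>A\<close>, \<open>B\<close> whose two products
  are trace class, although neither factor need be. This is exactly the statement that the trace
  vanishes on the Hochschild boundary of a generator \<open>A \<otimes> B\<close> of \<open>K\<^sub>1\<close>. A spectral cut-off that makes \<open>A\<close>
  invertible would reduce it to the case of one trace class factor. The proof here uses polynomials
  in \<open>A\<^sup>* A\<close> in place of spectral projections: with \<open>D = 1 - A\<^sup>* A\<close> for a contraction \<open>A\<close>, the operators
  \<open>A D\<^sup>k\<close> tend to \<open>0\<close> (\<open>power_decay\<close>), and \<open>1 - D\<^sup>k\<close> is divisible by \<open>A\<^sup>* A\<close>. The same polynomials yield a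
  factorization of a trace class operator into two Hilbert-Schmidt operators
  (\<open>trace_class_factorization\<close>). It reduces the summability of the diagonal, the bound of the trace by
  the trace norm, and the case of one trace class factor to the inner product of Hilbert-Schmidt
  operators, for which the trace property is Parseval's identity (\<open>hs_inner_adj\<close>).

  Adjoints, absolute values and the basis used by the trace are given by descriptions and choices.
  Their existence comes from minimisation over closed subspaces
  (\<open>riesz_representation_on_subspace\<close>), from a fixed point iteration for square roots
  (\<open>ex_sqrt_one_minus\<close>), and from Zorn's lemma (\<open>ex_onb\<close>).

  Finally, the trace and \<open>b\<close> are extended to the completions: the norm on \<open>K\<^sub>m\<close> dominates the trace norms
  of the cyclically permuted products, so the trace has norm at most \<open>1\<close> and \<open>b\<close> from \<open>K\<^sub>1\<close> to \<open>K\<^sub>0\<close> has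
  norm at most \<open>2\<close>.
\<close>

section \<open>Linear maps on tensors\<close>

lemma multilinearI:
  assumes "\<And>xs a b ys. g (xs @ (a + b) # ys) = g (xs @ a # ys) + g (xs @ b # ys)"
    and "\<And>xs c a ys. g (xs @ (c *\<^sub>C a) # ys) = c *\<^sub>C g (xs @ a # ys)"
  shows "multilinear g"
  using assms by (simp add: multilinear_def)

lemma multilinear_addD: "multilinear g \<Longrightarrow> g (xs @ (a + b) # ys) = g (xs @ a # ys) + g (xs @ b # ys)"
  and multilinear_scaleD: "multilinear g \<Longrightarrow> g (xs @ (c *\<^sub>C a) # ys) = c *\<^sub>C g (xs @ a # ys)"
  by (simp_all add: multilinear_def)

lemma multilinear_elem: "multilinear (elem :: 'a::complex_vector list \<Rightarrow> _)"
proof (rule multilinearI)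
  fix xs ys :: "'a list" and a b :: 'a and c :: complex
  show "elem (xs @ (a + b) # ys) = elem (xs @ a # ys) + elem (xs @ b # ys)"
  proof transfer
    fix xs ys :: "'a list" and a b :: 'a
    have "Poly_Mapping.single (xs @ (a + b) # ys) 1 - Poly_Mapping.single (xs @ a # ys) 1
        - Poly_Mapping.single (xs @ b # ys) (1::complex) \<in> tensor_relations"
      unfolding tensor_relations_def by blast
    then show "tensor_eq (Poly_Mapping.single (xs @ (a + b) # ys) 1)
        (Poly_Mapping.single (xs @ a # ys) 1 + Poly_Mapping.single (xs @ b # ys) 1)"
      by (simp add: tensor_eq_def cvec.span_base diff_diff_eq)
  qed
  show "elem (xs @ (c *\<^sub>C a) # ys) = c *\<^sub>C elem (xs @ a # ys)"
  proof transfer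
    fix xs ys :: "'a list" and a :: 'a and c :: complex
    have "Poly_Mapping.single (xs @ (c *\<^sub>C a) # ys) 1
        - c *\<^sub>C Poly_Mapping.single (xs @ a # ys) (1::complex) \<in> tensor_relations"
      unfolding tensor_relations_def by blast
    then show "tensor_eq (Poly_Mapping.single (xs @ (c *\<^sub>C a) # ys) 1)
        (c *\<^sub>C Poly_Mapping.single (xs @ a # ys) 1)"
      by (simp add: tensor_eq_def cvec.span_base)
  qed
qed

lemma tensor_rel_rep: "tensor_eq (rep_tensor (abs_tensor p)) p"
  by (simp add: tensor.abs_eq_iff[symmetric] Quotient3_abs_rep[OF Quotient3_tensor])

lemma abs_tensor_rep [simp]: "abs_tensor (rep_tensor z) = z"
  by (rule Quotient3_abs_rep[OF Quotient3_tensor])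

lemma tensor_lift_add:
  assumes "multilinear g"
  shows "tensor_lift g (x + y) = tensor_lift g x + tensor_lift g y"
proof -
  have "x + y = abs_tensor (rep_tensor x + rep_tensor y)"
    by (simp add: plus_tensor.abs_eq[symmetric])
  then have "tensor_eq (rep_tensor (x + y)) (rep_tensor x + rep_tensor y)"
    by (simp add: tensor_rel_rep)
  then show ?thesis
    using free_extension_tensor_eq[OF assms] free_extension_add
    unfolding tensor_lift_def by metis
qed

lemma tensor_lift_scaleC:
  assumes "multilinear g"
  shows "tensor_lift g (c *\<^sub>C x) = c *\<^sub>C tensor_lift g x"
proof -
  have "c *\<^sub>C x = abs_tensor (c *\<^sub>C rep_tensor x)"
    by (simp add: scaleC_tensor.abs_eq[symmetric])
  then have "tensor_eq (rep_tensor (c *\<^sub>C x)) (c *\<^sub>C rep_tensor x)"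
    by (simp add: tensor_rel_rep)
  then show ?thesis
    using free_extension_tensor_eq[OF assms] free_extension_scaleC
    unfolding tensor_lift_def by metis
qed

lemma additive_simps:
  fixes f :: "'a::ab_group_add \<Rightarrow> 'b::ab_group_add"
  assumes add: "\<And>x y. f (x + y) = f x + f y"
  shows "f 0 = 0" "f (- x) = - f x" "f (x - y) = f x - f y" "f (\<Sum>i\<in>A. h i) = (\<Sum>i\<in>A. f (h i))"
    "f (\<Sum>j\<leftarrow>L. k j) = (\<Sum>j\<leftarrow>L. f (k j))"
proof -
  show zero: "f 0 = 0" using add[of 0 0] by simp
  show neg: "f (- x) = - f x" for x
    using add[of x "- x"] zero by (simp add: eq_neg_iff_add_eq_0 add.commute)
  show "f (x - y) = f x - f y" using add[of x "- y"] neg by simp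
  show "f (\<Sum>i\<in>A. h i) = (\<Sum>i\<in>A. f (h i))"
    by (induction A rule: infinite_finite_induct) (simp_all add: zero add)
  show "f (\<Sum>j\<leftarrow>L. k j) = (\<Sum>j\<leftarrow>L. f (k j))"
    by (induction L) (simp_all add: zero add)
qed

lemma tensor_lift_linear:
  assumes "multilinear g"
  shows "tensor_lift g (x + y) = tensor_lift g x + tensor_lift g y"
    "tensor_lift g (c *\<^sub>C x) = c *\<^sub>C tensor_lift g x"
    "tensor_lift g 0 = 0" "tensor_lift g (- x) = - tensor_lift g x"
    "tensor_lift g (x - y) = tensor_lift g x - tensor_lift g y"
    "tensor_lift g (\<Sum>j\<leftarrow>L. k j) = (\<Sum>j\<leftarrow>L. tensor_lift g (k j))"
  by (rule tensor_lift_add tensor_lift_scaleC additive_simps assms)+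

lemma scaleC_algebra_simps:
  fixes x :: "'a::complex_vector"
  shows "(- c) *\<^sub>C x = - (c *\<^sub>C x)" "c *\<^sub>C (- x) = - (c *\<^sub>C x)" "0 *\<^sub>C x = 0" "c *\<^sub>C (0::'a) = 0"
    "c *\<^sub>C (x - y) = c *\<^sub>C x - c *\<^sub>C y"
  by (simp_all add: cvec.scale_right_diff_distrib)

lemma elem_linear_simps:
  "elem ((a + b) # ys) = elem (a # ys) + elem (b # ys)"
  "elem ((a - b) # ys) = elem (a # ys) - elem (b # ys)"
  "elem (- a # ys) = - elem (a # ys)"
  "elem ((c *\<^sub>C a) # ys) = c *\<^sub>C elem (a # ys)"
  "elem (x # (a + b) # ys) = elem (x # a # ys) + elem (x # b # ys)"
  "elem (x # (a - b) # ys) = elem (x # a # ys) - elem (x # b # ys)"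
  "elem (x # (- a) # ys) = - elem (x # a # ys)"
proof -
  have add: "elem (xs @ (a + b) # ys) = elem (xs @ a # ys) + elem (xs @ b # ys)" for xs a b
    by (rule multilinear_addD[OF multilinear_elem])
  note 1 = add[of "[]", simplified] and 2 = add[of "[x]", simplified]
  show "elem ((a + b) # ys) = elem (a # ys) + elem (b # ys)"
    "elem (x # (a + b) # ys) = elem (x # a # ys) + elem (x # b # ys)" by (rule 1 2)+
  show "elem ((a - b) # ys) = elem (a # ys) - elem (b # ys)" "elem (- a # ys) = - elem (a # ys)"
    using additive_simps[of "\<lambda>a. elem (a # ys)", OF 1] by auto
  show "elem (x # (a - b) # ys) = elem (x # a # ys) - elem (x # b # ys)"
    "elem (x # (- a) # ys) = - elem (x # a # ys)"
    using additive_simps[of "\<lambda>a. elem (x # a # ys)", OF 2] by auto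
  show "elem ((c *\<^sub>C a) # ys) = c *\<^sub>C elem (a # ys)"
    using multilinear_scaleD[OF multilinear_elem, of "[]"] by simp
qed

lemma multilinear_scaleC: "multilinear g \<Longrightarrow> multilinear (\<lambda>xs. c *\<^sub>C g xs)"
  by (simp add: multilinear_def scaleC_add_right scaleC_scaleC mult.commute)

lemma multilinear_add: "multilinear g \<Longrightarrow> multilinear h \<Longrightarrow> multilinear (\<lambda>xs. g xs + h xs)"
  by (simp add: multilinear_def scaleC_add_right algebra_simps)

text \<open>Multilinearity compares lists of equal length only, so coefficients and the range of a
  summation may depend on the length.\<close>

lemma multilinear_length_scaleC:
  "multilinear g \<Longrightarrow> multilinear (\<lambda>xs. (c (length xs) :: complex) *\<^sub>C g xs)"
  by (simp add: multilinear_def scaleC_add_right scaleC_scaleC mult.commute)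

lemma multilinear_length_sum:
  assumes "\<And>i. multilinear (\<lambda>xs. if i < f (length xs) then g i xs else 0)"
  shows "multilinear (\<lambda>xs. \<Sum>i<(f (length xs) :: nat). g i xs)"
proof (rule multilinearI)
  fix xs ys :: "'a list" and a b :: 'a and c :: complex
  let ?n = "f (Suc (length xs + length ys))"
  have "g i (xs @ (a + b) # ys) = g i (xs @ a # ys) + g i (xs @ b # ys)" if "i < ?n" for i
    using multilinear_addD[OF assms[of i], of xs a b ys] that by simp
  then show "(\<Sum>i<f (length (xs @ (a + b) # ys)). g i (xs @ (a + b) # ys)) =
      (\<Sum>i<f (length (xs @ a # ys)). g i (xs @ a # ys)) +
      (\<Sum>i<f (length (xs @ b # ys)). g i (xs @ b # ys))"
    by (simp add: sum.distrib[symmetric])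
  have "g i (xs @ (c *\<^sub>C a) # ys) = c *\<^sub>C g i (xs @ a # ys)" if "i < ?n" for i
    using multilinear_scaleD[OF assms[of i], of xs c a ys] that by simp
  then show "(\<Sum>i<f (length (xs @ (c *\<^sub>C a) # ys)). g i (xs @ (c *\<^sub>C a) # ys)) =
      c *\<^sub>C (\<Sum>i<f (length (xs @ a # ys)). g i (xs @ a # ys))"
    by (simp add: cvec.scale_sum_right)
qed

lemma multilinear_elem_map:
  assumes "\<And>x y. f (x + y) = f x + f y" "\<And>c x. f (c *\<^sub>C x) = c *\<^sub>C f x"
  shows "multilinear (\<lambda>xs. elem (map f xs))"
  by (rule multilinearI)
    (simp_all add: assms multilinear_addD[OF multilinear_elem] multilinear_scaleD[OF multilinear_elem])

lemma multilinear_prod_list: "multilinear (prod_list :: 'a::complex_algebra_1 list \<Rightarrow> 'a)"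
  by (rule multilinearI)
    (simp_all add: distrib_left distrib_right scaleC_mult_left scaleC_mult_right)

lemma multilinear_elem_Cons: "multilinear (\<lambda>xs. elem (z # xs))"
  by (rule multilinearI)
    (simp_all only: append_Cons[symmetric] multilinear_addD[OF multilinear_elem]
      multilinear_scaleD[OF multilinear_elem])

lemma multilinear_elem_rotate:
  "multilinear (\<lambda>xs :: 'a::complex_vector list. elem (last xs # butlast xs))"
proof (rule multilinearI)
  fix xs ys :: "'a list" and a b :: 'a and c :: complex
  have add: "elem (us @ (a + b) # vs) = elem (us @ a # vs) + elem (us @ b # vs)" for us vs
    by (rule multilinear_addD[OF multilinear_elem])
  have scale: "elem (us @ (c *\<^sub>C a) # vs) = c *\<^sub>C elem (us @ a # vs)" for us vs
    by (rule multilinear_scaleD[OF multilinear_elem])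
  show "elem (last (xs @ (a + b) # ys) # butlast (xs @ (a + b) # ys)) =
    elem (last (xs @ a # ys) # butlast (xs @ a # ys)) + elem (last (xs @ b # ys) # butlast (xs @ b # ys))"
    using add[of "[]" xs] add[of "last ys # xs" "butlast ys"] by (cases "ys = []") (auto simp: butlast_append)
  show "elem (last (xs @ (c *\<^sub>C a) # ys) # butlast (xs @ (c *\<^sub>C a) # ys)) =
    c *\<^sub>C elem (last (xs @ a # ys) # butlast (xs @ a # ys))"
    using scale[of "[]" xs] scale[of "last ys # xs" "butlast ys"] by (cases "ys = []") (auto simp: butlast_append)
qed

lemma linear_entryI:
  "(\<And>a. f a = ps @ (l * a * r) # qs) \<Longrightarrow> \<exists>ps qs l r. \<forall>a. f a = ps @ (l * a * r) # qs"
  by blast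

text \<open>An inner face of \<open>us @ a # vs\<close> multiplies two neighbours on the left of \<open>a\<close>, the entry \<open>a\<close>
  with its left or right neighbour, or two neighbours on the right of \<open>a\<close>; in all cases it is an
  elementary tensor with one entry depending linearly on \<open>a\<close>.\<close>

lemma inner_face_linear_entry:
  fixes us vs :: "'a::complex_algebra_1 list"
  assumes "i < length us + length vs"
  shows "\<exists>ps qs l r. \<forall>a. take i (us @ a # vs) @
     ((us @ a # vs) ! i * (us @ a # vs) ! (i + 1)) # drop (i + 2) (us @ a # vs)
     = ps @ (l * a * r) # qs"
proof -
  consider "i + 1 < length us" | "i + 1 = length us" | "i = length us" | "i > length us" by linarith
  then show ?thesis
  proof cases
    case 1
    then show ?thesis
      by (intro linear_entryI[of _ "take i us @ (us ! i * us ! (i+1)) # drop (i+2) us" 1 1 vs])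
        (auto simp: nth_append)
  next
    case 2
    then show ?thesis
      by (intro linear_entryI[of _ "take i us" "us ! i" 1 vs]) (auto simp: nth_append)
  next
    case 3
    then show ?thesis using assms
      by (intro linear_entryI[of _ us 1 "vs ! 0" "drop 1 vs"]) (auto simp: nth_append)
  next
    case 4
    define k where "k = i - length us - 1"
    have i: "i = length us + Suc k" using 4 by (simp add: k_def)
    show ?thesis using assms unfolding i
      by (intro linear_entryI[of _ us 1 1 "take k vs @ (vs ! k * vs ! (k+1)) # drop (k+2) vs"])
        (auto simp: nth_append numeral_3_eq_3)
  qed
qed

lemma outer_face_linear_entry:
  fixes us vs :: "'a::complex_algebra_1 list"
  assumes "length us + length vs > 0"
  defines "k \<equiv> length us + length vs"
  shows "\<exists>ps qs l r. \<forall>a. ((us @ a # vs) ! k * (us @ a # vs) ! 0) #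
     take (k - 1) (drop 1 (us @ a # vs)) = ps @ (l * a * r) # qs"
proof (cases us)
  case Nil
  then show ?thesis using assms(1)
    by (intro linear_entryI[of _ "[]" "vs ! (k-1)" 1 "take (k-1) vs"])
      (auto simp: k_def nth_Cons')
next
  case (Cons u us')
  show ?thesis
  proof (cases vs rule: rev_cases)
    case Nil
    then show ?thesis using Cons
      by (intro linear_entryI[of _ "[]" 1 u us'])
        (auto simp: k_def nth_append)
  next
    case (snoc vs' v)
    then show ?thesis using Cons
      by (intro linear_entryI[of _ "(v * u) # us'" 1 1 vs'])
        (auto simp: k_def nth_append nth_Cons')
  qed
qed

lemma elem_linear_entry:
  fixes f :: "'a::complex_algebra_1 \<Rightarrow> 'a list"
  assumes "\<forall>a. f a = ps @ (l * a * r) # qs"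
  shows "elem (f (a + b)) = elem (f a) + elem (f b)" "elem (f (c *\<^sub>C a)) = c *\<^sub>C elem (f a)"
  by (simp_all add: assms distrib_left distrib_right scaleC_mult_left scaleC_mult_right
      multilinear_addD[OF multilinear_elem] multilinear_scaleD[OF multilinear_elem])

text \<open>The Hochschild boundary of an elementary tensor.\<close>

definition face_sum :: "'a::complex_algebra_1 list \<Rightarrow> 'a tensor" where
  "face_sum xs = (if length xs \<le> 1 then 0 else
     let k = length xs - 1 in
       (\<Sum>i<k. (-1) ^ i *\<^sub>C elem (take i xs @ (xs ! i * xs ! (i + 1)) # drop (i + 2) xs))
       + (-1) ^ k *\<^sub>C elem ((xs ! k * xs ! 0) # take (k - 1) (drop 1 xs)))"

lemma multilinear_face_sum: "multilinear face_sum"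
proof -
  let ?d = "\<lambda>i xs::'a list. elem (take i xs @ (xs ! i * xs ! (i + 1)) # drop (i + 2) xs)"
  let ?e = "\<lambda>xs::'a list. if length xs \<le> 1 then 0 else
     elem ((xs ! (length xs - 1) * xs ! 0) # take (length xs - 1 - 1) (drop 1 xs))"
  have inner: "multilinear (\<lambda>xs. if i < length xs - 1 then ?d i xs else 0)" for i
  proof (rule multilinearI)
    fix us vs :: "'a list" and a b :: 'a and c :: complex
    show "(if i < length (us @ (a + b) # vs) - 1 then ?d i (us @ (a + b) # vs) else 0) =
      (if i < length (us @ a # vs) - 1 then ?d i (us @ a # vs) else 0) +
      (if i < length (us @ b # vs) - 1 then ?d i (us @ b # vs) else 0)"
    proof (cases "i < length us + length vs")
      case True
      from inner_face_linear_entry[OF this] obtain ps qs l r where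
        *: "\<forall>a. take i (us @ a # vs) @
         ((us @ a # vs) ! i * (us @ a # vs) ! (i + 1)) # drop (i + 2) (us @ a # vs)
         = ps @ (l * a * r) # qs" by blast
      from elem_linear_entry(1)[OF *] True show ?thesis by simp
    qed simp
    show "(if i < length (us @ (c *\<^sub>C a) # vs) - 1 then ?d i (us @ (c *\<^sub>C a) # vs) else 0) =
      c *\<^sub>C (if i < length (us @ a # vs) - 1 then ?d i (us @ a # vs) else 0)"
    proof (cases "i < length us + length vs")
      case True
      from inner_face_linear_entry[OF this] obtain ps qs l r where
        *: "\<forall>a. take i (us @ a # vs) @
         ((us @ a # vs) ! i * (us @ a # vs) ! (i + 1)) # drop (i + 2) (us @ a # vs)
         = ps @ (l * a * r) # qs" by blast
      from elem_linear_entry(2)[OF *] True show ?thesis by simp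
    qed simp
  qed
  have outer: "multilinear ?e"
  proof (rule multilinearI)
    fix us vs :: "'a list" and a b :: 'a and c :: complex
    show "?e (us @ (a + b) # vs) = ?e (us @ a # vs) + ?e (us @ b # vs)"
    proof (cases "length us + length vs > 0")
      case True
      have len: "length (us @ x # vs) - 1 = length us + length vs" "(length (us @ x # vs) \<le> 1) = False" for x
        using True by simp_all
      from outer_face_linear_entry[OF True] obtain ps qs l r where
        *: "\<forall>a. ((us @ a # vs) ! (length us + length vs) * (us @ a # vs) ! 0) #
           take (length us + length vs - 1) (drop 1 (us @ a # vs)) = ps @ (l * a * r) # qs" by blast
      show ?thesis by (simp only: len if_False elem_linear_entry(1)[OF *])
    qed simp
    show "?e (us @ (c *\<^sub>C a) # vs) = c *\<^sub>C ?e (us @ a # vs)"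
    proof (cases "length us + length vs > 0")
      case True
      have len: "length (us @ x # vs) - 1 = length us + length vs" "(length (us @ x # vs) \<le> 1) = False" for x
        using True by simp_all
      from outer_face_linear_entry[OF True] obtain ps qs l r where
        *: "\<forall>a. ((us @ a # vs) ! (length us + length vs) * (us @ a # vs) ! 0) #
           take (length us + length vs - 1) (drop 1 (us @ a # vs)) = ps @ (l * a * r) # qs" by blast
      show ?thesis by (simp only: len if_False elem_linear_entry(2)[OF *])
    qed simp
  qed
  have "multilinear (\<lambda>xs. if i < length xs - 1 then (-1) ^ i *\<^sub>C ?d i xs else 0)" for i
    using multilinear_scaleC[OF inner[of i], of "(-1)^i"] by (simp add: if_distrib cong: if_cong)
  from multilinear_add[OF multilinear_length_sum[where f = "\<lambda>n. n - 1", OF this]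
      multilinear_length_scaleC[OF outer, of "\<lambda>n. (-1) ^ (n - 1)"]]
  have "multilinear (\<lambda>xs. (\<Sum>i<length xs - 1. (-1) ^ i *\<^sub>C ?d i xs) + (-1) ^ (length xs - 1) *\<^sub>C ?e xs)" .
  moreover have "face_sum = (\<lambda>xs. (\<Sum>i<length xs - 1. (-1) ^ i *\<^sub>C ?d i xs) + (-1) ^ (length xs - 1) *\<^sub>C ?e xs)"
    by (auto simp: fun_eq_iff face_sum_def Let_def)
  ultimately show ?thesis by simp
qed

lemma hochschild_b_lift: "hochschild_b = tensor_lift face_sum"
  unfolding hochschild_b_def face_sum_def ..

lemmas hochschild_b_linear = tensor_lift_linear[OF multilinear_face_sum, folded hochschild_b_lift]

lemma hochschild_b_elem:
  "hochschild_b (elem [x]) = 0"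
  "hochschild_b (elem [x, y]) = elem [x * y] - elem [y * x]"
  "hochschild_b (elem [x, y, z]) = elem [x * y, z] - elem [x, y * z] + elem [z * x, y]"
  by (simp_all add: hochschild_b_lift tensor_lift_elem[OF multilinear_face_sum] face_sum_def
      numeral_2_eq_2 scaleC_one scaleC_algebra_simps)

lemma multilinear_cyclic_t:
  "multilinear (\<lambda>xs :: 'a::complex_vector list. (-1) ^ (length xs - 1) *\<^sub>C elem (last xs # butlast xs))"
  by (rule multilinear_length_scaleC[OF multilinear_elem_rotate, of "\<lambda>n. (-1) ^ (n - 1)"])

lemmas cyclic_t_linear = tensor_lift_linear[OF multilinear_cyclic_t, folded cyclic_t_def]

lemma cyclic_t_elem: "cyclic_t (elem [x]) = elem [x]" "cyclic_t (elem [x, y]) = - elem [y, x]"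
  unfolding cyclic_t_def tensor_lift_elem[OF multilinear_cyclic_t]
  by (simp_all add: scaleC_one scaleC_algebra_simps)

lemma cyclic_t_power_linear:
  "(cyclic_t ^^ i) (x + y) = (cyclic_t ^^ i) x + (cyclic_t ^^ i) y"
  "(cyclic_t ^^ i) (c *\<^sub>C x) = c *\<^sub>C (cyclic_t ^^ i) x"
  by (induction i) (simp_all add: cyclic_t_linear)

lemma multilinear_cyclic_N:
  "multilinear (\<lambda>xs :: 'a::complex_vector list. \<Sum>i<length xs. (cyclic_t ^^ i) (elem xs))"
proof (rule multilinear_length_sum[where f = "\<lambda>n. n"])
  fix i
  have "multilinear (elem :: 'a list \<Rightarrow> _)" by (rule multilinear_elem)
  then show "multilinear (\<lambda>xs::'a list. if i < length xs then (cyclic_t ^^ i) (elem xs) else 0)"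
    by (simp add: multilinear_def cyclic_t_power_linear)
qed

lemma connes_B_elem: "connes_B (elem [x]) = elem [1, x] + elem [x, 1]"
  by (simp add: connes_B_def cyclic_N_def tensor_lift_elem[OF multilinear_cyclic_N] cyclic_s_def
      tensor_lift_elem[OF multilinear_elem_Cons] cyclic_t_elem)

lemma connes_B_zero: "connes_B 0 = 0"
  by (simp add: connes_B_def cyclic_N_def cyclic_s_def tensor_lift_linear[OF multilinear_cyclic_N]
      tensor_lift_linear[OF multilinear_elem_Cons] cyclic_t_linear)

lemmas tensor_mult_linear = tensor_lift_linear[OF multilinear_prod_list, folded tensor_mult_def]

lemma tensor_mult_elem: "tensor_mult (elem xs) = prod_list xs"
  by (simp add: tensor_mult_def tensor_lift_elem[OF multilinear_prod_list])

lemma algebra_homD: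
  assumes "algebra_hom f"
  shows "f (x + y) = f x + f y" "f (c *\<^sub>C x) = c *\<^sub>C f x" "f (x * y) = f x * f y" "f 1 = 1"
    "f (x - y) = f x - f y" "f (x ^ n) = f x ^ n"
proof -
  show add: "f (x + y) = f x + f y" "f (c *\<^sub>C x) = c *\<^sub>C f x"
    and mult: "f (x * y) = f x * f y" "f 1 = 1" for x y
    using assms by (auto simp: algebra_hom_def)
  show "f (x - y) = f x - f y" by (rule additive_simps(3)) (rule add(1))
  show "f (x ^ n) = f x ^ n" by (induction n) (simp_all add: mult)
qed

lemma tensor_map_elem:
  assumes "algebra_hom f"
  shows "tensor_map f (elem xs) = elem (map f xs)"
  unfolding tensor_map_def
  by (rule tensor_lift_elem[OF multilinear_elem_map]) (rule algebra_homD[OF assms])+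

section \<open>The cycle in the free algebra\<close>

lemma power_intertwine:
  fixes a b c :: "'a::monoid_mult"
  assumes "a * c = c * b"
  shows "a ^ n * c = c * b ^ n"
proof (induction n)
  case (Suc n)
  have "a ^ Suc n * c = a * (a ^ n * c)" by (simp add: mult.assoc)
  also have "\<dots> = c * b ^ Suc n" by (simp add: Suc mult.assoc[symmetric] assms)
  finally show ?case .
qed simp

lemma fw_power_fy: "fw ^ n * fy = fy * fv ^ n"
  by (rule power_intertwine) (simp add: fv_def fw_def left_diff_distrib right_diff_distrib mult.assoc)

lemma fv_power_fx: "fv ^ n * fx = fx * fw ^ n"
  by (rule power_intertwine) (simp add: fv_def fw_def left_diff_distrib right_diff_distrib mult.assoc)

lemma fv_power_omega: "fv ^ n * omega m = omega m * fw ^ n"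
proof -
  have "fv ^ n * (fv ^ i * fx) = fv ^ i * fx * fw ^ n" for i
    by (simp add: mult.assoc fv_power_fx[symmetric])
      (simp add: mult.assoc[symmetric] power_add[symmetric] add.commute)
  then show ?thesis by (simp add: omega_def sum_distrib_left sum_distrib_right)
qed

text \<open>Both products telescope, because \<open>xy = 1 - v\<close> and \<open>yx = 1 - w\<close>.\<close>

lemma omega_fy: "omega n * fy = 1 - fv ^ n"
proof (induction n)
  case (Suc n)
  have "fv ^ n * fx * fy = fv ^ n - fv ^ Suc n"
    by (simp add: fv_def power_Suc2 right_diff_distrib mult.assoc del: power_Suc)
  with Suc show ?case by (simp add: omega_def distrib_right)
qed (simp add: omega_def)

lemma fy_omega: "fy * omega n = 1 - fw ^ n"
proof (induction n)
  case (Suc n)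
  have "fy * (fv ^ n * fx) = fw ^ n * (fy * fx)" by (simp add: mult.assoc[symmetric] fw_power_fy)
  also have "\<dots> = fw ^ n - fw ^ Suc n"
    by (simp add: fw_def power_Suc2 right_diff_distrib mult.assoc del: power_Suc)
  finally show ?case using Suc by (simp add: omega_def distrib_left)
qed (simp add: omega_def)

text \<open>Write \<open>g = w\<^sup>n - v\<^sup>n\<close>. In the boundary of the first four terms of \<open>\<gamma>\<^sub>2\<close> the tensors with \<open>y\<close> and
  \<open>\<omega>\<^sub>n\<close> in different factors cancel by the intertwining relations. The remaining ones contain \<open>\<omega>\<^sub>n y = 1 - v\<^sup>n\<close> or
  \<open>y \<omega>\<^sub>n = 1 - w\<^sup>n\<close> and add up to \<open>g \<otimes> 1 - 1 \<otimes> g\<close>. The last term of \<open>\<gamma>\<^sub>2\<close> contributes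
  \<open>- 2 g \<otimes> 1\<close>, and \<open>B \<gamma>\<^sub>0\<close> is \<open>1 \<otimes> g + g \<otimes> 1\<close>.\<close>

lemma hochschild_b_gamma2: "hochschild_b (gamma2 n) + connes_B (gamma0 n) = 0"
proof -
  have "hochschild_b (gamma2 n) =
      - (elem [fw ^ n * fy, omega n] - elem [fw ^ n, fy * omega n] + elem [omega n * fw ^ n, fy])
      + (elem [fv ^ n * omega n, fy] - elem [fv ^ n, omega n * fy] + elem [fy * fv ^ n, omega n])
      - (elem [omega n * fw ^ n, fy] - elem [omega n, fw ^ n * fy] + elem [fy * omega n, fw ^ n])
      + (elem [omega n * fy, fv ^ n] - elem [omega n, fy * fv ^ n] + elem [fv ^ n * omega n, fy])
      - 2 *\<^sub>C (elem [(fw ^ n - fv ^ n), 1])"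
    unfolding gamma2_def by (simp add: hochschild_b_linear hochschild_b_elem)
  also have "\<dots> = elem [fw ^ n, 1 - fw ^ n] - elem [fv ^ n, 1 - fv ^ n]
      - elem [1 - fw ^ n, fw ^ n] + elem [1 - fv ^ n, fv ^ n] - 2 *\<^sub>C elem [fw ^ n - fv ^ n, 1]"
    unfolding fw_power_fy fv_power_omega omega_fy fy_omega by simp
  also have "\<dots> = elem [fw ^ n - fv ^ n, 1] - elem [1, fw ^ n - fv ^ n]
      - 2 *\<^sub>C elem [fw ^ n - fv ^ n, 1]"
    by (simp add: elem_linear_simps)
  also have "2 *\<^sub>C elem [fw ^ n - fv ^ n, 1] = elem [fw ^ n - fv ^ n, 1] + elem [fw ^ n - fv ^ n, 1]"
    using scaleC_add_left[of 1 1 "elem [fw ^ n - fv ^ n, 1]"] by (simp add: scaleC_one)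
  finally show ?thesis by (simp add: gamma0_def connes_B_elem)
qed

lemma ideal_mult_closed: "a * b \<in> two_sided_ideal hull G" "b * a \<in> two_sided_ideal hull G"
  if "b \<in> two_sided_ideal hull G"
  using that by (auto simp: hull_def two_sided_ideal_def)

lemma ideal_diff_closed:
  assumes "a \<in> two_sided_ideal hull G" "b \<in> two_sided_ideal hull G"
  shows "a - b \<in> two_sided_ideal hull (G :: free_alg set)"
proof -
  have "- b \<in> two_sided_ideal hull G"
    using ideal_mult_closed(1)[OF assms(2), of "- 1"] by simp
  then have "a + - b \<in> two_sided_ideal hull G"
    using assms(1) unfolding hull_def two_sided_ideal_def by blast
  then show ?thesis by simp
qed

lemma elem_in_rel_chains:
  "length xs = k + 1 \<Longrightarrow> i \<le> k \<Longrightarrow> xs ! i \<in> I \<Longrightarrow> elem xs \<in> rel_chains k I"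
  unfolding rel_chains_def by (rule cvec.span_base) auto

lemma gamma0_in_rel_chains: "gamma0 n \<in> rel_chains 0 (ideal_J n)"
  unfolding gamma0_def ideal_J_def by (rule elem_in_rel_chains[of _ _ 0]) (auto intro: hull_inc)

lemma gamma2_in_rel_chains: "gamma2 n \<in> rel_chains 2 (ideal_I n)"
proof -
  have I: "fv ^ n \<in> ideal_I n" "fw ^ n \<in> ideal_I n"
    by (auto simp: ideal_I_def intro: hull_inc)
  then have "fw ^ n - fv ^ n \<in> ideal_I n"
    unfolding ideal_I_def by (rule ideal_diff_closed[rotated])
  note I = I this
  have mem: "elem [a, b, c] \<in> rel_chains 2 (ideal_I n)"
    if "a \<in> ideal_I n \<or> b \<in> ideal_I n \<or> c \<in> ideal_I n" for a b c
    using that elem_in_rel_chains[of "[a, b, c]" 2 0] elem_in_rel_chains[of "[a, b, c]" 2 1]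
      elem_in_rel_chains[of "[a, b, c]" 2 2] by auto
  have "elem [fw ^ n, fy, omega n] \<in> rel_chains 2 (ideal_I n)"
    "elem [fv ^ n, omega n, fy] \<in> rel_chains 2 (ideal_I n)"
    "elem [omega n, fw ^ n, fy] \<in> rel_chains 2 (ideal_I n)"
    "elem [omega n, fy, fv ^ n] \<in> rel_chains 2 (ideal_I n)"
    "elem [fw ^ n - fv ^ n, 1, 1] \<in> rel_chains 2 (ideal_I n)"
    by (simp_all add: I mem)
  then show ?thesis
    unfolding gamma2_def rel_chains_def
    by (intro cvec.span_add cvec.span_diff cvec.span_neg cvec.span_scale)
qed

proposition gamma_cycle: "gamma n \<in> B_cycles (ideal_I n) (ideal_J n) 2"
proof -
  have "gamma n \<in> B_chains (ideal_I n) (ideal_J n) 2"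
    unfolding B_chains_def
  proof (intro CollectI conjI allI impI)
    show "gamma n 0 \<in> rel_chains 2 (ideal_I n)"
      by (simp add: gamma_def gamma2_in_rel_chains)
    fix j :: nat assume "1 \<le> j"
    then show "if 2 * j \<le> 2 then gamma n j \<in> rel_chains (2 - 2 * j) (ideal_J n) else gamma n j = 0"
      by (cases "j = 1") (auto simp: gamma_def gamma0_in_rel_chains)
  qed
  moreover have "B_boundary (gamma n) j = 0" for j
    using hochschild_b_gamma2[of n]
    by (auto simp: B_boundary_def gamma_def connes_B_zero hochschild_b_linear gamma0_def hochschild_b_elem)
  ultimately show ?thesis by (auto simp: B_cycles_def)
qed

lemma periodicity_S_gamma: "periodicity_S (gamma n) \<in> B_chains (ideal_J n) (ideal_J n) 0"
  using gamma0_in_rel_chains by (auto simp: B_chains_def periodicity_S_def gamma_def)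

section \<open>Geometry of Hilbert spaces\<close>

lemma cinner_add_right: "cinner x (y + z) = cinner x y + cinner (x :: 'h::complex_hilbert) z"
  by (metis cinner_add_left cinner_commute complex_cnj_add)

lemma cinner_scaleC_right: "cinner x (c *\<^sub>C y) = cnj c * cinner (x :: 'h::complex_hilbert) y"
  by (metis cinner_scaleC_left cinner_commute complex_cnj_mult)

lemmas cinner_left_additive = additive_simps[of "\<lambda>x. cinner x y", OF cinner_add_left] for y
lemmas cinner_right_additive = additive_simps[of "\<lambda>y. cinner x y", OF cinner_add_right] for x

lemmas cinner_simps = cinner_add_left cinner_add_right cinner_scaleC_left cinner_scaleC_right
  cinner_left_additive(1-3) cinner_right_additive(1-3)

lemma Re_cinner_self: "Re (cinner x x) = (norm (x :: 'h::complex_hilbert))\<^sup>2"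
  by (simp add: cinner_self)

lemma Re_cinner_commute: "Re (cinner y x) = Re (cinner x (y :: 'h::complex_hilbert))"
  by (subst cinner_commute) simp

lemma norm_add_square: "(norm (x + y))\<^sup>2 = (norm x)\<^sup>2 + (norm y)\<^sup>2 + 2 * Re (cinner x (y :: 'h::complex_hilbert))"
  unfolding Re_cinner_self[symmetric] using Re_cinner_commute[of x y] by (simp add: cinner_simps)

lemma norm_diff_square: "(norm (x - y))\<^sup>2 = (norm x)\<^sup>2 + (norm y)\<^sup>2 - 2 * Re (cinner x (y :: 'h::complex_hilbert))"
  unfolding Re_cinner_self[symmetric] using Re_cinner_commute[of x y] by (simp add: cinner_simps)

lemma cinner_Cauchy_Schwarz: "cmod (cinner x y) \<le> norm x * norm (y :: 'h::complex_hilbert)"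
proof (cases "y = 0")
  case True
  then show ?thesis by (simp add: cinner_simps)
next
  case False
  define r c where "r = (norm y)\<^sup>2" and "c = cinner x y / of_real r"
  have r: "r > 0" using False by (simp add: r_def)
  have "cnj c * cinner x y = of_real ((cmod (cinner x y))\<^sup>2 / r)"
    by (simp add: c_def complex_norm_square mult.commute del: of_real_power)
  then have "Re (cinner x (c *\<^sub>C y)) = (cmod (cinner x y))\<^sup>2 / r"
    by (simp add: cinner_simps)
  moreover have "(norm (c *\<^sub>C y))\<^sup>2 = (cmod (cinner x y))\<^sup>2 / r"
    using False by (simp add: norm_scaleC c_def norm_divide norm_mult r_def power2_eq_square)
  ultimately have "(norm (x - c *\<^sub>C y))\<^sup>2 = (norm x)\<^sup>2 - (cmod (cinner x y))\<^sup>2 / r"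
    by (simp add: norm_diff_square)
  then have "(cmod (cinner x y))\<^sup>2 / r \<le> (norm x)\<^sup>2"
    using zero_le_power2[of "norm (x - c *\<^sub>C y)"] by linarith
  then have "(cmod (cinner x y))\<^sup>2 \<le> (norm x * norm y)\<^sup>2"
    using r by (simp add: field_simps r_def)
  then show ?thesis by (rule power2_le_imp_le) simp
qed

lemma bounded_bilinear_cinner: "bounded_bilinear (cinner :: 'h::complex_hilbert \<Rightarrow> 'h \<Rightarrow> complex)"
proof
  show "\<exists>K. \<forall>a b :: 'h. cmod (cinner a b) \<le> norm a * norm b * K"
    by (intro exI[of _ 1]) (simp add: cinner_Cauchy_Schwarz)
qed (simp_all add: cinner_simps scaleR_scaleC scaleR_conv_of_real)

lemmas tendsto_cinner = bounded_bilinear.tendsto[OF bounded_bilinear_cinner]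

lemma cinner_ext: "(\<And>x. cinner x a = cinner x b) \<Longrightarrow> a = (b :: 'h::complex_hilbert)"
proof -
  assume "\<And>x. cinner x a = cinner x b"
  then have "cinner (a - b) (a - b) = 0" by (simp add: cinner_simps)
  then show "a = b" by (simp add: cinner_self)
qed

lemma parallelogram_law:
  "(norm (x + y))\<^sup>2 + (norm (x - y))\<^sup>2 = 2 * (norm x)\<^sup>2 + 2 * (norm (y :: 'h::complex_hilbert))\<^sup>2"
  by (simp add: norm_add_square norm_diff_square)

text \<open>A bounded functional \<open>f\<close> is represented on a subspace \<open>V\<close> by the minimiser \<open>u\<close> of
  \<open>\<parallel>x\<parallel>\<^sup>2 - 2 Re (f x)\<close> over the closure of \<open>V\<close>: the parallelogram law makes every minimising sequence
  Cauchy, and the first variation at \<open>u\<close> vanishes. For \<open>V = UNIV\<close> this is the Riesz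
  representation theorem, for \<open>f x = cinner x y\<close> it yields the orthogonal projection of \<open>y\<close>.\<close>

lemma riesz_representation_on_subspace:
  fixes f :: "'h::complex_hilbert \<Rightarrow> complex"
  assumes V: "cvec.subspace V"
    and add: "\<And>x y. f (x + y) = f x + f y" and scale: "\<And>c x. f (c *\<^sub>C x) = c * f x"
    and bound: "\<And>x. cmod (f x) \<le> K * norm x"
  shows "\<exists>u\<in>closure V. \<forall>h\<in>V. f h = cinner h u"
proof -
  define \<phi> where "\<phi> x = (norm x)\<^sup>2 - 2 * Re (f x)" for x
  have lower: "- K\<^sup>2 \<le> \<phi> x" for x
  proof -
    have "Re (f x) \<le> K * norm x" using bound[of x] complex_Re_le_cmod[of "f x"] by linarith
    moreover have "0 \<le> (norm x - K)\<^sup>2" by simp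
    ultimately show ?thesis by (simp add: \<phi>_def power2_diff algebra_simps)
  qed
  define m where "m = Inf (\<phi> ` V)"
  have bdd: "bdd_below (\<phi> ` V)" using lower by (auto intro!: bdd_belowI)
  have V0: "0 \<in> V" using V by (rule cvec.subspace_0)
  have m_le: "m \<le> \<phi> x" if "x \<in> V" for x
    unfolding m_def using that bdd by (auto intro: cInf_lower)
  have "\<exists>x\<in>V. \<phi> x < m + inverse (real (Suc n))" for n
    using cInf_lessD[of "\<phi> ` V" "m + inverse (real (Suc n))"] V0 by (auto simp: m_def)
  then obtain x where x: "\<And>n. x n \<in> V" "\<And>n. \<phi> (x n) < m + inverse (real (Suc n))"
    by metis
  have mid: "\<phi> a + \<phi> b = 2 * \<phi> ((1/2) *\<^sub>C (a + b)) + (norm (a - b))\<^sup>2 / 2" for a b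
  proof -
    have "\<phi> ((1/2) *\<^sub>C (a + b)) = (norm (a + b))\<^sup>2 / 4 - Re (f a) - Re (f b)"
      by (simp add: \<phi>_def norm_scaleC scale add power_divide add_divide_distrib)
    then show ?thesis using parallelogram_law[of a b] by (simp add: \<phi>_def)
  qed
  have close: "(norm (x i - x j))\<^sup>2 \<le> 2 * (inverse (real (Suc i)) + inverse (real (Suc j)))" for i j
  proof -
    have "(1/2) *\<^sub>C (x i + x j) \<in> V"
      using V x(1) by (intro cvec.subspace_scale cvec.subspace_add)
    from m_le[OF this] show ?thesis using mid[of "x i" "x j"] x(2)[of i] x(2)[of j] by simp
  qed
  have "Cauchy x"
  proof (rule CauchyI)
    fix e :: real assume e: "0 < e"
    have "(\<lambda>n. inverse (real (Suc n))) \<longlonglongrightarrow> 0" by (rule LIMSEQ_inverse_real_of_nat)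
    from order_tendstoD(2)[OF this, of "e\<^sup>2 / 4"]
    have "\<exists>M. \<forall>n\<ge>M. inverse (real (Suc n)) < e\<^sup>2 / 4"
      using e by (simp add: eventually_sequentially)
    then obtain M where M: "\<And>n. n \<ge> M \<Longrightarrow> inverse (real (Suc n)) < e\<^sup>2 / 4" by blast
    have "norm (x i - x j) < e" if "i \<ge> M" "j \<ge> M" for i j
    proof -
      have "(norm (x i - x j))\<^sup>2 < e\<^sup>2"
      proof -
        have "2 * (inverse (real (Suc i)) + inverse (real (Suc j))) < 2 * (e\<^sup>2 / 4 + e\<^sup>2 / 4)"
          by (intro mult_strict_left_mono add_strict_mono M that) simp
        then show ?thesis using close[of i j] by simp
      qed
      then show ?thesis using e by (simp add: power2_less_imp_less)
    qed
    then show "\<exists>M. \<forall>m\<ge>M. \<forall>n\<ge>M. norm (x m - x n) < e" by blast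
  qed
  then obtain u where u: "x \<longlonglongrightarrow> u" using convergent_eq_Cauchy by auto
  have u_closure: "u \<in> closure V" using u x(1) closure_sequential by blast
  have f_bl: "bounded_linear f"
    by (rule bounded_linear_intro[where K = K])
      (use bound in \<open>simp_all add: add scale scaleR_scaleC scaleR_conv_of_real mult.commute\<close>)
  have \<phi>_lim: "(\<lambda>n. \<phi> (x n + h)) \<longlonglongrightarrow> \<phi> (u + h)" for h
    unfolding \<phi>_def
    by (intro tendsto_intros u tendsto_Re bounded_linear.tendsto[OF f_bl])
  have "\<phi> u \<le> m"
  proof (rule LIMSEQ_le[OF \<phi>_lim[of 0, simplified]])
    show "(\<lambda>n. m + inverse (real (Suc n))) \<longlonglongrightarrow> m"
      using tendsto_add[OF tendsto_const LIMSEQ_inverse_real_of_nat, of m] by simp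
    show "\<exists>N. \<forall>n\<ge>N. \<phi> (x n) \<le> m + inverse (real (Suc n))" using x(2) less_imp_le by blast
  qed
  moreover have "m \<le> \<phi> (u + h)" if "h \<in> V" for h
    by (rule LIMSEQ_le_const[OF \<phi>_lim]) (use V x(1) that in \<open>auto intro!: m_le cvec.subspace_add\<close>)
  ultimately have minimal: "\<phi> u \<le> \<phi> (u + h)" if "h \<in> V" for h using that by fastforce
  have Re_eq: "Re (f h) = Re (cinner h u)" if h: "h \<in> V" for h
  proof -
    define d H where "d = Re (cinner h u) - Re (f h)" and "H = (norm h)\<^sup>2"
    have H: "0 \<le> H" by (simp add: H_def)
    have var: "0 \<le> t\<^sup>2 * H + 2 * t * d" for t
    proof -
      have "complex_of_real t *\<^sub>C h \<in> V" using V h by (rule cvec.subspace_scale)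
      then show ?thesis
        using minimal[of "complex_of_real t *\<^sub>C h"] Re_cinner_commute[of h u]
        by (simp add: \<phi>_def norm_add_square norm_scaleC add scale cinner_simps d_def H_def
            power_mult_distrib algebra_simps)
    qed
    \<comment> \<open>at this \<open>t\<close> the parabola has the value \<open>- d\<^sup>2 (H + 2) / (H + 1)\<^sup>2\<close>\<close>
    have "(d / (H + 1))\<^sup>2 * H - 2 * (d / (H + 1)) * d = - (d\<^sup>2 * (H + 2) / (H + 1)\<^sup>2)"
    proof -
      define k where "k = H + 1"
      have "k \<noteq> 0" and Hk: "H = k - 1" using H by (simp_all add: k_def)
      then show ?thesis unfolding Hk by (simp add: field_simps power2_eq_square)
    qed
    then have "d\<^sup>2 * (H + 2) / (H + 1)\<^sup>2 \<le> 0" using var[of "- (d / (H + 1))"] by simp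
    then have "d\<^sup>2 * (H + 2) \<le> 0" using H by (simp add: divide_le_0_iff)
    then have "d = 0" using H by (simp add: mult_le_0_iff)
    then show ?thesis by (simp add: d_def)
  qed
  have "f h = cinner h u" if h: "h \<in> V" for h
  proof (rule complex_eqI)
    show "Re (f h) = Re (cinner h u)" by (rule Re_eq[OF h])
    have "\<i> *\<^sub>C h \<in> V" using V h by (rule cvec.subspace_scale)
    from Re_eq[OF this] show "Im (f h) = Im (cinner h u)" by (simp add: scale cinner_simps)
  qed
  with u_closure show ?thesis by blast
qed

definition orthonormal :: "'h::complex_hilbert set \<Rightarrow> bool" where
  "orthonormal E \<longleftrightarrow> (\<forall>e\<in>E. norm e = 1) \<and> (\<forall>e\<in>E. \<forall>f\<in>E. e \<noteq> f \<longrightarrow> cinner e f = 0)"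

lemma is_onb_iff: "is_onb E \<longleftrightarrow> orthonormal E \<and> closure (cvec.span E) = UNIV"
  by (auto simp: is_onb_def orthonormal_def)

text \<open>A maximal orthonormal set has dense span: otherwise the component of some vector orthogonal
  to the span could be normalised and added.\<close>

lemma ex_onb: "\<exists>E :: 'h::complex_hilbert set. is_onb E"
proof -
  have "\<exists>M\<in>Collect orthonormal. \<forall>X\<in>Collect orthonormal. M \<subseteq> X \<longrightarrow> X = (M :: 'h set)"
  proof (rule subset_Zorn')
    fix C :: "'h set set" assume C: "subset.chain (Collect orthonormal) C"
    then have orth: "orthonormal X" if "X \<in> C" for X
      using that by (auto simp: subset_chain_def)
    have "\<exists>X\<in>C. e \<in> X \<and> f \<in> X" if ef: "e \<in> \<Union>C" "f \<in> \<Union>C" for e f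
    proof -
      obtain X Y where XY: "X \<in> C" "e \<in> X" "Y \<in> C" "f \<in> Y" using ef by blast
      then have "X \<subseteq> Y \<or> Y \<subseteq> X" using C unfolding subset_chain_def by blast
      with XY show ?thesis by blast
    qed
    then show "\<Union>C \<in> Collect orthonormal"
      using orth unfolding orthonormal_def by (simp only: mem_Collect_eq) (meson UnionE)
  qed
  then obtain E :: "'h set" where E: "orthonormal E" and
    max: "\<And>X. orthonormal X \<Longrightarrow> E \<subseteq> X \<Longrightarrow> X = E" by auto
  have "y \<in> closure (cvec.span E)" for y
  proof (rule ccontr)
    assume y: "y \<notin> closure (cvec.span E)"
    have "\<exists>u\<in>closure (cvec.span E). \<forall>h\<in>cvec.span E. cinner h y = cinner h u"
      by (rule riesz_representation_on_subspace[where K = "norm y"])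
        (use cinner_Cauchy_Schwarz in \<open>simp_all add: cinner_simps mult.commute\<close>)
    then obtain u where u: "u \<in> closure (cvec.span E)" "\<And>h. h \<in> cvec.span E \<Longrightarrow> cinner h (y - u) = 0"
      by (auto simp: cinner_simps)
    define z where "z = y - u"
    have z: "z \<noteq> 0" using y u(1) by (auto simp: z_def)
    define e where "e = complex_of_real (inverse (norm z)) *\<^sub>C z"
    have e_norm: "norm e = 1" using z by (simp add: e_def norm_scaleC norm_inverse)
    have e_orth: "cinner f e = 0" if "f \<in> E" for f
      using u(2)[OF cvec.span_base[OF that]] by (simp add: e_def cinner_simps z_def)
    then have e_orth': "cinner e f = 0" if "f \<in> E" for f
      using that by (metis cinner_commute complex_cnj_zero)
    have "orthonormal (insert e E)"
      using E e_norm e_orth e_orth' by (auto simp: orthonormal_def)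
    then have "e \<in> E" using max by blast
    then have "cinner e e = 0" by (rule e_orth)
    then show False using e_norm by (simp add: cinner_self)
  qed
  then show ?thesis using E by (auto simp: is_onb_iff)
qed

lemma some_onb: "is_onb some_onb"
  unfolding some_onb_def using ex_onb by (rule someI_ex)

text \<open>The best approximation of \<open>x\<close> by combinations of finitely many orthonormal vectors has the
  coefficients \<open>cinner x e\<close>; every other choice of coefficients adds the last sum.\<close>

lemma norm_diff_orthonormal_combination:
  assumes "orthonormal F" "finite F"
  shows "(norm (x - (\<Sum>e\<in>F. c e *\<^sub>C e)))\<^sup>2 =
    (norm x)\<^sup>2 - (\<Sum>e\<in>F. (cmod (cinner x e))\<^sup>2) + (\<Sum>e\<in>F. (cmod (c e - cinner x e))\<^sup>2)"
proof -
  define y where "y = (\<Sum>e\<in>F. c e *\<^sub>C e)"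
  have left: "cinner (\<Sum>e\<in>F. c e *\<^sub>C e) e' = (\<Sum>e\<in>F. c e * cinner e e')" for e'
    by (simp add: cinner_left_additive cinner_simps)
  have coeff: "cinner y e = c e" if "e \<in> F" for e
  proof -
    have "cinner y e = (\<Sum>f\<in>F. if f = e then c e else 0)"
      unfolding y_def left using assms(1) that
      by (intro sum.cong) (auto simp: orthonormal_def cinner_self)
    then show ?thesis using assms(2) that by simp
  qed
  have right: "cinner z y = (\<Sum>e\<in>F. cnj (c e) * cinner z e)" for z
    unfolding y_def by (simp add: cinner_right_additive cinner_simps)
  have "(norm y)\<^sup>2 = Re (cinner y y)" by (simp add: cinner_self)
  also have "\<dots> = (\<Sum>e\<in>F. (cmod (c e))\<^sup>2)"
    unfolding right Re_sum
  proof (rule sum.cong)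
    fix e assume "e \<in> F"
    then show "Re (cnj (c e) * cinner y e) = (cmod (c e))\<^sup>2"
      using cmod_power2[of "c e"] by (simp add: coeff power2_eq_square)
  qed simp
  finally have "(norm y)\<^sup>2 = (\<Sum>e\<in>F. (cmod (c e))\<^sup>2)" .
  moreover have "Re (cinner x y) = (\<Sum>e\<in>F. Re (cnj (c e) * cinner x e))"
    unfolding right by (simp add: Re_sum)
  moreover have "(cmod (a - b))\<^sup>2 = (cmod a)\<^sup>2 + (cmod b)\<^sup>2 - 2 * Re (cnj a * b)" for a b
    unfolding cmod_power2 by (simp add: power2_eq_square algebra_simps)
  ultimately show ?thesis
    unfolding y_def[symmetric] norm_diff_square
    by (simp add: sum.distrib sum_subtractf sum_distrib_left)
qed

lemma bessel_inequality:
  assumes "orthonormal F" "finite F"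
  shows "(\<Sum>e\<in>F. (cmod (cinner x e))\<^sup>2) \<le> (norm x)\<^sup>2"
proof -
  have "0 \<le> (norm (x - (\<Sum>e\<in>F. cinner x e *\<^sub>C e)))\<^sup>2" by (rule zero_le_power2)
  also have "\<dots> = (norm x)\<^sup>2 - (\<Sum>e\<in>F. (cmod (cinner x e))\<^sup>2)"
    unfolding norm_diff_orthonormal_combination[OF assms]
    by (simp only: diff_self norm_zero zero_power2 sum.neutral_const add_0_right)
  finally show ?thesis by linarith
qed

lemma orthonormal_subset: "orthonormal E \<Longrightarrow> F \<subseteq> E \<Longrightarrow> orthonormal F"
  by (simp add: orthonormal_def subset_iff)

text \<open>Density of the span makes the error of best approximation by finitely many basis vectors
  arbitrarily small.\<close>

theorem parseval:
  assumes "is_onb E"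
  shows "((\<lambda>e. (cmod (cinner x e))\<^sup>2) has_sum (norm x)\<^sup>2) E"
proof -
  have orth: "orthonormal F" if "F \<subseteq> E" for F
    using assms orthonormal_subset that by (auto simp: is_onb_iff)
  have summable: "(\<lambda>e. (cmod (cinner x e))\<^sup>2) summable_on E"
    by (rule nonneg_bdd_above_summable_on)
      (auto intro!: bdd_aboveI[where M = "(norm x)\<^sup>2"] bessel_inequality orth)
  have "infsum (\<lambda>e. (cmod (cinner x e))\<^sup>2) E \<le> (norm x)\<^sup>2"
    by (rule infsum_le_finite_sums[OF summable]) (auto intro: bessel_inequality orth)
  moreover have "(norm x)\<^sup>2 \<le> infsum (\<lambda>e. (cmod (cinner x e))\<^sup>2) E + \<epsilon>" if "\<epsilon> > 0" for \<epsilon>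
  proof -
    have "x \<in> closure (cvec.span E)" using assms by (simp add: is_onb_iff)
    then obtain y where y: "y \<in> cvec.span E" "dist y x < sqrt \<epsilon>"
      unfolding closure_approachable using \<open>\<epsilon> > 0\<close> real_sqrt_gt_zero by blast
    then obtain F c where F: "finite F" "F \<subseteq> E" "y = (\<Sum>e\<in>F. c e *\<^sub>C e)"
      unfolding cvec.span_explicit by blast
    have "(norm (x - y))\<^sup>2 \<le> (sqrt \<epsilon>)\<^sup>2"
      using y(2) by (intro power_mono) (simp_all add: dist_norm norm_minus_commute)
    then have "(norm x)\<^sup>2 - (\<Sum>e\<in>F. (cmod (cinner x e))\<^sup>2) + (\<Sum>e\<in>F. (cmod (c e - cinner x e))\<^sup>2) \<le> \<epsilon>"
      using \<open>\<epsilon> > 0\<close> unfolding F(3) norm_diff_orthonormal_combination[OF orth[OF F(2)] F(1)] by simp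
    moreover have "(\<Sum>e\<in>F. (cmod (cinner x e))\<^sup>2) \<le> infsum (\<lambda>e. (cmod (cinner x e))\<^sup>2) E"
      by (intro finite_sum_le_infsum summable F) auto
    moreover have "0 \<le> (\<Sum>e\<in>F. (cmod (c e - cinner x e))\<^sup>2)" by (simp add: sum_nonneg)
    ultimately show ?thesis by linarith
  qed
  ultimately have "infsum (\<lambda>e. (cmod (cinner x e))\<^sup>2) E = (norm x)\<^sup>2"
    by (meson antisym field_le_epsilon)
  then show ?thesis using summable by (simp add: has_sum_iff)
qed

section \<open>Bounded operators, adjoints and positivity\<close>

lemma op_eqI: "(\<And>x. op_apply A x = op_apply B x) \<Longrightarrow> A = B"
  by (metis op_apply_inject ext)

lemma op_apply_simps:
  "op_apply (A + B) x = op_apply A x + op_apply B x" "op_apply (A - B) x = op_apply A x - op_apply B x"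
  "op_apply (- A) x = - op_apply A x" "op_apply 0 x = 0" "op_apply 1 x = x"
  "op_apply (A * B) x = op_apply A (op_apply B x)" "op_apply (c *\<^sub>C A) x = c *\<^sub>C op_apply A x"
  by (transfer; simp)+

lemma bounded_linear_op_apply: "bounded_linear (op_apply A)"
  using op_apply[of A] by simp

lemma op_apply_linear:
  "op_apply A (x + y) = op_apply A x + op_apply A y" "op_apply A (c *\<^sub>C x) = c *\<^sub>C op_apply A x"
  "op_apply A 0 = 0" "op_apply A (x - y) = op_apply A x - op_apply A y" "op_apply A (- x) = - op_apply A x"
proof -
  interpret bounded_linear "op_apply A" by (rule bounded_linear_op_apply)
  show "op_apply A (x + y) = op_apply A x + op_apply A y" "op_apply A 0 = 0"
    "op_apply A (x - y) = op_apply A x - op_apply A y" "op_apply A (- x) = - op_apply A x"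
    by (rule add zero diff neg)+
  show "op_apply A (c *\<^sub>C x) = c *\<^sub>C op_apply A x" using op_apply[of A] by simp
qed

lemma op_apply_Bounded_op:
  assumes "\<And>x y. f (x + y) = f x + f y" "\<And>c x. f (c *\<^sub>C x) = c *\<^sub>C f x" "\<And>x. norm (f x) \<le> K * norm x"
  shows "op_apply (Bounded_op f) = (f :: 'h::complex_hilbert \<Rightarrow> 'h)"
proof (rule Bounded_op_inverse)
  have "bounded_linear f"
    by (rule bounded_linear_intro[where K = K]) (use assms in \<open>simp_all add: scaleR_scaleC mult.commute\<close>)
  then show "f \<in> {f. bounded_linear f \<and> (\<forall>c x. f (c *\<^sub>C x) = c *\<^sub>C f x)}" using assms(2) by simp
qed

lemma norm_op_apply: "norm (op_apply A x) \<le> op_norm A * norm x"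
  unfolding op_norm_def by (rule onorm[OF bounded_linear_op_apply])

lemma op_norm_nonneg: "0 \<le> op_norm A"
  unfolding op_norm_def by (rule onorm_pos_le[OF bounded_linear_op_apply])

lemma op_norm_le: "0 \<le> K \<Longrightarrow> (\<And>x. norm (op_apply A x) \<le> K * norm x) \<Longrightarrow> op_norm A \<le> K"
  unfolding op_norm_def by (rule onorm_bound)

lemma op_norm_mult: "op_norm (A * B) \<le> op_norm A * op_norm B"
proof (rule op_norm_le)
  fix x
  have "norm (op_apply A (op_apply B x)) \<le> op_norm A * norm (op_apply B x)" by (rule norm_op_apply)
  also have "\<dots> \<le> op_norm A * (op_norm B * norm x)"
    by (rule mult_left_mono[OF norm_op_apply op_norm_nonneg])
  finally show "norm (op_apply (A * B) x) \<le> op_norm A * op_norm B * norm x"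
    by (simp add: op_apply_simps mult.assoc)
qed (simp add: op_norm_nonneg)

lemma op_norm_scaleC_le: "op_norm (c *\<^sub>C A) \<le> cmod c * op_norm A"
  by (rule op_norm_le)
    (simp_all add: op_norm_nonneg op_apply_simps norm_scaleC mult.assoc mult_left_mono norm_op_apply)

definition contraction :: "'h::complex_hilbert bounded_op \<Rightarrow> bool" where
  "contraction A \<longleftrightarrow> (\<forall>x. norm (op_apply A x) \<le> norm x)"

lemma contractionD: "contraction A \<Longrightarrow> norm (op_apply A x) \<le> norm x"
  by (simp add: contraction_def)

lemma contraction_power: "contraction A \<Longrightarrow> contraction (A ^ n)"
proof (induction n)
  case (Suc n)
  then show ?case by (auto simp: contraction_def op_apply_simps intro: order_trans)
qed (simp add: contraction_def op_apply_simps)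

lemma ex_contractive_multiple: "\<exists>c>0. contraction (complex_of_real c *\<^sub>C A)"
proof (intro exI conjI)
  show "0 < inverse (op_norm A + 1)" using op_norm_nonneg[of A] by simp
  show "contraction (complex_of_real (inverse (op_norm A + 1)) *\<^sub>C A)"
    unfolding contraction_def
  proof
    fix x
    have "inverse (op_norm A + 1) * norm (op_apply A x) \<le> inverse (op_norm A + 1) * ((op_norm A + 1) * norm x)"
      using norm_op_apply[of A x] op_norm_nonneg[of A]
      by (intro mult_left_mono) (simp_all add: distrib_right add_increasing2)
    also have "\<dots> = norm x" using op_norm_nonneg[of A] by (simp add: mult.assoc[symmetric])
    finally show "norm (op_apply (complex_of_real (inverse (op_norm A + 1)) *\<^sub>C A) x) \<le> norm x"
      using op_norm_nonneg[of A] by (simp only: op_apply_simps norm_scaleC norm_of_real) simp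
  qed
qed

lemma ex_adjoint:
  fixes A :: "'h::complex_hilbert bounded_op"
  shows "\<exists>B. \<forall>x y. cinner (op_apply A x) y = cinner x (op_apply B y)"
proof -
  have "\<exists>u\<in>closure UNIV. \<forall>x\<in>UNIV. cinner (op_apply A x) y = cinner x u" for y
  proof (rule riesz_representation_on_subspace[where K = "op_norm A * norm y"])
    fix x
    have "cmod (cinner (op_apply A x) y) \<le> norm (op_apply A x) * norm y" by (rule cinner_Cauchy_Schwarz)
    also have "\<dots> \<le> op_norm A * norm x * norm y" by (rule mult_right_mono[OF norm_op_apply]) simp
    finally show "cmod (cinner (op_apply A x) y) \<le> op_norm A * norm y * norm x" by (simp add: ac_simps)
  qed (simp_all add: cvec.subspace_UNIV op_apply_linear cinner_simps)
  then obtain g where g: "\<And>x y. cinner (op_apply A x) y = cinner x (g y)" by simp metis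
  have bound: "norm (g y) \<le> op_norm A * norm y" for y
  proof (cases "g y = 0")
    case False
    have "(norm (g y))\<^sup>2 = cmod (cinner (op_apply A (g y)) y)" by (simp add: g cinner_self norm_power)
    also have "\<dots> \<le> norm (op_apply A (g y)) * norm y" by (rule cinner_Cauchy_Schwarz)
    also have "\<dots> \<le> op_norm A * norm (g y) * norm y" by (rule mult_right_mono[OF norm_op_apply]) simp
    finally show ?thesis using False by (simp add: power2_eq_square mult.assoc mult.left_commute[of _ "norm (g y)"])
  qed (simp add: op_norm_nonneg)
  have "op_apply (Bounded_op g) = g"
    by (rule op_apply_Bounded_op[OF _ _ bound]; rule cinner_ext)
      (simp_all add: g[symmetric] cinner_simps)
  then show ?thesis using g by metis
qed

lemma adj_eqI:
  assumes "\<And>x y. cinner (op_apply A x) y = cinner x (op_apply B y)"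
  shows "adj A = B"
  unfolding adj_def
proof (rule the_equality)
  show "\<forall>x y. cinner (op_apply A x) y = cinner x (op_apply B y)" using assms by blast
  fix C assume "\<forall>x y. cinner (op_apply A x) y = cinner x (op_apply C y)"
  then show "C = B" using assms by (intro op_eqI cinner_ext) metis
qed

lemma cinner_adj: "cinner (op_apply A x) y = cinner x (op_apply (adj A) y)"
  using ex_adjoint[of A] adj_eqI[of A] by metis

lemma cinner_adj_left: "cinner (op_apply (adj A) x) y = cinner x (op_apply A y)"
  by (metis cinner_adj cinner_commute)

lemma adj_adj: "adj (adj A) = A"
  by (rule adj_eqI) (rule cinner_adj_left)

lemma adj_sums_and_products:
  "adj (A + B) = adj A + adj B" "adj (A - B) = adj A - adj B" "adj (- A) = - adj A"
  "adj (A * B) = adj B * adj A" "adj (c *\<^sub>C A) = cnj c *\<^sub>C adj A" "adj 1 = (1 :: 'h::complex_hilbert bounded_op)"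
  by (rule adj_eqI; simp add: op_apply_simps cinner_simps cinner_adj cinner_adj_left)+

lemmas adj_simps = adj_adj adj_sums_and_products

lemma adj_power: "adj (A ^ n) = adj A ^ n"
  by (induction n) (simp_all add: adj_simps power_commutes)

lemma positive_op_Re: "positive_op A \<Longrightarrow> 0 \<le> Re (cinner (op_apply A x) x)"
  and positive_op_real: "positive_op A \<Longrightarrow> cinner (op_apply A x) x = of_real (Re (cinner (op_apply A x) x))"
  unfolding positive_op_def by (simp_all add: complex_nonneg_Reals_iff complex_eq_iff)

lemma positive_opI:
  assumes "adj A = A" "\<And>x. 0 \<le> Re (cinner (op_apply A x) x)"
  shows "positive_op A"
proof -
  have "cinner (op_apply A x) x = cnj (cinner (op_apply A x) x)" for x
    by (metis assms(1) cinner_adj cinner_commute)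
  then have "Im (cinner (op_apply A x) x) = 0" for x by (simp add: complex_eq_iff)
  then show ?thesis using assms(2) by (simp add: positive_op_def complex_nonneg_Reals_iff)
qed

text \<open>Over the complex numbers a form is determined by its diagonal, so a real diagonal makes the
  operator self-adjoint.\<close>

lemma positive_op_adj:
  assumes "positive_op A"
  shows "adj A = A"
proof (rule adj_eqI)
  fix x y
  define s where "s x y = cinner (op_apply A x) y - cinner x (op_apply A y)" for x y
  have diag: "s x x = 0" for x
    using positive_op_real[OF assms, of x] unfolding s_def
    by (metis cinner_commute complex_cnj_complex_of_real diff_self)
  have "s x y + s y x = 0"
    using diag[of "x + y"] diag[of x] diag[of y]
    by (simp add: s_def op_apply_linear cinner_simps algebra_simps)
  moreover have "s (x + \<i> *\<^sub>C y) (x + \<i> *\<^sub>C y) = s x x + s y y + \<i> * (s y x - s x y)"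
    by (simp add: s_def op_apply_linear cinner_simps algebra_simps)
  then have "s x y - s y x = 0" using diag by simp
  ultimately have "s x y = 0" by (simp add: complex_eq_iff)
  then show "cinner (op_apply A x) y = cinner x (op_apply A y)" by (simp add: s_def)
qed

lemma positive_op_adj_mult: "positive_op (adj A * A)"
  by (rule positive_opI) (simp_all add: adj_simps op_apply_simps cinner_adj_left cinner_self)

lemma positive_op_scale: "positive_op A \<Longrightarrow> 0 \<le> c \<Longrightarrow> positive_op (complex_of_real c *\<^sub>C A)"
  by (rule positive_opI) (simp_all add: adj_simps positive_op_adj op_apply_simps cinner_simps positive_op_Re)

lemma positive_one_minus_contraction:
  assumes "adj A = A" "contraction A"
  shows "positive_op (1 - A)"
proof (rule positive_opI)
  fix x
  have "cmod (cinner (op_apply A x) x) \<le> norm (op_apply A x) * norm x" by (rule cinner_Cauchy_Schwarz)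
  also have "\<dots> \<le> norm x * norm x" by (rule mult_right_mono[OF contractionD[OF assms(2)]]) simp
  finally show "0 \<le> Re (cinner (op_apply (1 - A) x) x)"
    using complex_Re_le_cmod[of "cinner (op_apply A x) x"]
    by (simp add: op_apply_simps cinner_simps Re_cinner_self power2_eq_square)
qed (simp add: adj_simps assms)

text \<open>For \<open>0 \<le> B \<le> 1\<close> one has \<open>B\<^sup>2 \<le> B\<close>: expand positivity of \<open>B\<close> at the vector \<open>x - B x\<close>.\<close>

lemma positive_contraction_square_le:
  assumes "positive_op B" "contraction B"
  shows "(norm (op_apply B x))\<^sup>2 \<le> Re (cinner (op_apply B x) x)"
proof -
  define z where "z = op_apply B x"
  have sa: "cinner (op_apply B a) b = cinner a (op_apply B b)" for a b
    using cinner_adj[of B a b] positive_op_adj[OF assms(1)] by simp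
  have "cmod (cinner (op_apply B z) z) \<le> norm (op_apply B z) * norm z" by (rule cinner_Cauchy_Schwarz)
  also have "\<dots> \<le> norm z * norm z" by (rule mult_right_mono[OF contractionD[OF assms(2)]]) simp
  finally have "Re (cinner (op_apply B z) z) \<le> (norm z)\<^sup>2"
    using complex_Re_le_cmod[of "cinner (op_apply B z) z"] by (simp add: power2_eq_square)
  moreover have "0 \<le> Re (cinner (op_apply B (x - z)) (x - z))" by (rule positive_op_Re[OF assms(1)])
  moreover have "cinner (op_apply B z) x = cinner z z" by (simp add: sa z_def)
  ultimately show ?thesis
    by (simp add: op_apply_linear cinner_simps z_def[symmetric] Re_cinner_self)
qed

lemma contraction_one_minus:
  assumes "positive_op B" "contraction B"
  shows "contraction (1 - B)"
  unfolding contraction_def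
proof
  fix x
  have "(norm (x - op_apply B x))\<^sup>2 \<le> (norm x)\<^sup>2"
    using positive_contraction_square_le[OF assms, of x] positive_op_Re[OF assms(1), of x]
      Re_cinner_commute[of x "op_apply B x"]
    unfolding norm_diff_square by simp
  then show "norm (op_apply (1 - B) x) \<le> norm x"
    by (simp add: op_apply_simps)
qed

text \<open>The uniform bound passes to the pointwise limit and makes it a bounded operator.\<close>

lemma ex_strong_limit:
  fixes Y :: "nat \<Rightarrow> 'h::complex_hilbert bounded_op"
  assumes conv: "\<And>x. convergent (\<lambda>n. op_apply (Y n) x)"
    and bound: "\<And>n x. norm (op_apply (Y n) x) \<le> K * norm x"
  shows "\<exists>Z. \<forall>x. (\<lambda>n. op_apply (Y n) x) \<longlonglongrightarrow> op_apply Z x"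
proof -
  obtain f where f: "\<And>x. (\<lambda>n. op_apply (Y n) x) \<longlonglongrightarrow> f x"
    using conv unfolding convergent_def by metis
  have "op_apply (Bounded_op f) = f"
  proof (rule op_apply_Bounded_op)
    fix x y c
    have "(\<lambda>n. op_apply (Y n) (x + y)) \<longlonglongrightarrow> f x + f y"
      unfolding op_apply_linear by (intro tendsto_add f)
    then show "f (x + y) = f x + f y" using f LIMSEQ_unique by blast
    have "(\<lambda>n. op_apply (Y n) (c *\<^sub>C x)) \<longlonglongrightarrow> c *\<^sub>C f x"
      unfolding op_apply_linear by (intro bounded_linear.tendsto[OF bounded_linear_scaleC] f)
    then show "f (c *\<^sub>C x) = c *\<^sub>C f x" using f LIMSEQ_unique by blast
    show "norm (f x) \<le> K * norm x"
      by (rule LIMSEQ_le_const2[OF tendsto_norm[OF f]]) (use bound in blast)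
  qed
  then show ?thesis using f by metis
qed

section \<open>Square roots and the absolute value\<close>

text \<open>For a self-adjoint contraction \<open>Z\<close>, the square root of \<open>1 - Z\<close> is \<open>1 - Y\<close> with
  \<open>Y = (Z + Y\<^sup>2) / 2\<close>. The iterates of this fixed point equation converge in norm because they are
  dominated term by term by the numerical iteration \<open>y = (1 + y\<^sup>2) / 2\<close>, which is increasing and
  bounded by \<open>1\<close>.\<close>

primrec sqrt_iter :: "'h::complex_hilbert bounded_op \<Rightarrow> nat \<Rightarrow> 'h bounded_op" where
  "sqrt_iter Z 0 = 0"
| "sqrt_iter Z (Suc n) = (1/2) *\<^sub>C (Z + sqrt_iter Z n * sqrt_iter Z n)"

primrec sqrt_iter_bound :: "nat \<Rightarrow> real" where
  "sqrt_iter_bound 0 = 0"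
| "sqrt_iter_bound (Suc n) = (1 + (sqrt_iter_bound n)\<^sup>2) / 2"

lemma sqrt_iter_bound_range: "0 \<le> sqrt_iter_bound n" "sqrt_iter_bound n \<le> 1"
proof -
  show nonneg: "0 \<le> sqrt_iter_bound n" for n by (cases n) simp_all
  show "sqrt_iter_bound n \<le> 1"
    by (induction n) (use nonneg in \<open>simp_all add: power_le_one\<close>)
qed

lemma sqrt_iter_bound_mono: "sqrt_iter_bound n \<le> sqrt_iter_bound (Suc n)"
proof -
  have "0 \<le> (1 - sqrt_iter_bound n)\<^sup>2" by simp
  then show ?thesis by (simp add: power2_diff)
qed

lemma sqrt_iter_commute:
  assumes "W * Z = Z * W"
  shows "W * sqrt_iter Z n = sqrt_iter Z n * W"
proof (induction n)
  case (Suc n)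
  have "W * (sqrt_iter Z n * sqrt_iter Z n) = sqrt_iter Z n * sqrt_iter Z n * W"
    by (metis Suc mult.assoc)
  then show ?case
    by (simp add: scaleC_mult_left scaleC_mult_right distrib_left distrib_right assms)
qed simp

lemma sqrt_iter_adj: "adj Z = Z \<Longrightarrow> adj (sqrt_iter Z n) = sqrt_iter Z n"
proof (induction n)
  case 0
  show ?case by (simp, rule adj_eqI) (simp add: op_apply_simps cinner_simps)
qed (simp add: adj_simps)

lemma norm_sqrt_iter:
  assumes "contraction Z"
  shows "norm (op_apply (sqrt_iter Z n) x) \<le> sqrt_iter_bound n * norm x"
proof (induction n arbitrary: x)
  case (Suc n)
  let ?Y = "op_apply (sqrt_iter Z n)" and ?y = "sqrt_iter_bound n"
  have "norm (?Y (?Y x)) \<le> ?y * norm (?Y x)" by (rule Suc)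
  also have "\<dots> \<le> ?y * (?y * norm x)" by (rule mult_left_mono[OF Suc sqrt_iter_bound_range(1)])
  finally have "norm (op_apply Z x + ?Y (?Y x)) \<le> norm x + ?y\<^sup>2 * norm x"
    using norm_triangle_ineq[of "op_apply Z x" "?Y (?Y x)"] contractionD[OF assms, of x]
    by (simp add: power2_eq_square mult.assoc)
  then show ?case by (simp add: op_apply_simps norm_scaleC distrib_right)
qed (simp add: op_apply_simps)

lemma norm_sqrt_iter_step:
  assumes "contraction Z"
  shows "norm (op_apply (sqrt_iter Z (Suc n)) x - op_apply (sqrt_iter Z n) x)
    \<le> (sqrt_iter_bound (Suc n) - sqrt_iter_bound n) * norm x"
proof (induction n arbitrary: x)
  case 0
  show ?case using contractionD[OF assms, of x] by (simp add: op_apply_simps norm_scaleC)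
next
  case (Suc n)
  define Y Y' where "Y = sqrt_iter Z n" and "Y' = sqrt_iter Z (Suc n)"
  define y y' where "y = sqrt_iter_bound n" and "y' = sqrt_iter_bound (Suc n)"
  have comm: "Y * Y' = Y' * Y"
    unfolding Y_def Y'_def by (intro sqrt_iter_commute) (rule sqrt_iter_commute[symmetric], simp)
  have "sqrt_iter Z (Suc (Suc n)) - sqrt_iter Z (Suc n) = (1/2) *\<^sub>C (Y' * Y') - (1/2) *\<^sub>C (Y * Y)"
    by (simp add: Y_def Y'_def scaleC_add_right)
  also have "\<dots> = (1/2) *\<^sub>C (Y' * (Y' - Y) + Y * (Y' - Y))"
    by (simp add: right_diff_distrib comm cvec.scale_right_diff_distrib[symmetric])
  finally have "op_apply (sqrt_iter Z (Suc (Suc n))) x - op_apply (sqrt_iter Z (Suc n)) x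
    = (1/2) *\<^sub>C (op_apply Y' (op_apply Y' x - op_apply Y x) + op_apply Y (op_apply Y' x - op_apply Y x))"
    by (simp only: op_apply_simps(2)[symmetric]) (simp only: op_apply_simps)
  moreover have "norm (op_apply Y' (op_apply Y' x - op_apply Y x)) \<le> y' * ((y' - y) * norm x)"
    using norm_sqrt_iter[OF assms, of "Suc n"] mult_left_mono[OF Suc.IH sqrt_iter_bound_range(1)]
    unfolding Y_def Y'_def y_def y'_def by (rule order_trans)
  moreover have "norm (op_apply Y (op_apply Y' x - op_apply Y x)) \<le> y * ((y' - y) * norm x)"
    using norm_sqrt_iter[OF assms, of n] mult_left_mono[OF Suc.IH sqrt_iter_bound_range(1)]
    unfolding Y_def Y'_def y_def y'_def by (rule order_trans)
  ultimately have "norm (op_apply (sqrt_iter Z (Suc (Suc n))) x - op_apply (sqrt_iter Z (Suc n)) x)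
    \<le> (1/2) * (y' * ((y' - y) * norm x) + y * ((y' - y) * norm x))"
    using norm_triangle_ineq[of "op_apply Y' (op_apply Y' x - op_apply Y x)"
        "op_apply Y (op_apply Y' x - op_apply Y x)"] by (simp add: norm_scaleC)
  also have "\<dots> = (sqrt_iter_bound (Suc (Suc n)) - sqrt_iter_bound (Suc n)) * norm x"
  proof -
    have *: "sqrt_iter_bound (Suc (Suc n)) = (1 + y'\<^sup>2) / 2" "sqrt_iter_bound (Suc n) = (1 + y\<^sup>2) / 2"
      by (simp_all add: y_def y'_def)
    show ?thesis unfolding * by (simp add: field_simps power2_eq_square)
  qed
  finally show ?case .
qed

text \<open>Uniqueness of positive square roots will follow from the last conjunct, which is inherited from
  the iterates because they are polynomials in \<open>Z\<close>.\<close>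

lemma ex_sqrt_one_minus:
  assumes Z: "adj Z = Z" "contraction Z"
  shows "\<exists>S. positive_op S \<and> S * S = 1 - Z \<and> (\<forall>W. W * Z = Z * W \<longrightarrow> W * S = S * W)"
proof -
  define Y where "Y = sqrt_iter Z"
  have "convergent sqrt_iter_bound"
    by (rule Bseq_mono_convergent[OF BseqI'[where K = 1]])
      (use sqrt_iter_bound_range in simp, use lift_Suc_mono_le[of sqrt_iter_bound] sqrt_iter_bound_mono in blast)
  then have Cauchy_bound: "Cauchy sqrt_iter_bound" by (rule convergent_Cauchy)
  have mono: "sqrt_iter_bound m \<le> sqrt_iter_bound n" if "m \<le> n" for m n
    using that lift_Suc_mono_le[of sqrt_iter_bound] sqrt_iter_bound_mono by blast
  have dist: "norm (op_apply (Y (m + k)) x - op_apply (Y m) x)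
    \<le> (sqrt_iter_bound (m + k) - sqrt_iter_bound m) * norm x" for m k x
  proof (induction k)
    case (Suc k)
    have "norm (op_apply (Y (m + Suc k)) x - op_apply (Y m) x) \<le>
      norm (op_apply (Y (Suc (m + k))) x - op_apply (Y (m + k)) x) + norm (op_apply (Y (m + k)) x - op_apply (Y m) x)"
      using norm_triangle_ineq[of "op_apply (Y (Suc (m + k))) x - op_apply (Y (m + k)) x"
          "op_apply (Y (m + k)) x - op_apply (Y m) x"] by simp
    also have "\<dots> \<le> (sqrt_iter_bound (Suc (m + k)) - sqrt_iter_bound (m + k)) * norm x +
       (sqrt_iter_bound (m + k) - sqrt_iter_bound m) * norm x"
      unfolding Y_def by (intro add_mono norm_sqrt_iter_step[OF Z(2)] Suc[unfolded Y_def])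
    finally show ?case by (simp add: algebra_simps del: sqrt_iter_bound.simps)
  qed simp
  have "convergent (\<lambda>n. op_apply (Y n) x)" for x
  proof (rule Cauchy_convergent, rule metric_CauchyI)
    fix e :: real assume "0 < e"
    then have "0 < e / (norm x + 1)" by (simp add: add_nonneg_pos)
    then obtain M where M: "\<And>m n. m \<ge> M \<Longrightarrow> n \<ge> M \<Longrightarrow> dist (sqrt_iter_bound m) (sqrt_iter_bound n) < e / (norm x + 1)"
      using Cauchy_bound unfolding Cauchy_def by meson
    have less: "dist (op_apply (Y n) x) (op_apply (Y m) x) < e" if mn: "M \<le> m" "m \<le> n" for m n
    proof -
      obtain k where n: "n = m + k" using le_Suc_ex[OF mn(2)] by blast
      have "dist (op_apply (Y n) x) (op_apply (Y m) x) \<le> (sqrt_iter_bound n - sqrt_iter_bound m) * norm x"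
        using dist[of m k x] by (simp add: n dist_norm)
      also have "\<dots> \<le> e / (norm x + 1) * norm x"
        using M[of m n] mono[OF mn(2)] mn by (intro mult_right_mono) (simp_all add: dist_real_def)
      also have "\<dots> < e" using \<open>0 < e\<close> by (simp add: pos_divide_less_eq add_pos_nonneg distrib_left add.commute)
      finally show ?thesis .
    qed
    show "\<exists>M. \<forall>m\<ge>M. \<forall>n\<ge>M. dist (op_apply (Y m) x) (op_apply (Y n) x) < e"
    proof (intro exI allI impI)
      fix m n assume "M \<le> m" "M \<le> n"
      then show "dist (op_apply (Y m) x) (op_apply (Y n) x) < e"
        using less[of m n] less[of n m] by (cases "m \<le> n") (simp_all add: dist_commute)
    qed
  qed
  moreover have bound: "norm (op_apply (Y n) x) \<le> 1 * norm x" for n x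
    unfolding Y_def using norm_sqrt_iter[OF Z(2), of n x] sqrt_iter_bound_range(2)[of n]
    by (meson mult_right_mono norm_ge_zero order_trans)
  ultimately obtain L where L: "\<And>x. (\<lambda>n. op_apply (Y n) x) \<longlonglongrightarrow> op_apply L x"
    using ex_strong_limit[of Y 1] by blast
  have "contraction L"
    unfolding contraction_def
    by (intro allI LIMSEQ_le_const2[OF tendsto_norm[OF L]]) (use bound in auto)
  have L_adj: "adj L = L"
  proof (rule adj_eqI)
    fix x y
    have "cinner (op_apply (Y n) x) y = cinner x (op_apply (Y n) y)" for n
      using cinner_adj[of "Y n" x y] sqrt_iter_adj[OF Z(1), of n] by (simp add: Y_def)
    moreover have "(\<lambda>n. cinner (op_apply (Y n) x) y) \<longlonglongrightarrow> cinner (op_apply L x) y"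
      by (intro tendsto_cinner L tendsto_const)
    moreover have "(\<lambda>n. cinner x (op_apply (Y n) y)) \<longlonglongrightarrow> cinner x (op_apply L y)"
      by (intro tendsto_cinner L tendsto_const)
    ultimately show "cinner (op_apply L x) y = cinner x (op_apply L y)"
      by (simp add: LIMSEQ_unique)
  qed
  have square: "(\<lambda>n. op_apply (Y n * Y n) x) \<longlonglongrightarrow> op_apply (L * L) x" for x
  proof -
    have "(\<lambda>n. op_apply (Y n) (op_apply (Y n) x - op_apply L x)) \<longlonglongrightarrow> 0"
    proof (rule Lim_null_comparison[OF always_eventually])
      show "\<forall>n. norm (op_apply (Y n) (op_apply (Y n) x - op_apply L x)) \<le> norm (op_apply (Y n) x - op_apply L x)"
        using bound by simp
      show "(\<lambda>n. norm (op_apply (Y n) x - op_apply L x)) \<longlonglongrightarrow> 0"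
        using L by (simp add: tendsto_norm_zero_iff LIM_zero)
    qed
    then have "(\<lambda>n. op_apply (Y n) (op_apply (Y n) x - op_apply L x) + op_apply (Y n) (op_apply L x))
        \<longlonglongrightarrow> 0 + op_apply L (op_apply L x)"
      by (intro tendsto_add L)
    then show ?thesis by (simp add: op_apply_simps op_apply_linear)
  qed
  have "op_apply L x = op_apply ((1/2) *\<^sub>C (Z + L * L)) x" for x
  proof (rule LIMSEQ_unique)
    show "(\<lambda>n. op_apply (Y (Suc n)) x) \<longlonglongrightarrow> op_apply L x" by (rule LIMSEQ_Suc[OF L])
    have "(\<lambda>n. (1/2) *\<^sub>C (op_apply Z x + op_apply (Y n * Y n) x)) \<longlonglongrightarrow> (1/2) *\<^sub>C (op_apply Z x + op_apply (L * L) x)"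
      by (intro bounded_linear.tendsto[OF bounded_linear_scaleC] tendsto_add tendsto_const square)
    then show "(\<lambda>n. op_apply (Y (Suc n)) x) \<longlonglongrightarrow> op_apply ((1/2) *\<^sub>C (Z + L * L)) x"
      by (simp add: Y_def op_apply_simps)
  qed
  then have "L = (1/2) *\<^sub>C (Z + L * L)" by (rule op_eqI)
  then have "2 *\<^sub>C L = Z + L * L" using scaleC_scaleC[of 2 "1/2"] by (metis mult_cancel_left1 scaleC_one mult.commute nonzero_mult_div_cancel_right times_divide_eq_right zero_neq_numeral)
  moreover have "2 *\<^sub>C L = L + L" using scaleC_add_left[of 1 1 L] by (simp add: scaleC_one)
  ultimately have "(1 - L) * (1 - L) = 1 - Z" by (simp add: algebra_simps)
  moreover have "W * (1 - L) = (1 - L) * W" if "W * Z = Z * W" for W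
  proof -
    have "op_apply (W * L) x = op_apply (L * W) x" for x
    proof (rule LIMSEQ_unique)
      have "op_apply (W * Y n) x = op_apply (Y n * W) x" for n
        using sqrt_iter_commute[OF that, of n] by (simp add: Y_def)
      moreover have "(\<lambda>n. op_apply (W * Y n) x) \<longlonglongrightarrow> op_apply (W * L) x"
        unfolding op_apply_simps by (rule bounded_linear.tendsto[OF bounded_linear_op_apply L])
      ultimately show "(\<lambda>n. op_apply (Y n * W) x) \<longlonglongrightarrow> op_apply (W * L) x" by simp
      show "(\<lambda>n. op_apply (Y n * W) x) \<longlonglongrightarrow> op_apply (L * W) x"
        unfolding op_apply_simps by (rule L)
    qed
    then have "W * L = L * W" by (rule op_eqI)
    then show ?thesis by (simp add: algebra_simps)
  qed
  moreover have "positive_op (1 - L)"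
    by (rule positive_one_minus_contraction[OF L_adj \<open>contraction L\<close>])
  ultimately show ?thesis by blast
qed

lemma ex_positive_sqrt:
  assumes A: "positive_op A"
  shows "\<exists>S. positive_op S \<and> S * S = A \<and> (\<forall>W. W * A = A * W \<longrightarrow> W * S = S * W)"
proof -
  obtain c where c: "c > 0" "contraction (complex_of_real c *\<^sub>C A)"
    using ex_contractive_multiple by blast
  define B where "B = complex_of_real c *\<^sub>C A"
  have B: "positive_op B" "contraction B"
    using A c by (simp_all add: B_def positive_op_scale)
  have "\<exists>S. positive_op S \<and> S * S = 1 - (1 - B) \<and> (\<forall>W. W * (1 - B) = (1 - B) * W \<longrightarrow> W * S = S * W)"
    by (rule ex_sqrt_one_minus)
      (simp_all add: B contraction_one_minus adj_simps(3,7) positive_op_adj)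
  then obtain S where S: "positive_op S" "S * S = B" "\<And>W. W * (1 - B) = (1 - B) * W \<Longrightarrow> W * S = S * W"
    by (metis diff_diff_eq2 add_diff_cancel_left')
  define r where "r = inverse (sqrt c)"
  have r: "r * r * c = 1" using c(1) by (simp add: r_def field_simps)
  define S' where "S' = complex_of_real r *\<^sub>C S"
  have "S' * S' = complex_of_real (r * r * c) *\<^sub>C A"
    by (simp add: S'_def scaleC_mult_left scaleC_mult_right S(2) B_def scaleC_scaleC mult.assoc)
  then have "S' * S' = A" using r by (simp add: scaleC_one)
  moreover have "positive_op S'" unfolding S'_def using S(1) c(1) by (intro positive_op_scale) (simp_all add: r_def)
  moreover have "W * S' = S' * W" if "W * A = A * W" for W
  proof -
    have "W * (1 - B) = (1 - B) * W"
      by (simp add: B_def right_diff_distrib left_diff_distrib scaleC_mult_left scaleC_mult_right that)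
    then show ?thesis by (simp add: S'_def scaleC_mult_left scaleC_mult_right S(3))
  qed
  ultimately show ?thesis by blast
qed

text \<open>With a square root \<open>S\<close> of \<open>R\<close> the form \<open>cinner (R y) y\<close> is \<open>\<parallel>S y\<parallel>\<^sup>2\<close>.\<close>

lemma positive_op_kernel:
  assumes "positive_op R" "cinner (op_apply R y) y = 0"
  shows "op_apply R y = 0"
proof -
  obtain S where S: "positive_op S" "S * S = R" using ex_positive_sqrt[OF assms(1)] by blast
  have "cinner (op_apply S y) (op_apply S y) = cinner (op_apply R y) y"
    using cinner_adj[of S "op_apply S y" y] by (simp add: S(2)[symmetric] op_apply_simps positive_op_adj[OF S(1)])
  then have "op_apply S y = 0" by (simp add: assms(2) cinner_self)
  then show ?thesis by (simp add: S(2)[symmetric] op_apply_simps op_apply_linear)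
qed

text \<open>If \<open>P\<^sup>2 = Q\<^sup>2\<close> and \<open>P\<close>, \<open>Q\<close> commute, then \<open>D = P - Q\<close> satisfies \<open>D P D + D Q D = D (P\<^sup>2 - Q\<^sup>2) = 0\<close>.
  Both summands are positive, so \<open>P\<close> and \<open>Q\<close> vanish on the range of \<open>D\<close>. Hence \<open>D\<^sup>2 = 0\<close>, and
  \<open>D = 0\<close> because \<open>D\<close> is self-adjoint.\<close>

lemma commuting_positive_sqrt_unique:
  assumes P: "positive_op P" and Q: "positive_op Q" and comm: "P * Q = Q * P" and eq: "P * P = Q * Q"
  shows "P = Q"
proof -
  define D where "D = P - Q"
  have D_adj: "adj D = D" by (simp add: D_def adj_simps positive_op_adj P Q)
  have sa: "cinner (op_apply D a) b = cinner a (op_apply D b)" for a b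
    using cinner_adj[of D a b] D_adj by simp
  have DPQ: "D * P + D * Q = 0" by (simp add: D_def algebra_simps comm eq)
  have "op_apply D x = 0" for x
  proof -
    define y where "y = op_apply D x"
    have "cinner (op_apply P y) y + cinner (op_apply Q y) y = cinner (op_apply (D * P + D * Q) y) x"
      unfolding y_def sa[symmetric] by (simp only: op_apply_simps cinner_simps)
    then have sum0: "cinner (op_apply P y) y + cinner (op_apply Q y) y = 0"
      by (simp add: DPQ op_apply_simps cinner_simps)
    then have "Re (cinner (op_apply P y) y) + Re (cinner (op_apply Q y) y) = 0"
      by (simp only: plus_complex.sel(1)[symmetric] zero_complex.sel)
    then have "Re (cinner (op_apply P y) y) = 0"
      using positive_op_Re[OF P, of y] positive_op_Re[OF Q, of y] by linarith
    then have "cinner (op_apply P y) y = 0" using positive_op_real[OF P, of y] by simp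
    with sum0 have "op_apply P y = 0" "op_apply Q y = 0"
      using positive_op_kernel[OF P] positive_op_kernel[OF Q] by auto
    then have "op_apply D y = 0" by (simp add: D_def op_apply_simps)
    then have "cinner y y = 0" using sa[of x y] by (simp add: y_def cinner_simps)
    then show ?thesis by (simp add: y_def cinner_self)
  qed
  then have "D = 0" by (intro op_eqI) (simp add: op_apply_simps)
  then show ?thesis by (simp add: D_def)
qed

lemma positive_sqrt_unique:
  assumes "positive_op P" "positive_op Q" "P * P = Q * Q"
  shows "P = Q"
proof -
  obtain S where S: "positive_op S" "S * S = P * P" "\<And>W. W * (P * P) = P * P * W \<Longrightarrow> W * S = S * W"
    using ex_positive_sqrt[of "P * P"] positive_op_adj_mult[of P]
    unfolding positive_op_adj[OF assms(1)] by blast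
  have "P * S = S * P" by (rule S(3)) (simp only: mult.assoc)
  then have "P = S" by (rule commuting_positive_sqrt_unique[OF assms(1) S(1) _ S(2)[symmetric]])
  moreover have "Q * S = S * Q" by (rule S(3), unfold assms(3)) (simp only: mult.assoc)
  then have "Q = S"
    by (rule commuting_positive_sqrt_unique[OF assms(2) S(1) _ trans[OF assms(3)[symmetric] S(2)[symmetric]]])
  ultimately show ?thesis by simp
qed

lemma abs_op_eqI:
  assumes "positive_op P" "P * P = adj A * A"
  shows "abs_op A = P"
  unfolding abs_op_def
proof (rule the_equality)
  show "positive_op P \<and> P * P = adj A * A" using assms ..
  fix Q assume "positive_op Q \<and> Q * Q = adj A * A"
  then have "Q * Q = P * P" "positive_op Q" using assms(2) by (metis, metis)
  then show "Q = P" using assms(1) positive_sqrt_unique by metis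
qed

lemma positive_abs_op: "positive_op (abs_op A)"
  and abs_op_square: "abs_op A * abs_op A = adj A * A"
proof -
  obtain P where "positive_op P" "P * P = adj A * A"
    using ex_positive_sqrt[OF positive_op_adj_mult[of A]] by blast
  then show "positive_op (abs_op A)" "abs_op A * abs_op A = adj A * A"
    by (simp_all only: abs_op_eqI)
qed

lemma abs_op_scaleC: "abs_op (c *\<^sub>C A) = complex_of_real (cmod c) *\<^sub>C abs_op A"
proof (rule abs_op_eqI)
  show "positive_op (complex_of_real (cmod c) *\<^sub>C abs_op A)"
    by (simp add: positive_op_scale positive_abs_op)
  have "complex_of_real (cmod c) * complex_of_real (cmod c) = c * cnj c"
    by (simp add: complex_norm_square[symmetric] power2_eq_square)
  then show "complex_of_real (cmod c) *\<^sub>C abs_op A * complex_of_real (cmod c) *\<^sub>C abs_op A =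
    adj (c *\<^sub>C A) * c *\<^sub>C A"
    by (simp add: scaleC_mult_left scaleC_mult_right scaleC_scaleC abs_op_square adj_simps mult.commute)
qed

lemma norm_abs_op: "norm (op_apply (abs_op A) x) = norm (op_apply A x)"
proof -
  have "cinner (op_apply (abs_op A) x) (op_apply (abs_op A) x) = cinner x (op_apply (abs_op A * abs_op A) x)"
    using cinner_adj[of "abs_op A" x] by (simp add: positive_op_adj[OF positive_abs_op] op_apply_simps)
  also have "\<dots> = cinner (op_apply A x) (op_apply A x)"
    by (simp add: abs_op_square op_apply_simps cinner_adj)
  finally have "(norm (op_apply (abs_op A) x))\<^sup>2 = (norm (op_apply A x))\<^sup>2"
    by (simp only: cinner_self of_real_eq_iff)
  then show ?thesis by simp
qed

section \<open>Hilbert-Schmidt operators\<close>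

lemma has_sum_finite_sum:
  fixes g :: "'a \<Rightarrow> 'b \<Rightarrow> 'c::topological_comm_monoid_add"
  assumes "finite G" "\<And>e. e \<in> G \<Longrightarrow> (g e has_sum s e) F"
  shows "((\<lambda>f. \<Sum>e\<in>G. g e f) has_sum (\<Sum>e\<in>G. s e)) F"
  using assms by (induction G rule: finite_induct) (simp_all add: has_sum_add)

text \<open>By Parseval's identity both sums are the sum of \<open>|cinner (Z e) f|\<^sup>2\<close> over all pairs of basis
  vectors.\<close>

lemma hilbert_schmidt_basis_change:
  assumes E: "is_onb E" and F: "is_onb F"
    and summable: "(\<lambda>f. (norm (op_apply (adj Z) f))\<^sup>2) summable_on F"
  shows "(\<lambda>e. (norm (op_apply Z e))\<^sup>2) summable_on E"
    and "infsum (\<lambda>e. (norm (op_apply Z e))\<^sup>2) E \<le> infsum (\<lambda>f. (norm (op_apply (adj Z) f))\<^sup>2) F"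
proof -
  have finite_bound: "(\<Sum>e\<in>G. (norm (op_apply Z e))\<^sup>2) \<le> infsum (\<lambda>f. (norm (op_apply (adj Z) f))\<^sup>2) F"
    if G: "finite G" "G \<subseteq> E" for G
  proof (rule has_sum_mono)
    show "((\<lambda>f. \<Sum>e\<in>G. (cmod (cinner (op_apply Z e) f))\<^sup>2) has_sum (\<Sum>e\<in>G. (norm (op_apply Z e))\<^sup>2)) F"
      by (intro has_sum_finite_sum G parseval F)
    show "((\<lambda>f. (norm (op_apply (adj Z) f))\<^sup>2) has_sum infsum (\<lambda>f. (norm (op_apply (adj Z) f))\<^sup>2) F) F"
      using summable by (rule has_sum_infsum)
    fix f assume "f \<in> F"
    have "cmod (cinner (op_apply Z e) f) = cmod (cinner (op_apply (adj Z) f) e)" for e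
      by (metis cinner_adj cinner_commute complex_mod_cnj)
    then show "(\<Sum>e\<in>G. (cmod (cinner (op_apply Z e) f))\<^sup>2) \<le> (norm (op_apply (adj Z) f))\<^sup>2"
      using bessel_inequality[of G "op_apply (adj Z) f"] E G orthonormal_subset[of E G]
      by (simp add: is_onb_iff)
  qed
  show summable': "(\<lambda>e. (norm (op_apply Z e))\<^sup>2) summable_on E"
    by (rule nonneg_bdd_above_summable_on) (auto intro!: bdd_aboveI finite_bound)
  show "infsum (\<lambda>e. (norm (op_apply Z e))\<^sup>2) E \<le> infsum (\<lambda>f. (norm (op_apply (adj Z) f))\<^sup>2) F"
    by (rule infsum_le_finite_sums[OF summable']) (rule finite_bound)
qed

definition hilbert_schmidt :: "'h::complex_hilbert bounded_op \<Rightarrow> bool" where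
  "hilbert_schmidt Z \<longleftrightarrow> (\<lambda>e. (norm (op_apply Z e))\<^sup>2) summable_on some_onb"

definition hs_norm_square :: "'h::complex_hilbert bounded_op \<Rightarrow> real" where
  "hs_norm_square Z = (\<Sum>\<^sub>\<infinity>e\<in>some_onb. (norm (op_apply Z e))\<^sup>2)"

definition hs_inner :: "'h::complex_hilbert bounded_op \<Rightarrow> 'h bounded_op \<Rightarrow> complex" where
  "hs_inner U V = (\<Sum>\<^sub>\<infinity>e\<in>some_onb. cinner (op_apply U e) (op_apply V e))"

lemma hilbert_schmidt_has_sum:
  "hilbert_schmidt Z \<Longrightarrow> ((\<lambda>e. (norm (op_apply Z e))\<^sup>2) has_sum hs_norm_square Z) some_onb"
  unfolding hilbert_schmidt_def hs_norm_square_def by (rule has_sum_infsum)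

lemma hs_norm_square_nonneg: "0 \<le> hs_norm_square Z"
  unfolding hs_norm_square_def by (rule infsum_nonneg) simp

lemma hilbert_schmidt_adj: "hilbert_schmidt Z \<Longrightarrow> hilbert_schmidt (adj Z)"
  unfolding hilbert_schmidt_def
  by (rule hilbert_schmidt_basis_change(1)[OF some_onb some_onb]) (simp add: adj_simps)

lemma hs_norm_square_adj:
  assumes "hilbert_schmidt Z"
  shows "hs_norm_square (adj Z) = hs_norm_square Z"
proof (rule antisym)
  show "hs_norm_square (adj Z) \<le> hs_norm_square Z"
    using hilbert_schmidt_basis_change(2)[OF some_onb some_onb, of "adj Z"] assms
    by (simp add: adj_simps hilbert_schmidt_def hs_norm_square_def)
  show "hs_norm_square Z \<le> hs_norm_square (adj Z)"
    using hilbert_schmidt_basis_change(2)[OF some_onb some_onb, of Z] hilbert_schmidt_adj[OF assms]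
    by (simp add: hilbert_schmidt_def hs_norm_square_def)
qed

lemma hilbert_schmidt_mult_left:
  assumes Z: "hilbert_schmidt Z" and K: "\<And>x. norm (op_apply M x) \<le> K * norm x"
  shows "hilbert_schmidt (M * Z)" "hs_norm_square (M * Z) \<le> K\<^sup>2 * hs_norm_square Z"
proof -
  have le: "(norm (op_apply (M * Z) e))\<^sup>2 \<le> K\<^sup>2 * (norm (op_apply Z e))\<^sup>2" for e
    using power_mono[OF K[of "op_apply Z e"], of 2] by (simp add: op_apply_simps power_mult_distrib)
  have sum: "((\<lambda>e. K\<^sup>2 * (norm (op_apply Z e))\<^sup>2) has_sum K\<^sup>2 * hs_norm_square Z) some_onb"
    by (rule has_sum_cmult_right[OF hilbert_schmidt_has_sum[OF Z]])
  then show "hilbert_schmidt (M * Z)"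
    unfolding hilbert_schmidt_def
    by (rule summable_on_comparison_test[OF has_sum_imp_summable]) (use le in auto)
  then show "hs_norm_square (M * Z) \<le> K\<^sup>2 * hs_norm_square Z"
    using has_sum_mono[OF hilbert_schmidt_has_sum sum] le by blast
qed

lemma hilbert_schmidt_mult_right:
  assumes "hilbert_schmidt Z"
  shows "hilbert_schmidt (Z * M)"
proof -
  have "hilbert_schmidt (adj M * adj Z)"
    by (rule hilbert_schmidt_mult_left(1)[OF hilbert_schmidt_adj[OF assms] norm_op_apply])
  from hilbert_schmidt_adj[OF this] show ?thesis by (simp add: adj_simps)
qed

lemma hs_norm_square_contraction:
  assumes "hilbert_schmidt Z" "contraction M"
  shows "hs_norm_square (M * Z) \<le> hs_norm_square Z"
  using hilbert_schmidt_mult_left(2)[OF assms(1), of M 1] contractionD[OF assms(2)] by simp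

lemma hilbert_schmidt_scaleC:
  assumes "hilbert_schmidt Z"
  shows "hilbert_schmidt (c *\<^sub>C Z)" "hs_norm_square (c *\<^sub>C Z) = (cmod c)\<^sup>2 * hs_norm_square Z"
proof -
  have "((\<lambda>e. (norm (op_apply (c *\<^sub>C Z) e))\<^sup>2) has_sum (cmod c)\<^sup>2 * hs_norm_square Z) some_onb"
    using has_sum_cmult_right[OF hilbert_schmidt_has_sum[OF assms], of "(cmod c)\<^sup>2"]
    by (simp add: op_apply_simps norm_scaleC power_mult_distrib)
  then show "hilbert_schmidt (c *\<^sub>C Z)" "hs_norm_square (c *\<^sub>C Z) = (cmod c)\<^sup>2 * hs_norm_square Z"
    by (simp_all add: hilbert_schmidt_def hs_norm_square_def has_sum_iff)
qed

lemma hilbert_schmidt_add: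
  assumes "hilbert_schmidt U" "hilbert_schmidt V"
  shows "hilbert_schmidt (U + V)"
  unfolding hilbert_schmidt_def
proof (rule summable_on_comparison_test)
  show "(\<lambda>e. 2 * (norm (op_apply U e))\<^sup>2 + 2 * (norm (op_apply V e))\<^sup>2) summable_on some_onb"
    using assms unfolding hilbert_schmidt_def by (intro summable_on_add summable_on_cmult_right)
  show "(norm (op_apply (U + V) e))\<^sup>2 \<le> 2 * (norm (op_apply U e))\<^sup>2 + 2 * (norm (op_apply V e))\<^sup>2" for e
  proof -
    have "0 \<le> (norm (op_apply U e - op_apply V e))\<^sup>2" by simp
    then show ?thesis
      using parallelogram_law[of "op_apply U e" "op_apply V e"] unfolding op_apply_simps by linarith
  qed
qed simp

lemma hilbert_schmidt_diff:
  assumes "hilbert_schmidt U" "hilbert_schmidt V"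
  shows "hilbert_schmidt (U - V)"
  using hilbert_schmidt_add[OF assms(1) hilbert_schmidt_scaleC(1)[OF assms(2), of "-1"]]
  by (simp add: scaleC_algebra_simps scaleC_one)

lemma weighted_Cauchy_Schwarz:
  assumes "0 < s"
  shows "cmod (cinner x y) \<le> (s * (norm x)\<^sup>2 + (norm y)\<^sup>2 / s) / 2"
proof -
  have "0 \<le> (s * norm x - norm y)\<^sup>2 / s" using assms by simp
  also have "\<dots> = s * (norm x)\<^sup>2 + (norm y)\<^sup>2 / s - 2 * (norm x * norm y)"
    using assms by (simp add: field_simps power2_eq_square)
  finally have "norm x * norm y \<le> (s * (norm x)\<^sup>2 + (norm y)\<^sup>2 / s) / 2" by simp
  with cinner_Cauchy_Schwarz show ?thesis by (rule order_trans)
qed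

lemma hs_inner_abs_summable:
  assumes "hilbert_schmidt U" "hilbert_schmidt V"
  shows "(\<lambda>e. cmod (cinner (op_apply U e) (op_apply V e))) summable_on some_onb"
proof (rule summable_on_comparison_test)
  show "(\<lambda>e. 1/2 * (norm (op_apply U e))\<^sup>2 + 1/2 * (norm (op_apply V e))\<^sup>2) summable_on some_onb"
    using assms unfolding hilbert_schmidt_def by (intro summable_on_add summable_on_cmult_right)
  show "cmod (cinner (op_apply U e) (op_apply V e)) \<le> 1/2 * (norm (op_apply U e))\<^sup>2 + 1/2 * (norm (op_apply V e))\<^sup>2" for e
    using weighted_Cauchy_Schwarz[of 1 "op_apply U e" "op_apply V e"] by simp
qed simp

lemma hs_inner_summable:
  assumes "hilbert_schmidt U" "hilbert_schmidt V"
  shows "(\<lambda>e. cinner (op_apply U e) (op_apply V e)) summable_on some_onb"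
  by (rule abs_summable_summable[OF hs_inner_abs_summable[OF assms]])

lemma cmod_hs_inner_le:
  assumes "hilbert_schmidt U" "hilbert_schmidt V"
  shows "cmod (hs_inner U V) \<le> (hs_norm_square U + hs_norm_square V) / 2"
proof -
  have "((\<lambda>e. 1/2 * (norm (op_apply U e))\<^sup>2 + 1/2 * (norm (op_apply V e))\<^sup>2) has_sum
      1/2 * hs_norm_square U + 1/2 * hs_norm_square V) some_onb"
    by (intro has_sum_add has_sum_cmult_right hilbert_schmidt_has_sum assms)
  moreover have "cmod (cinner (op_apply U e) (op_apply V e)) \<le> 1/2 * (norm (op_apply U e))\<^sup>2 + 1/2 * (norm (op_apply V e))\<^sup>2" for e
    using weighted_Cauchy_Schwarz[of 1 "op_apply U e" "op_apply V e"] by simp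
  ultimately have "norm (hs_inner U V) \<le> 1/2 * hs_norm_square U + 1/2 * hs_norm_square V"
    unfolding hs_inner_def
    by (rule norm_infsum_le[OF has_sum_infsum[OF hs_inner_summable[OF assms]]])
  then show ?thesis by simp
qed

lemma hs_inner_cnj: "hs_inner U V = cnj (hs_inner V U)"
  unfolding hs_inner_def infsum_cnj[symmetric] by (subst cinner_commute) simp

lemma polarization_identity:
  "4 * cinner x y = of_real ((norm (x + y))\<^sup>2) - of_real ((norm (x - y))\<^sup>2)
    + \<i> * of_real ((norm (x + \<i> *\<^sub>C y))\<^sup>2) - \<i> * of_real ((norm (x - \<i> *\<^sub>C y))\<^sup>2)"
  unfolding cinner_self[symmetric] by (simp add: cinner_simps algebra_simps)

lemma hs_polarization_identity:
  assumes "hilbert_schmidt U" "hilbert_schmidt V"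
  shows "4 * hs_inner U V = of_real (hs_norm_square (U + V)) - of_real (hs_norm_square (U - V))
    + \<i> * of_real (hs_norm_square (U + \<i> *\<^sub>C V)) - \<i> * of_real (hs_norm_square (U - \<i> *\<^sub>C V))"
proof -
  have sum: "((\<lambda>e. complex_of_real ((norm (op_apply Z e))\<^sup>2)) has_sum of_real (hs_norm_square Z)) some_onb"
    if "hilbert_schmidt Z" for Z
    by (rule has_sum_of_real[OF hilbert_schmidt_has_sum[OF that]])
  have "((\<lambda>e. of_real ((norm (op_apply (U + V) e))\<^sup>2) - of_real ((norm (op_apply (U - V) e))\<^sup>2)
     + \<i> * of_real ((norm (op_apply (U + \<i> *\<^sub>C V) e))\<^sup>2)
     - \<i> * of_real ((norm (op_apply (U - \<i> *\<^sub>C V) e))\<^sup>2)) has_sum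
     of_real (hs_norm_square (U + V)) - of_real (hs_norm_square (U - V))
    + \<i> * of_real (hs_norm_square (U + \<i> *\<^sub>C V)) - \<i> * of_real (hs_norm_square (U - \<i> *\<^sub>C V))) some_onb"
    unfolding diff_conv_add_uminus[where 'a = complex]
    by (intro has_sum_add has_sum_uminusI has_sum_cmult_right sum hilbert_schmidt_add hilbert_schmidt_diff
        hilbert_schmidt_scaleC assms)
  moreover have "((\<lambda>e. 4 * cinner (op_apply U e) (op_apply V e)) has_sum 4 * hs_inner U V) some_onb"
    unfolding hs_inner_def
    by (intro has_sum_cmult_right has_sum_infsum hs_inner_summable assms)
  ultimately show ?thesis
    unfolding polarization_identity by (simp only: op_apply_simps) (rule has_sum_unique)
qed

text \<open>Since \<open>Z\<close> and \<open>adj Z\<close> have the same Hilbert-Schmidt norm, the polarization identity transports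
  the inner product; this is the trace property for products of Hilbert-Schmidt operators.\<close>

lemma hs_inner_adj:
  assumes U: "hilbert_schmidt U" and V: "hilbert_schmidt V"
  shows "hs_inner U V = hs_inner (adj V) (adj U)"
proof -
  note UV = hilbert_schmidt_add[OF U V] hilbert_schmidt_diff[OF U V]
    hilbert_schmidt_add[OF U hilbert_schmidt_scaleC(1)[OF V, of \<i>]]
    hilbert_schmidt_diff[OF U hilbert_schmidt_scaleC(1)[OF V, of \<i>]]
  note ad = hilbert_schmidt_adj[OF U] hilbert_schmidt_adj[OF V]
  have 1: "hs_norm_square (U + V) = hs_norm_square (adj V + adj U)"
    using hs_norm_square_adj[OF UV(1)] by (simp add: adj_simps add.commute)
  have 2: "hs_norm_square (U - V) = hs_norm_square (adj V - adj U)"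
    using hs_norm_square_adj[OF UV(2)]
      hilbert_schmidt_scaleC(2)[OF hilbert_schmidt_diff[OF ad], of "-1"]
    by (simp add: adj_simps scaleC_algebra_simps scaleC_one)
  \<comment> \<open>the adjoint conjugates \<open>\<i>\<close>; extracting a factor of modulus one restores the sign and swaps the
      two summands\<close>
  have 3: "hs_norm_square (U + \<i> *\<^sub>C V) = hs_norm_square (adj V + \<i> *\<^sub>C adj U)"
  proof -
    have "adj (U + \<i> *\<^sub>C V) = (- \<i>) *\<^sub>C (adj V + \<i> *\<^sub>C adj U)"
      by (simp add: adj_simps scaleC_add_right scaleC_algebra_simps scaleC_scaleC scaleC_one)
    then show ?thesis
      using hs_norm_square_adj[OF UV(3)] hilbert_schmidt_scaleC(2)[of "adj V + \<i> *\<^sub>C adj U" "- \<i>"]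
        hilbert_schmidt_add[OF ad(2) hilbert_schmidt_scaleC(1)[OF ad(1), of \<i>]] by simp
  qed
  have 4: "hs_norm_square (U - \<i> *\<^sub>C V) = hs_norm_square (adj V - \<i> *\<^sub>C adj U)"
  proof -
    have "adj (U - \<i> *\<^sub>C V) = \<i> *\<^sub>C (adj V - \<i> *\<^sub>C adj U)"
      by (simp add: adj_simps scaleC_algebra_simps scaleC_scaleC scaleC_one)
    then show ?thesis
      using hs_norm_square_adj[OF UV(4)] hilbert_schmidt_scaleC(2)[of "adj V - \<i> *\<^sub>C adj U" "\<i>"]
        hilbert_schmidt_diff[OF ad(2) hilbert_schmidt_scaleC(1)[OF ad(1), of \<i>]] by simp
  qed
  have "4 * hs_inner U V = 4 * hs_inner (adj V) (adj U)"
    unfolding hs_polarization_identity[OF U V] hs_polarization_identity[OF ad(2,1)] 1 2 3 4 ..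
  then show ?thesis by simp
qed

text \<open>A Hilbert-Schmidt bound on \<open>U k\<close> makes the tails of the sums uniformly small, because the
  weight \<open>s\<close> in the Cauchy-Schwarz inequality can be chosen before the finite part of the basis.\<close>

lemma hs_inner_tendsto_0:
  assumes U: "\<And>k. hilbert_schmidt (U k)" and M: "\<And>k. hs_norm_square (U k) \<le> M"
    and V: "hilbert_schmidt V"
    and lim: "\<And>e. (\<lambda>k. cinner (op_apply (U k) e) (op_apply V e)) \<longlonglongrightarrow> 0"
  shows "(\<lambda>k. hs_inner (U k) V) \<longlonglongrightarrow> 0"
proof (rule LIMSEQ_I)
  fix r :: real assume "0 < r"
  define \<epsilon> s where "\<epsilon> = r / 4" and "s = \<epsilon> / (M + 1)"
  have M0: "0 \<le> M" using M[of 0] hs_norm_square_nonneg[of "U 0"] by linarith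
  have \<epsilon>: "0 < \<epsilon>" using \<open>0 < r\<close> by (simp add: \<epsilon>_def)
  have s: "0 < s" "s * M \<le> \<epsilon>" using \<epsilon> M0 by (simp_all add: s_def field_simps)
  let ?E = "some_onb :: 'a set"
  let ?v = "\<lambda>e. (norm (op_apply V e))\<^sup>2" and ?u = "\<lambda>k e. (norm (op_apply (U k) e))\<^sup>2"
  let ?f = "\<lambda>k e. cinner (op_apply (U k) e) (op_apply V e)"
  have v_sum: "?v summable_on ?E" and u_sum: "?u k summable_on ?E" for k
    using U V by (simp_all add: hilbert_schmidt_def)
  obtain F where F: "finite F" "F \<subseteq> ?E" "dist (sum ?v F) (infsum ?v ?E) \<le> \<epsilon> * s"
    using infsum_finite_approximation[OF v_sum, of "\<epsilon> * s"] \<epsilon> s by auto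
  have split: "infsum h ?E = sum h F + infsum h (?E - F)" "h summable_on (?E - F)"
    if "h summable_on ?E" for h :: "'a \<Rightarrow> 'b::banach"
  proof -
    show *: "h summable_on (?E - F)" using that by (rule summable_on_subset_banach) auto
    have "infsum h (F \<union> (?E - F)) = infsum h F + infsum h (?E - F)"
      by (rule infsum_Un_disjoint) (use * F in auto)
    moreover have "F \<union> (?E - F) = ?E" using F by auto
    ultimately show "infsum h ?E = sum h F + infsum h (?E - F)" using F(1) by simp
  qed
  have v_tail: "infsum ?v (?E - F) \<le> \<epsilon> * s"
    using F(3) split(1)[OF v_sum] by (simp add: dist_real_def)
  have u_tail: "infsum (?u k) (?E - F) \<le> M" for k
  proof -
    have "0 \<le> sum (?u k) F" by (simp add: sum_nonneg)
    then show ?thesis using split(1)[OF u_sum, of k] M[of k] by (simp add: hs_norm_square_def)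
  qed
  have tail: "cmod (infsum (?f k) (?E - F)) \<le> \<epsilon>" for k
  proof -
    have "cmod (infsum (?f k) (?E - F)) \<le> (s / 2) * infsum (?u k) (?E - F) + (1/(2 * s)) * infsum ?v (?E - F)"
    proof (rule norm_infsum_le)
      show "(?f k has_sum infsum (?f k) (?E - F)) (?E - F)"
        by (rule has_sum_infsum[OF split(2)[OF hs_inner_summable[OF U V]]])
      show "((\<lambda>e. (s / 2) * ?u k e + (1/(2 * s)) * ?v e) has_sum
          (s / 2) * infsum (?u k) (?E - F) + (1/(2 * s)) * infsum ?v (?E - F)) (?E - F)"
        by (intro has_sum_add has_sum_cmult_right has_sum_infsum split(2) u_sum v_sum)
      show "cmod (?f k e) \<le> (s / 2) * ?u k e + (1/(2 * s)) * ?v e" for e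
        using weighted_Cauchy_Schwarz[OF s(1), of "op_apply (U k) e" "op_apply V e"]
        by (simp add: add_divide_distrib mult.commute)
    qed
    also have "\<dots> \<le> (s / 2) * M + (1/(2 * s)) * (\<epsilon> * s)"
      using s(1) by (intro add_mono mult_left_mono u_tail v_tail) simp_all
    also have "\<dots> = (s * M + \<epsilon>) / 2" using s(1) by (simp add: field_simps)
    also have "\<dots> \<le> \<epsilon>" using s(2) by simp
    finally show ?thesis .
  qed
  have "(\<lambda>k. sum (?f k) F) \<longlonglongrightarrow> (\<Sum>e\<in>F. 0)" by (intro tendsto_sum lim)
  then have "(\<lambda>k. sum (?f k) F) \<longlonglongrightarrow> 0" by simp
  then obtain N where N: "\<And>k. k \<ge> N \<Longrightarrow> norm (sum (?f k) F) < \<epsilon>"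
    using LIMSEQ_D[OF _ \<epsilon>] by fastforce
  have "norm (hs_inner (U k) V - 0) < r" if "k \<ge> N" for k
  proof -
    have "norm (hs_inner (U k) V) \<le> norm (sum (?f k) F) + norm (infsum (?f k) (?E - F))"
      unfolding hs_inner_def split(1)[OF hs_inner_summable[OF U V]] by (rule norm_triangle_ineq)
    also have "\<dots> < \<epsilon> + \<epsilon>" by (rule add_less_le_mono[OF N[OF that] tail])
    also have "\<dots> < r" using \<open>0 < r\<close> by (simp add: \<epsilon>_def)
    finally show ?thesis by simp
  qed
  then show "\<exists>N. \<forall>k\<ge>N. norm (hs_inner (U k) V - 0) < r" by blast
qed

section \<open>Trace class operators\<close>

text \<open>This is the form in which trace class operators are used below. Unlike the definition through
  the absolute value, it is visibly stable under multiplication by bounded operators.\<close>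

definition hs_product :: "'h::complex_hilbert bounded_op \<Rightarrow> bool" where
  "hs_product C \<longleftrightarrow> (\<exists>X S. hilbert_schmidt X \<and> hilbert_schmidt S \<and> C = X * S)"

lemma hs_product_mult_left: "hs_product C \<Longrightarrow> hs_product (M * C)"
  unfolding hs_product_def using hilbert_schmidt_mult_left(1)[OF _ norm_op_apply] by (metis mult.assoc)

lemma op_trace_eq_hs_inner:
  assumes "hilbert_schmidt X" "hilbert_schmidt S"
  shows "((\<lambda>e. cinner (op_apply (X * S) e) e) has_sum hs_inner S (adj X)) some_onb"
    and "op_trace (X * S) = hs_inner S (adj X)"
proof -
  have eq: "cinner (op_apply (X * S) e) e = cinner (op_apply S e) (op_apply (adj X) e)" for e
    by (simp add: op_apply_simps cinner_adj)
  show "((\<lambda>e. cinner (op_apply (X * S) e) e) has_sum hs_inner S (adj X)) some_onb"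
    unfolding eq hs_inner_def
    by (rule has_sum_infsum[OF hs_inner_summable[OF assms(2) hilbert_schmidt_adj[OF assms(1)]]])
  show "op_trace (X * S) = hs_inner S (adj X)"
    unfolding op_trace_def eq hs_inner_def ..
qed

lemma op_trace_hilbert_schmidt_commute:
  assumes "hilbert_schmidt X" "hilbert_schmidt S"
  shows "op_trace (X * S) = op_trace (S * X)"
  using hs_inner_adj[OF assms(1) hilbert_schmidt_adj[OF assms(2)]]
  by (simp add: op_trace_eq_hs_inner[OF assms] op_trace_eq_hs_inner[OF assms(2,1)] adj_simps)

lemma op_trace_mult_commute:
  assumes "hs_product C"
  shows "op_trace (M * C) = op_trace (C * M)"
proof -
  obtain X S where XS: "hilbert_schmidt X" "hilbert_schmidt S" "C = X * S"
    using assms by (auto simp: hs_product_def)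
  have "op_trace ((M * X) * S) = op_trace (S * (M * X))"
    by (rule op_trace_hilbert_schmidt_commute[OF hilbert_schmidt_mult_left(1)[OF XS(1) norm_op_apply] XS(2)])
  also have "\<dots> = op_trace ((S * M) * X)" by (simp add: mult.assoc)
  also have "\<dots> = op_trace (X * (S * M))"
    by (rule op_trace_hilbert_schmidt_commute[OF hilbert_schmidt_mult_right[OF XS(2)] XS(1)])
  finally show ?thesis by (simp add: XS(3) mult.assoc)
qed

lemma diagonal_summable:
  assumes "hs_product C"
  shows "(\<lambda>e. cinner (op_apply C e) e) summable_on some_onb"
proof -
  obtain X S where XS: "hilbert_schmidt X" "hilbert_schmidt S" "C = X * S"
    using assms by (auto simp: hs_product_def)
  show ?thesis unfolding XS(3) by (rule has_sum_imp_summable[OF op_trace_eq_hs_inner(1)[OF XS(1,2)]])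
qed

text \<open>With \<open>D = 1 - B\<close>, the numbers \<open>cinner (B D\<^sup>k z) (D\<^sup>k z)\<close> decrease in \<open>k\<close>, and their sum
  telescopes because \<open>D\<^sup>2 \<le> D\<close>; so the \<open>k\<close>-th one is at most the mean of the first \<open>k + 1\<close>. This
  is the operator form of the estimate \<open>\<lambda> (1 - \<lambda>)\<^sup>2\<^sup>k \<le> 1 / (k + 1)\<close> for \<open>0 \<le> \<lambda> \<le> 1\<close>.\<close>

lemma power_decay:
  assumes B: "positive_op B" "contraction B"
  shows "Re (cinner (op_apply B (op_apply ((1 - B) ^ k) z)) (op_apply ((1 - B) ^ k) z))
    \<le> (norm z)\<^sup>2 / real (k + 1)"
proof -
  define D where "D = 1 - B"
  define w where "w k = op_apply (D ^ k) z" for k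
  define b where "b k = Re (cinner (op_apply B (w k)) (w k))" for k
  have D: "adj D = D" "contraction D" using B by (simp_all add: D_def adj_simps positive_op_adj contraction_one_minus)
  have D_pos: "positive_op D" unfolding D_def by (rule positive_one_minus_contraction) (simp_all add: B positive_op_adj)
  have w_Suc: "w (Suc k) = op_apply D (w k)" for k by (simp add: w_def op_apply_simps)
  have saD: "cinner (op_apply D x) y = cinner x (op_apply D y)" for x y using cinner_adj[of D x y] D by simp
  have B_D: "op_apply B x = x - op_apply D x" for x by (simp add: D_def op_apply_simps)
  have decreasing: "b (Suc k) \<le> b k" for k
  proof -
    define u where "u = op_apply B (w k)"
    have "b k - b (Suc k) = Re (cinner u u) + Re (cinner (op_apply D u) u)"
      unfolding b_def w_Suc u_def B_D by (simp add: op_apply_linear cinner_simps saD)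
    moreover have "0 \<le> Re (cinner u u)" by (simp add: Re_cinner_self)
    moreover have "0 \<le> Re (cinner (op_apply D u) u)" by (rule positive_op_Re[OF D_pos])
    ultimately show ?thesis by linarith
  qed
  have telescope: "b k \<le> (norm (w k))\<^sup>2 - (norm (w (Suc k)))\<^sup>2" for k
    using positive_contraction_square_le[OF D_pos D(2), of "w k"]
    by (simp add: b_def w_Suc B_D cinner_simps Re_cinner_self)
  have "b k \<le> b j" if "j \<le> k" for j
    using lift_Suc_antimono_le[of b, OF decreasing that] .
  then have "(\<Sum>j<Suc k. b k) \<le> (\<Sum>j<Suc k. b j)" by (intro sum_mono) auto
  also have "\<dots> \<le> (\<Sum>j<Suc k. (norm (w j))\<^sup>2 - (norm (w (Suc j)))\<^sup>2)" by (intro sum_mono telescope)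
  also have "\<dots> = (norm (w 0))\<^sup>2 - (norm (w (Suc k)))\<^sup>2" by (rule sum_lessThan_telescope')
  also have "\<dots> \<le> (norm z)\<^sup>2" by (simp add: w_def op_apply_simps)
  finally have "real (Suc k) * b k \<le> (norm z)\<^sup>2" by simp
  then show ?thesis by (simp add: b_def w_def D_def field_simps)
qed

lemma norm_square_decay_tendsto_0:
  fixes f :: "nat \<Rightarrow> 'h::complex_hilbert"
  assumes "\<And>k. c * (norm (f k))\<^sup>2 \<le> r / real (k + 1)" "0 < c"
  shows "f \<longlonglongrightarrow> 0"
proof -
  have "(\<lambda>k. (r / c) * inverse (real (Suc k))) \<longlonglongrightarrow> (r / c) * 0"
    by (intro tendsto_mult tendsto_const LIMSEQ_inverse_real_of_nat)
  then have "(\<lambda>k. (r / c) * inverse (real (Suc k))) \<longlonglongrightarrow> 0" by simp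
  then have "(\<lambda>k. (norm (f k))\<^sup>2) \<longlonglongrightarrow> 0"
  proof (rule tendsto_sandwich[OF _ _ tendsto_const, rotated 2])
    show "\<forall>\<^sub>F k in sequentially. (norm (f k))\<^sup>2 \<le> (r / c) * inverse (real (Suc k))"
    proof (intro always_eventually allI)
      fix k
      have "(norm (f k))\<^sup>2 \<le> (r / real (k + 1)) / c"
        using assms by (simp only: pos_le_divide_eq mult.commute[of _ c])
      then show "(norm (f k))\<^sup>2 \<le> (r / c) * inverse (real (Suc k))"
        by (simp add: divide_inverse ac_simps)
    qed
  qed simp
  from tendsto_real_sqrt[OF this] have "(\<lambda>k. norm (f k)) \<longlonglongrightarrow> 0" by simp
  then show ?thesis by (rule tendsto_norm_zero_cancel)
qed

text \<open>The partial sums of the formal inverse of \<open>B = 1 - (1 - B)\<close>.\<close>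

definition neumann_sum :: "'h::complex_hilbert bounded_op \<Rightarrow> nat \<Rightarrow> 'h bounded_op" where
  "neumann_sum B k = (\<Sum>j<k. (1 - B) ^ j)"

lemma neumann_sum_mult: "B * neumann_sum B k = 1 - (1 - B) ^ k" "neumann_sum B k * B = 1 - (1 - B) ^ k"
proof -
  have "B * (1 - B) = (1 - B) * B" by (simp add: algebra_simps)
  then have comm: "(1 - B) ^ j * B = B * (1 - B) ^ j" for j
    by (intro power_intertwine) simp
  show "B * neumann_sum B k = 1 - (1 - B) ^ k"
    by (induction k) (simp_all add: neumann_sum_def distrib_left left_diff_distrib)
  then show "neumann_sum B k * B = 1 - (1 - B) ^ k"
    by (simp add: neumann_sum_def sum_distrib_left sum_distrib_right comm)
qed

text \<open>A trace class operator \<open>A\<close> with absolute value \<open>P = S\<^sup>2\<close> factors as \<open>X S\<close>, where formally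
  \<open>X = A P\<^sup>-\<^sup>1 S\<close>. A partial Neumann series for \<open>P\<^sup>-\<^sup>1\<close> gives operators \<open>X\<^sub>k\<close> converging strongly to
  \<open>X\<close>, and \<open>\<parallel>A v\<parallel> = \<parallel>P v\<parallel>\<close> gives \<open>\<parallel>X z\<parallel> = \<parallel>S z\<parallel>\<close>. So both factors are Hilbert-Schmidt with the
  trace norm of \<open>A\<close> as squared norm.\<close>

lemma trace_class_factorization:
  assumes "A \<in> trace_class"
  shows "\<exists>X S. hilbert_schmidt X \<and> hilbert_schmidt S \<and> A = X * S \<and>
    hs_norm_square X \<le> trace_norm A \<and> hs_norm_square S \<le> trace_norm A"
proof -
  define P where "P = abs_op A"
  have P: "positive_op P" by (simp add: P_def positive_abs_op)
  obtain S where S: "positive_op S" "S * S = P" using ex_positive_sqrt[OF P] by blast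
  have S_adj: "adj S = S" by (rule positive_op_adj[OF S(1)])
  have S_form: "cinner (op_apply P x) x = of_real ((norm (op_apply S x))\<^sup>2)" for x
    using cinner_adj[of S "op_apply S x" x] by (simp add: S(2)[symmetric] op_apply_simps S_adj cinner_self)
  obtain E where E: "is_onb E" "(\<lambda>e. cinner (op_apply P e) e) summable_on E"
    using assms by (auto simp: trace_class_def P_def)
  have "(\<lambda>e. (norm (op_apply S e))\<^sup>2) summable_on E"
    using summable_on_Re[OF E(2)] by (simp add: S_form)
  then have HS_S: "hilbert_schmidt S"
    unfolding hilbert_schmidt_def
    by (intro hilbert_schmidt_basis_change(1)[OF some_onb E(1)]) (simp add: S_adj)
  have tn: "trace_norm A = hs_norm_square S"
  proof -
    have "(\<Sum>\<^sub>\<infinity>e\<in>some_onb. cinner (op_apply P e) e) = of_real (hs_norm_square S)"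
      unfolding S_form by (rule infsumI[OF has_sum_of_real[OF hilbert_schmidt_has_sum[OF HS_S]]])
    then show ?thesis by (simp add: trace_norm_def P_def)
  qed
  obtain c where c: "c > 0" "contraction (complex_of_real c *\<^sub>C P)"
    using ex_contractive_multiple by blast
  define B where "B = complex_of_real c *\<^sub>C P"
  have B: "positive_op B" "contraction B" using P c by (simp_all add: B_def positive_op_scale)
  define D where "D = 1 - B"
  have "S * D = D * S"
    by (simp add: D_def B_def S(2)[symmetric] algebra_simps scaleC_mult_left scaleC_mult_right)
  then have comm: "D ^ k * S = S * D ^ k" for k by (intro power_intertwine) simp
  have S_decay: "(\<lambda>k. op_apply (S * D ^ k) z) \<longlonglongrightarrow> 0" for z
  proof (rule norm_square_decay_tendsto_0[OF _ c(1)])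
    fix k
    show "c * (norm (op_apply (S * D ^ k) z))\<^sup>2 \<le> (norm z)\<^sup>2 / real (k + 1)"
      using power_decay[OF B, of k z] S_form[of "op_apply (D ^ k) z"]
      by (simp add: D_def[symmetric]) (simp add: B_def op_apply_simps cinner_simps)
  qed
  have A_P: "norm (op_apply A v) = norm (op_apply P v)" for v by (simp add: P_def norm_abs_op)
  define Q where "Q k = (complex_of_real c *\<^sub>C neumann_sum B k) * S" for k
  have PQ: "P * Q k = S - S * D ^ k" for k
  proof -
    have "P * Q k = (B * neumann_sum B k) * S"
      by (simp add: Q_def B_def scaleC_mult_left scaleC_mult_right mult.assoc)
    then show ?thesis by (simp add: neumann_sum_mult D_def[symmetric] left_diff_distrib comm)
  qed
  have PQ_lim: "(\<lambda>k. op_apply (P * Q k) z) \<longlonglongrightarrow> op_apply S z" for z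
    using tendsto_diff[OF tendsto_const S_decay, of "op_apply S z" z] by (simp add: PQ op_apply_simps)
  have conv: "convergent (\<lambda>k. op_apply (A * Q k) z)" for z
  proof (rule Cauchy_convergent)
    have "dist (op_apply (A * Q k) z) (op_apply (A * Q l) z) = dist (op_apply (P * Q k) z) (op_apply (P * Q l) z)" for k l
      using A_P[of "op_apply (Q k) z - op_apply (Q l) z"] by (simp add: dist_norm op_apply_simps op_apply_linear)
    moreover have "Cauchy (\<lambda>k. op_apply (P * Q k) z)"
      using PQ_lim by (intro convergent_Cauchy) (auto simp: convergent_def)
    ultimately show "Cauchy (\<lambda>k. op_apply (A * Q k) z)" by (simp add: Cauchy_def)
  qed
  have bound: "norm (op_apply (A * Q k) z) \<le> (2 * op_norm S) * norm z" for k z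
  proof -
    have "norm (op_apply (A * Q k) z) = norm (op_apply (P * Q k) z)"
      using A_P[of "op_apply (Q k) z"] by (simp add: op_apply_simps)
    also have "\<dots> \<le> norm (op_apply S z) + norm (op_apply S (op_apply (D ^ k) z))"
      unfolding PQ op_apply_simps by (rule norm_triangle_ineq4)
    also have "\<dots> \<le> op_norm S * norm z + op_norm S * norm z"
    proof (rule add_mono[OF norm_op_apply order_trans[OF norm_op_apply]])
      have "norm (op_apply (D ^ k) z) \<le> norm z"
        using contraction_power[OF contraction_one_minus[OF B], of k] by (simp add: D_def contractionD)
      then show "op_norm S * norm (op_apply (D ^ k) z) \<le> op_norm S * norm z"
        by (rule mult_left_mono) (rule op_norm_nonneg)
    qed
    finally show ?thesis by simp
  qed
  obtain X where X: "\<And>z. (\<lambda>k. op_apply (A * Q k) z) \<longlonglongrightarrow> op_apply X z"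
    using ex_strong_limit[OF conv bound] by blast
  have norm_X: "norm (op_apply X z) = norm (op_apply S z)" for z
  proof (rule LIMSEQ_unique[OF tendsto_norm[OF X]])
    show "(\<lambda>k. norm (op_apply (A * Q k) z)) \<longlonglongrightarrow> norm (op_apply S z)"
      using tendsto_norm[OF PQ_lim[of z]] A_P by (simp add: op_apply_simps)
  qed
  have "op_apply A z = op_apply (X * S) z" for z
  proof (rule LIMSEQ_unique)
    have "neumann_sum B k * B = 1 - D ^ k" for k by (simp add: neumann_sum_mult D_def)
    then have QS: "Q k * S = 1 - D ^ k" for k
      by (simp add: Q_def B_def mult.assoc S(2) scaleC_mult_left scaleC_mult_right)
    show "(\<lambda>k. op_apply (A * Q k) (op_apply S z)) \<longlonglongrightarrow> op_apply (X * S) z"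
      unfolding op_apply_simps(6)[of X S] by (rule X)
    have "(\<lambda>k. op_apply S (op_apply (S * D ^ k) z)) \<longlonglongrightarrow> op_apply S 0"
      by (rule bounded_linear.tendsto[OF bounded_linear_op_apply S_decay])
    then have "(\<lambda>k. op_apply P (op_apply (D ^ k) z)) \<longlonglongrightarrow> 0"
      by (simp add: S(2)[symmetric] op_apply_simps op_apply_linear)
    then have "(\<lambda>k. op_apply A (op_apply (D ^ k) z)) \<longlonglongrightarrow> 0"
      by (subst (asm) tendsto_norm_zero_iff[symmetric], subst tendsto_norm_zero_iff[symmetric])
        (simp only: A_P)
    from tendsto_diff[OF tendsto_const this, of "op_apply A z"]
    have "(\<lambda>k. op_apply A (op_apply (1 - D ^ k) z)) \<longlonglongrightarrow> op_apply A z"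
      by (simp add: op_apply_simps op_apply_linear)
    then show "(\<lambda>k. op_apply (A * Q k) (op_apply S z)) \<longlonglongrightarrow> op_apply A z"
      unfolding QS[symmetric] by (simp add: op_apply_simps)
  qed
  then have "A = X * S" by (rule op_eqI)
  moreover have "hilbert_schmidt X" "hs_norm_square X = hs_norm_square S"
    using HS_S by (simp_all add: hilbert_schmidt_def hs_norm_square_def norm_X)
  ultimately show ?thesis using HS_S tn by (metis order_refl)
qed

lemma trace_class_hs_product: "A \<in> trace_class \<Longrightarrow> hs_product A"
  unfolding hs_product_def using trace_class_factorization by blast

lemma cmod_op_trace_le:
  assumes "A \<in> trace_class"
  shows "cmod (op_trace A) \<le> trace_norm A"
proof -
  obtain X S where XS: "hilbert_schmidt X" "hilbert_schmidt S" "A = X * S"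
    "hs_norm_square X \<le> trace_norm A" "hs_norm_square S \<le> trace_norm A"
    using trace_class_factorization[OF assms] by blast
  have "cmod (hs_inner S (adj X)) \<le> (hs_norm_square S + hs_norm_square (adj X)) / 2"
    by (rule cmod_hs_inner_le[OF XS(2) hilbert_schmidt_adj[OF XS(1)]])
  moreover have "op_trace A = hs_inner S (adj X)"
    unfolding XS(3) by (rule op_trace_eq_hs_inner(2)[OF XS(1,2)])
  ultimately show ?thesis using XS(4,5) unfolding hs_norm_square_adj[OF XS(1)] by simp
qed

lemma op_trace_diff:
  assumes "hs_product A" "hs_product B"
  shows "op_trace (A - B) = op_trace A - op_trace B"
proof -
  have "((\<lambda>e. cinner (op_apply A e) e + - cinner (op_apply B e) e) has_sum op_trace A + - op_trace B) some_onb"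
    unfolding op_trace_def by (intro has_sum_add has_sum_uminusI has_sum_infsum diagonal_summable assms)
  then show ?thesis
    by (simp add: op_trace_def[of "A - B"] op_apply_simps cinner_simps infsumI)
qed

lemma hs_product_scaleC:
  assumes "hs_product C"
  shows "hs_product (c *\<^sub>C C)"
  using hs_product_mult_left[OF assms, of "c *\<^sub>C 1"] by (simp add: scaleC_mult_left)

lemma op_trace_scaleC: "op_trace (c *\<^sub>C A) = c * op_trace A"
  unfolding op_trace_def op_apply_simps cinner_simps by (rule infsum_cmult_right')

text \<open>Neither \<open>A\<close> nor \<open>B\<close> need be trace class, so the two products have to be compared through an
  approximate inverse \<open>L\<^sub>k\<close> of \<open>A\<close>: the partial Neumann sum for \<open>(A\<^sup>* A)\<^sup>-\<^sup>1\<close>, times \<open>A\<^sup>*\<close>. As \<open>A B\<close> is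
  trace class, \<open>Tr (A \<cdot> L\<^sub>k A B) = Tr (L\<^sub>k A B \<cdot> A)\<close>. Here \<open>A L\<^sub>k = 1 - D\<^sub>1\<^sup>k\<close> and \<open>L\<^sub>k A = 1 - D\<^sub>0\<^sup>k\<close> with
  \<open>D\<^sub>0 = 1 - A\<^sup>* A\<close> and \<open>D\<^sub>1 = 1 - A A\<^sup>*\<close>, and the error terms \<open>Tr (D\<^sub>1\<^sup>k A B)\<close> and \<open>Tr (B A D\<^sub>0\<^sup>k)\<close> tend to
  \<open>0\<close> because \<open>D\<^sub>1\<^sup>k A = A D\<^sub>0\<^sup>k\<close> does so strongly.\<close>

lemma op_trace_commute_contraction:
  assumes A: "contraction A" and AB: "hs_product (A * B)" and BA: "hs_product (B * A)"
  shows "op_trace (A * B) = op_trace (B * A)"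
proof -
  obtain X S where XS: "hilbert_schmidt X" "hilbert_schmidt S" "A * B = X * S"
    using AB by (auto simp: hs_product_def)
  obtain X' S' where XS': "hilbert_schmidt X'" "hilbert_schmidt S'" "B * A = X' * S'"
    using BA by (auto simp: hs_product_def)
  have A_adj: "contraction (adj A)"
    unfolding contraction_def
  proof
    fix x
    have "(norm (op_apply (adj A) x))\<^sup>2 = cmod (cinner (op_apply A (op_apply (adj A) x)) x)"
      by (simp add: cinner_adj cinner_self norm_power)
    also have "\<dots> \<le> norm (op_apply A (op_apply (adj A) x)) * norm x" by (rule cinner_Cauchy_Schwarz)
    also have "\<dots> \<le> norm (op_apply (adj A) x) * norm x" by (rule mult_right_mono[OF contractionD[OF A]]) simp
    finally show "norm (op_apply (adj A) x) \<le> norm x"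
      by (cases "norm (op_apply (adj A) x) = 0") (simp_all add: power2_eq_square)
  qed
  define B0 B1 where "B0 = adj A * A" and "B1 = A * adj A"
  define D0 D1 where "D0 = 1 - B0" and "D1 = 1 - B1"
  have B0: "positive_op B0" "contraction B0" and B1: "positive_op B1" "contraction B1"
    using positive_op_adj_mult[of A] positive_op_adj_mult[of "adj A"] A A_adj
    by (auto simp: B0_def B1_def adj_simps contraction_def op_apply_simps intro: order_trans)
  have D0: "contraction (D0 ^ k)" "adj (D0 ^ k) = D0 ^ k" and D1: "contraction (D1 ^ k)" "adj (D1 ^ k) = D1 ^ k" for k
    using B0 B1 by (simp_all add: D0_def D1_def contraction_power contraction_one_minus adj_power adj_simps positive_op_adj)
  have "D1 * A = A * D0" by (simp add: D0_def D1_def B0_def B1_def algebra_simps)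
  then have inter: "D1 ^ k * A = A * D0 ^ k" for k by (rule power_intertwine)
  have A_decay: "(\<lambda>k. op_apply A (op_apply (D0 ^ k) z)) \<longlonglongrightarrow> 0" for z
  proof (rule norm_square_decay_tendsto_0[where c = 1])
    show "1 * (norm (op_apply A (op_apply (D0 ^ k) z)))\<^sup>2 \<le> (norm z)\<^sup>2 / real (k + 1)" for k
      using power_decay[OF B0, of k z]
      by (simp add: D0_def[symmetric]) (simp add: B0_def op_apply_simps cinner_adj_left cinner_self)
  qed simp
  define L where "L k = neumann_sum B0 k * adj A" for k
  have AL: "A * L k = 1 - D1 ^ k" for k
  proof -
    have "A * neumann_sum B0 k = neumann_sum B1 k * A"
      by (simp add: neumann_sum_def sum_distrib_left sum_distrib_right D0_def[symmetric] D1_def[symmetric] inter)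
    then have "A * L k = neumann_sum B1 k * B1" by (simp add: L_def B1_def mult.assoc[symmetric])
    then show ?thesis by (simp add: neumann_sum_mult D1_def)
  qed
  have LA: "L k * A = 1 - D0 ^ k" for k
    using neumann_sum_mult(2)[of B0 k] by (simp add: L_def B0_def D0_def mult.assoc)
  have eq: "op_trace (A * B) - op_trace (D1 ^ k * (A * B)) = op_trace (B * A) - op_trace (D0 ^ k * (B * A))" for k
  proof -
    have "op_trace (A * B) - op_trace (D1 ^ k * (A * B)) = op_trace (A * (L k * (A * B)))"
      using op_trace_diff[OF AB hs_product_mult_left[OF AB, of "D1 ^ k"]] AL[of k]
      by (simp add: mult.assoc[symmetric] left_diff_distrib)
    also have "\<dots> = op_trace (L k * (A * B) * A)"
      by (rule op_trace_mult_commute[OF hs_product_mult_left[OF AB]])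
    also have "\<dots> = op_trace (B * A) - op_trace (D0 ^ k * (B * A))"
      using op_trace_diff[OF BA hs_product_mult_left[OF BA, of "D0 ^ k"]] LA[of k]
      by (simp add: mult.assoc[symmetric] left_diff_distrib)
    finally show ?thesis .
  qed
  have "(\<lambda>k. op_trace (D1 ^ k * (A * B))) \<longlonglongrightarrow> 0"
  proof -
    define U where "U k = adj X * D1 ^ k" for k
    have U_adj: "U k = adj (D1 ^ k * X)" for k by (simp add: U_def adj_simps D1)
    have HS: "hilbert_schmidt (D1 ^ k * X)" for k
      by (rule hilbert_schmidt_mult_left(1)[OF XS(1) norm_op_apply])
    \<comment> \<open>the conjugate moves the varying factor to the first argument, while the diagonal entries
        still contain \<open>D\<^sub>1\<^sup>k X S = D\<^sub>1\<^sup>k A B\<close>\<close>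
    have "op_trace (D1 ^ k * (A * B)) = cnj (hs_inner (U k) S)" for k
      using op_trace_eq_hs_inner(2)[OF HS XS(2), of k]
      by (simp add: XS(3) mult.assoc U_adj[symmetric] hs_inner_cnj[of S])
    moreover have "(\<lambda>k. hs_inner (U k) S) \<longlonglongrightarrow> 0"
    proof (rule hs_inner_tendsto_0[OF _ _ XS(2)])
      show "hilbert_schmidt (U k)" for k unfolding U_adj by (rule hilbert_schmidt_adj[OF HS])
      show "hs_norm_square (U k) \<le> hs_norm_square X" for k
        unfolding U_adj hs_norm_square_adj[OF HS] by (rule hs_norm_square_contraction[OF XS(1) D1(1)])
      fix e
      have "cinner (op_apply (U k) e) (op_apply S e) = cinner e (op_apply A (op_apply (D0 ^ k) (op_apply B e)))" for k
      proof -
        have "cinner (op_apply (U k) e) (op_apply S e) = cinner e (op_apply (D1 ^ k * (X * S)) e)"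
          unfolding U_adj cinner_adj_left by (simp add: op_apply_simps)
        also have "D1 ^ k * (X * S) = A * D0 ^ k * B"
          by (simp add: XS(3)[symmetric] inter mult.assoc[symmetric])
        finally show ?thesis by (simp add: op_apply_simps)
      qed
      then show "(\<lambda>k. cinner (op_apply (U k) e) (op_apply S e)) \<longlonglongrightarrow> 0"
        using tendsto_cinner[OF tendsto_const A_decay[of "op_apply B e"], of e] by (simp add: cinner_simps)
    qed
    ultimately show ?thesis using tendsto_cnj by fastforce
  qed
  moreover have "(\<lambda>k. op_trace (D0 ^ k * (B * A))) \<longlonglongrightarrow> 0"
  proof -
    have HS: "hilbert_schmidt (S' * D0 ^ k)" for k by (rule hilbert_schmidt_mult_right[OF XS'(2)])
    have "op_trace (D0 ^ k * (B * A)) = hs_inner (S' * D0 ^ k) (adj X')" for k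
      using op_trace_mult_commute[OF BA, of "D0 ^ k"] op_trace_eq_hs_inner(2)[OF XS'(1) HS, of k]
      by (simp add: XS'(3) mult.assoc)
    moreover have "(\<lambda>k. hs_inner (S' * D0 ^ k) (adj X')) \<longlonglongrightarrow> 0"
    proof (rule hs_inner_tendsto_0[OF HS _ hilbert_schmidt_adj[OF XS'(1)]])
      fix k
      have "hs_norm_square (S' * D0 ^ k) = hs_norm_square (D0 ^ k * adj S')"
        using hs_norm_square_adj[OF HS, of k] by (simp add: adj_simps D0)
      also have "\<dots> \<le> hs_norm_square (adj S')"
        by (rule hs_norm_square_contraction[OF hilbert_schmidt_adj[OF XS'(2)] D0(1)])
      finally show "hs_norm_square (S' * D0 ^ k) \<le> hs_norm_square (adj S')" .
    next
      fix e
      have "cinner (op_apply (S' * D0 ^ k) e) (op_apply (adj X') e) = cinner (op_apply B (op_apply A (op_apply (D0 ^ k) e))) e" for k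
      proof -
        have "cinner (op_apply (S' * D0 ^ k) e) (op_apply (adj X') e) = cinner (op_apply (X' * S' * D0 ^ k) e) e"
          by (simp add: op_apply_simps cinner_adj)
        then show ?thesis by (simp add: XS'(3)[symmetric] op_apply_simps)
      qed
      then show "(\<lambda>k. cinner (op_apply (S' * D0 ^ k) e) (op_apply (adj X') e)) \<longlonglongrightarrow> 0"
        using tendsto_cinner[OF bounded_linear.tendsto[OF bounded_linear_op_apply A_decay[of e]] tendsto_const, of B e]
        by (simp add: op_apply_linear cinner_simps)
    qed
    ultimately show ?thesis by simp
  qed
  ultimately have "(\<lambda>k. op_trace (A * B) - op_trace (D1 ^ k * (A * B))) \<longlonglongrightarrow> op_trace (A * B) - 0"
    and "(\<lambda>k. op_trace (B * A) - op_trace (D0 ^ k * (B * A))) \<longlonglongrightarrow> op_trace (B * A) - 0"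
    by - (rule tendsto_diff[OF tendsto_const], assumption)+
  then show ?thesis unfolding eq diff_zero by (rule LIMSEQ_unique)
qed

theorem op_trace_commute:
  assumes "A * B \<in> trace_class" "B * A \<in> trace_class"
  shows "op_trace (A * B) = op_trace (B * A)"
proof -
  obtain c where c: "c > 0" "contraction (complex_of_real c *\<^sub>C A)"
    using ex_contractive_multiple by blast
  have "hs_product (complex_of_real c *\<^sub>C A * B)" "hs_product (B * complex_of_real c *\<^sub>C A)"
    using assms by (simp_all add: scaleC_mult_left scaleC_mult_right hs_product_scaleC trace_class_hs_product)
  from op_trace_commute_contraction[OF c(2) this] show ?thesis
    using c(1) by (simp add: scaleC_mult_left scaleC_mult_right op_trace_scaleC)
qed

lemma trace_norm_nonneg: "0 \<le> trace_norm A"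
proof (cases "(\<lambda>e. cinner (op_apply (abs_op A) e) e) summable_on some_onb")
  case True
  then have "((\<lambda>e. Re (cinner (op_apply (abs_op A) e) e)) has_sum trace_norm A) some_onb"
    unfolding trace_norm_def by (intro has_sum_Re has_sum_infsum)
  then show ?thesis by (rule has_sum_nonneg) (simp add: positive_op_Re[OF positive_abs_op])
qed (simp add: trace_norm_def infsum_not_exists)

lemma trace_norm_scaleC: "trace_norm (c *\<^sub>C A) = cmod c * trace_norm A"
  by (simp add: trace_norm_def abs_op_scaleC op_apply_simps cinner_simps infsum_cmult_right')

lemma trace_class_scaleC:
  assumes "A \<in> trace_class"
  shows "c *\<^sub>C A \<in> trace_class"
proof -
  obtain E where "is_onb E" "(\<lambda>e. cinner (op_apply (abs_op A) e) e) summable_on E"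
    using assms by (auto simp: trace_class_def)
  then show ?thesis
    unfolding trace_class_def
    by (auto simp: abs_op_scaleC op_apply_simps cinner_simps intro!: exI[of _ E] summable_on_cmult_right)
qed

section \<open>Completions\<close>

locale seminormed_subspace =
  fixes V :: "'a::complex_vector set" and \<nu> :: "'a \<Rightarrow> real"
  assumes subspace: "cvec.subspace V"
    and nonneg: "x \<in> V \<Longrightarrow> 0 \<le> \<nu> x"
    and triangle: "x \<in> V \<Longrightarrow> y \<in> V \<Longrightarrow> \<nu> (x + y) \<le> \<nu> x + \<nu> y"
    and scale_le: "x \<in> V \<Longrightarrow> \<nu> (c *\<^sub>C x) \<le> cmod c * \<nu> x"
begin

lemmas closed = cvec.subspace_0[OF subspace] cvec.subspace_add[OF subspace]
  cvec.subspace_diff[OF subspace] cvec.subspace_scale[OF subspace] cvec.subspace_neg[OF subspace]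

lemma seminorm_0: "\<nu> 0 = 0"
  using scale_le[OF closed(1), of 0] nonneg[OF closed(1)] by (simp add: scaleC_algebra_simps)

lemma seminorm_minus: "x \<in> V \<Longrightarrow> \<nu> (- x) = \<nu> x"
  using scale_le[of x "-1"] scale_le[of "- x" "-1"] closed(5)[of x]
  by (simp add: scaleC_algebra_simps scaleC_one)

lemma seminorm_diff_commute: "x \<in> V \<Longrightarrow> y \<in> V \<Longrightarrow> \<nu> (x - y) = \<nu> (y - x)"
  using seminorm_minus[of "x - y"] closed by simp

lemma seminorm_diff_triangle: "x \<in> V \<Longrightarrow> y \<in> V \<Longrightarrow> z \<in> V \<Longrightarrow> \<nu> (x - z) \<le> \<nu> (x - y) + \<nu> (y - z)"
  using triangle[of "x - y" "y - z"] closed by simp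

lemma seminorm_abs_diff: "x \<in> V \<Longrightarrow> y \<in> V \<Longrightarrow> \<bar>\<nu> x - \<nu> y\<bar> \<le> \<nu> (x - y)"
  using triangle[of "x - y" y] triangle[of "y - x" x] seminorm_diff_commute[of x y] closed by simp

lemma seminorm_sum_list: "(\<And>x. x \<in> set L \<Longrightarrow> f x \<in> V) \<Longrightarrow>
    (\<Sum>x\<leftarrow>L. f x) \<in> V \<and> \<nu> (\<Sum>x\<leftarrow>L. f x) \<le> (\<Sum>x\<leftarrow>L. \<nu> (f x))"
proof (induction L)
  case (Cons x L)
  then show ?case using triangle[of "f x" "\<Sum>x\<leftarrow>L. f x"] closed by force
qed (simp add: closed seminorm_0)

lemma cauchy_seqsD: "s \<in> cauchy_seqs V \<nu> \<Longrightarrow> s i \<in> V"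
  "s \<in> cauchy_seqs V \<nu> \<Longrightarrow> 0 < e \<Longrightarrow> \<exists>N. \<forall>i\<ge>N. \<forall>j\<ge>N. \<nu> (s i - s j) < e"
  by (simp_all add: cauchy_seqs_def)

lemma cauchy_seqs_const: "x \<in> V \<Longrightarrow> (\<lambda>_. x) \<in> cauchy_seqs V \<nu>"
  by (simp add: cauchy_seqs_def seminorm_0)

lemma null_relI:
  assumes "s \<in> cauchy_seqs V \<nu>" "t \<in> cauchy_seqs V \<nu>" "\<And>i. \<nu> (s i - t i) \<le> f i" "f \<longlonglongrightarrow> 0"
  shows "(s, t) \<in> null_rel V \<nu>"
proof -
  have "(\<lambda>i. \<nu> (s i - t i)) \<longlonglongrightarrow> 0"
    by (rule tendsto_sandwich[OF _ _ tendsto_const assms(4)])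
      (use assms closed cauchy_seqsD in \<open>auto intro!: always_eventually nonneg\<close>)
  then show ?thesis using assms by (simp add: null_rel_def)
qed

lemma null_relD:
  assumes "(s, t) \<in> null_rel V \<nu>"
  shows "s \<in> cauchy_seqs V \<nu>" "t \<in> cauchy_seqs V \<nu>" "(\<lambda>i. \<nu> (s i - t i)) \<longlonglongrightarrow> 0"
  using assms by (auto simp: null_rel_def)

lemma equiv_null_rel: "equiv (cauchy_seqs V \<nu>) (null_rel V \<nu>)"
proof (rule equivI)
  show "null_rel V \<nu> \<subseteq> cauchy_seqs V \<nu> \<times> cauchy_seqs V \<nu>" by (auto simp: null_rel_def)
  show "refl_on (cauchy_seqs V \<nu>) (null_rel V \<nu>)"
    by (rule refl_onI) (auto simp: null_rel_def seminorm_0)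
  show "sym (null_rel V \<nu>)"
  proof (rule symI)
    fix s t assume st: "(s, t) \<in> null_rel V \<nu>"
    show "(t, s) \<in> null_rel V \<nu>"
      by (rule null_relI[OF null_relD(2,1)[OF st] _ null_relD(3)[OF st]])
        (simp add: seminorm_diff_commute cauchy_seqsD null_relD(1,2)[OF st])
  qed
  show "trans (null_rel V \<nu>)"
  proof (rule transI)
    fix s t u assume st: "(s, t) \<in> null_rel V \<nu>" and tu: "(t, u) \<in> null_rel V \<nu>"
    have "(\<lambda>i. \<nu> (s i - t i) + \<nu> (t i - u i)) \<longlonglongrightarrow> 0 + 0"
      by (intro tendsto_add null_relD(3)[OF st] null_relD(3)[OF tu])
    then show "(s, u) \<in> null_rel V \<nu>"
      by (intro null_relI[OF null_relD(1)[OF st] null_relD(2)[OF tu]])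
        (auto intro: seminorm_diff_triangle simp: cauchy_seqsD null_relD(1,2)[OF st] null_relD(2)[OF tu])
  qed
qed

definition cls :: "(nat \<Rightarrow> 'a) \<Rightarrow> (nat \<Rightarrow> 'a) set" where
  "cls s = null_rel V \<nu> `` {s}"

lemma cls_in_completion: "s \<in> cauchy_seqs V \<nu> \<Longrightarrow> cls s \<in> completion V \<nu>"
  unfolding completion_def cls_def by (rule quotientI)

lemma completionE:
  assumes "c \<in> completion V \<nu>"
  obtains s where "s \<in> cauchy_seqs V \<nu>" "c = cls s"
  using assms unfolding completion_def cls_def by (rule quotientE)

lemma in_cls_self: "s \<in> cauchy_seqs V \<nu> \<Longrightarrow> s \<in> cls s"
  unfolding cls_def by (rule equiv_class_self[OF equiv_null_rel])

lemma in_clsD: "t \<in> cls s \<Longrightarrow> (s, t) \<in> null_rel V \<nu>"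
  by (simp add: cls_def)

text \<open>The operations on completions are defined by applying them to all representatives and
  saturating; the result is the class of a single one.\<close>

lemma image_null_rel_eq_cls:
  assumes "s \<in> X" "\<And>t. t \<in> X \<Longrightarrow> (s, t) \<in> null_rel V \<nu>"
  shows "null_rel V \<nu> `` X = cls s"
proof -
  have "null_rel V \<nu> `` {t} = cls s" if "t \<in> X" for t
    unfolding cls_def by (rule equiv_class_eq[OF equiv_null_rel, symmetric]) (rule assms(2)[OF that])
  then show ?thesis using assms(1) by (auto simp: Image_def)
qed

lemma cauchy_seqs_add:
  assumes s: "s \<in> cauchy_seqs V \<nu>" and t: "t \<in> cauchy_seqs V \<nu>"
  shows "(\<lambda>i. s i + t i) \<in> cauchy_seqs V \<nu>"
  unfolding cauchy_seqs_def
proof (intro CollectI conjI allI impI)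
  show "s i + t i \<in> V" for i using s t by (simp add: closed cauchy_seqsD)
  fix e :: real assume "0 < e"
  then obtain M N where M: "\<And>i j. i \<ge> M \<Longrightarrow> j \<ge> M \<Longrightarrow> \<nu> (s i - s j) < e / 2"
    and N: "\<And>i j. i \<ge> N \<Longrightarrow> j \<ge> N \<Longrightarrow> \<nu> (t i - t j) < e / 2"
    using cauchy_seqsD(2)[OF s half_gt_zero] cauchy_seqsD(2)[OF t half_gt_zero] by meson
  have "\<nu> (s i + t i - (s j + t j)) < e" if "i \<ge> max M N" "j \<ge> max M N" for i j
  proof -
    have "\<nu> (s i + t i - (s j + t j)) \<le> \<nu> (s i - s j) + \<nu> (t i - t j)"
      using triangle[of "s i - s j" "t i - t j"] s t by (simp add: closed cauchy_seqsD add_diff_add)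
    then show ?thesis using M[of i j] N[of i j] that by simp
  qed
  then show "\<exists>N. \<forall>i\<ge>N. \<forall>j\<ge>N. \<nu> (s i + t i - (s j + t j)) < e" by blast
qed

lemma completion_add_cls:
  assumes s: "s \<in> cauchy_seqs V \<nu>" and t: "t \<in> cauchy_seqs V \<nu>"
  shows "completion_add V \<nu> (cls s) (cls t) = cls (\<lambda>i. s i + t i)"
  unfolding completion_add_def
proof (rule image_null_rel_eq_cls)
  show "(\<lambda>i. s i + t i) \<in> {\<lambda>i. a i + b i | a b. a \<in> cls s \<and> b \<in> cls t}"
    using in_cls_self[OF s] in_cls_self[OF t] by blast
  fix u assume "u \<in> {\<lambda>i. a i + b i | a b. a \<in> cls s \<and> b \<in> cls t}"
  then obtain a b where u: "u = (\<lambda>i. a i + b i)" and a: "(s, a) \<in> null_rel V \<nu>" and b: "(t, b) \<in> null_rel V \<nu>"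
    by (auto dest!: in_clsD)
  show "((\<lambda>i. s i + t i), u) \<in> null_rel V \<nu>"
    unfolding u
  proof (rule null_relI)
    show "(\<lambda>i. s i + t i) \<in> cauchy_seqs V \<nu>" "(\<lambda>i. a i + b i) \<in> cauchy_seqs V \<nu>"
      by (intro cauchy_seqs_add s t null_relD(2)[OF a] null_relD(2)[OF b])+
    show "\<nu> (s i + t i - (a i + b i)) \<le> \<nu> (s i - a i) + \<nu> (t i - b i)" for i
      using triangle[of "s i - a i" "t i - b i"] null_relD(1,2)[OF a] null_relD(1,2)[OF b]
      by (simp add: closed cauchy_seqsD add_diff_add)
    show "(\<lambda>i. \<nu> (s i - a i) + \<nu> (t i - b i)) \<longlonglongrightarrow> 0"
      using tendsto_add[OF null_relD(3)[OF a] null_relD(3)[OF b]] by simp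
  qed
qed

lemma completion_norm_cls:
  assumes s: "s \<in> cauchy_seqs V \<nu>"
  shows "(\<lambda>i. \<nu> (s i)) \<longlonglongrightarrow> completion_norm \<nu> (cls s)"
proof -
  have "Cauchy (\<lambda>i. \<nu> (s i))"
  proof (rule CauchyI)
    fix e :: real assume "0 < e"
    then obtain N where "\<forall>i\<ge>N. \<forall>j\<ge>N. \<nu> (s i - s j) < e" using cauchy_seqsD(2)[OF s] by blast
    then have "\<forall>i\<ge>N. \<forall>j\<ge>N. norm (\<nu> (s i) - \<nu> (s j)) < e"
      using seminorm_abs_diff cauchy_seqsD(1)[OF s] by (metis order_le_less_trans real_norm_def)
    then show "\<exists>N. \<forall>i\<ge>N. \<forall>j\<ge>N. norm (\<nu> (s i) - \<nu> (s j)) < e" by blast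
  qed
  then obtain r where r: "(\<lambda>i. \<nu> (s i)) \<longlonglongrightarrow> r"
    using Cauchy_convergent convergent_def by blast
  have "(\<lambda>i. \<nu> (t i)) \<longlonglongrightarrow> r" if "t \<in> cls s" for t
  proof -
    note st = in_clsD[OF that]
    have "(\<lambda>i. \<nu> (t i) - \<nu> (s i)) \<longlonglongrightarrow> 0"
    proof (rule Lim_null_comparison[OF always_eventually null_relD(3)[OF st]], rule allI)
      fix i show "norm (\<nu> (t i) - \<nu> (s i)) \<le> \<nu> (s i - t i)"
        using seminorm_abs_diff[of "s i" "t i"] by (simp add: cauchy_seqsD null_relD(1,2)[OF st] abs_minus_commute)
    qed
    from tendsto_add[OF this r] show ?thesis by simp
  qed
  then have "completion_norm \<nu> (cls s) = r"
    unfolding completion_norm_def using in_cls_self[OF s] r LIMSEQ_unique by (intro the_equality) blast+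
  with r show ?thesis by simp
qed

end

text \<open>Besides the Hochschild boundary this covers multiplication by scalars, because
  \<^const>\<open>completion_scale\<close> is an instance of \<^const>\<open>completion_map\<close>.\<close>

locale bounded_map = V: seminormed_subspace V \<nu> + W: seminormed_subspace W \<mu>
  for V :: "'a::complex_vector set" and \<nu> and W :: "'b::complex_vector set" and \<mu> +
  fixes f :: "'a \<Rightarrow> 'b" and C :: real
  assumes maps: "x \<in> V \<Longrightarrow> f x \<in> W"
    and diff: "x \<in> V \<Longrightarrow> y \<in> V \<Longrightarrow> f (x - y) = f x - f y"
    and bound: "x \<in> V \<Longrightarrow> \<mu> (f x) \<le> C * \<nu> x"
    and bound_nonneg: "0 \<le> C"
begin

lemma bound_diff: "x \<in> V \<Longrightarrow> y \<in> V \<Longrightarrow> \<mu> (f x - f y) \<le> C * \<nu> (x - y)"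
  using bound[of "x - y"] by (simp add: diff V.closed)

lemma cauchy_seqs_map:
  assumes s: "s \<in> cauchy_seqs V \<nu>"
  shows "(\<lambda>i. f (s i)) \<in> cauchy_seqs W \<mu>"
  unfolding cauchy_seqs_def
proof (intro CollectI conjI allI impI)
  show "f (s i) \<in> W" for i using V.cauchy_seqsD(1)[OF s] by (rule maps)
  fix e :: real assume "0 < e"
  then have "0 < e / (C + 1)" using bound_nonneg by simp
  then obtain N where N: "\<And>i j. i \<ge> N \<Longrightarrow> j \<ge> N \<Longrightarrow> \<nu> (s i - s j) < e / (C + 1)"
    using V.cauchy_seqsD(2)[OF s] by meson
  have "\<mu> (f (s i) - f (s j)) < e" if "i \<ge> N" "j \<ge> N" for i j
  proof -
    have "\<mu> (f (s i) - f (s j)) \<le> C * \<nu> (s i - s j)"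
      by (intro bound_diff V.cauchy_seqsD(1)[OF s])
    also have "\<dots> \<le> (C + 1) * \<nu> (s i - s j)"
      by (simp add: distrib_right V.nonneg V.closed V.cauchy_seqsD(1)[OF s])
    also have "\<dots> < e" using N[OF that] bound_nonneg by (simp add: pos_less_divide_eq mult.commute)
    finally show ?thesis .
  qed
  then show "\<exists>N. \<forall>i\<ge>N. \<forall>j\<ge>N. \<mu> (f (s i) - f (s j)) < e" by blast
qed

lemma completion_map_cls:
  assumes s: "s \<in> cauchy_seqs V \<nu>"
  shows "completion_map W \<mu> f (V.cls s) = W.cls (\<lambda>i. f (s i))"
  unfolding completion_map_def
proof (rule W.image_null_rel_eq_cls)
  show "(\<lambda>i. f (s i)) \<in> (\<lambda>s i. f (s i)) ` V.cls s"
    using V.in_cls_self[OF s] by (rule imageI)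
  fix u assume "u \<in> (\<lambda>s i. f (s i)) ` V.cls s"
  then obtain t where u: "u = (\<lambda>i. f (t i))" and t: "(s, t) \<in> null_rel V \<nu>" by (auto dest!: V.in_clsD)
  note st = V.null_relD[OF t]
  show "((\<lambda>i. f (s i)), u) \<in> null_rel W \<mu>"
    unfolding u
  proof (rule W.null_relI)
    show "(\<lambda>i. f (s i)) \<in> cauchy_seqs W \<mu>" "(\<lambda>i. f (t i)) \<in> cauchy_seqs W \<mu>"
      by (rule cauchy_seqs_map st(1,2))+
    show "\<mu> (f (s i) - f (t i)) \<le> C * \<nu> (s i - t i)" for i
      by (intro bound_diff V.cauchy_seqsD(1)[OF st(1)] V.cauchy_seqsD(1)[OF st(2)])
    show "(\<lambda>i. C * \<nu> (s i - t i)) \<longlonglongrightarrow> 0"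
      using tendsto_mult[OF tendsto_const st(3), of C] by simp
  qed
qed

end

context seminormed_subspace
begin

lemma bounded_map_scaleC: "bounded_map V \<nu> V \<nu> (\<lambda>x. c *\<^sub>C x) (cmod c)"
  by unfold_locales (simp_all add: closed scale_le scaleC_algebra_simps)

lemma completion_scale_cls:
  assumes "s \<in> cauchy_seqs V \<nu>"
  shows "completion_scale V \<nu> c (cls s) = cls (\<lambda>i. c *\<^sub>C s i)"
    and "(\<lambda>i. c *\<^sub>C s i) \<in> cauchy_seqs V \<nu>"
proof -
  interpret bounded_map V \<nu> V \<nu> "\<lambda>x. c *\<^sub>C x" "cmod c" by (rule bounded_map_scaleC)
  have "{\<lambda>i. c *\<^sub>C s i | s. s \<in> cls s'} = (\<lambda>s i. c *\<^sub>C s i) ` cls s'" for s' by auto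
  then show "completion_scale V \<nu> c (cls s) = cls (\<lambda>i. c *\<^sub>C s i)"
    using completion_map_cls[OF assms] by (simp add: completion_scale_def completion_map_def)
  show "(\<lambda>i. c *\<^sub>C s i) \<in> cauchy_seqs V \<nu>" by (rule cauchy_seqs_map[OF assms])
qed

end

locale bounded_functional = seminormed_subspace V \<nu> for V :: "'a::complex_vector set" and \<nu> +
  fixes \<tau> :: "'a \<Rightarrow> complex"
  assumes functional_add: "x \<in> V \<Longrightarrow> y \<in> V \<Longrightarrow> \<tau> (x + y) = \<tau> x + \<tau> y"
    and functional_scale: "x \<in> V \<Longrightarrow> \<tau> (c *\<^sub>C x) = c * \<tau> x"
    and functional_bound: "x \<in> V \<Longrightarrow> cmod (\<tau> x) \<le> \<nu> x"
begin

definition extension :: "(nat \<Rightarrow> 'a) set \<Rightarrow> complex" where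
  "extension = (\<lambda>c\<in>completion V \<nu>. THE z. \<forall>s\<in>c. (\<lambda>i. \<tau> (s i)) \<longlonglongrightarrow> z)"

lemma functional_diff:
  assumes "x \<in> V" "y \<in> V"
  shows "\<tau> (x - y) = \<tau> x - \<tau> y"
  using functional_add[of x "(-1) *\<^sub>C y"] functional_scale[of y "-1"] assms closed
  by (simp add: scaleC_algebra_simps scaleC_one)

lemma cmod_functional_diff: "x \<in> V \<Longrightarrow> y \<in> V \<Longrightarrow> cmod (\<tau> x - \<tau> y) \<le> \<nu> (x - y)"
  using functional_bound[of "x - y"] by (simp add: functional_diff closed)

lemma extension_cls:
  assumes s: "s \<in> cauchy_seqs V \<nu>"
  shows "(\<lambda>i. \<tau> (s i)) \<longlonglongrightarrow> extension (cls s)"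
proof -
  have "Cauchy (\<lambda>i. \<tau> (s i))"
  proof (rule CauchyI)
    fix e :: real assume "0 < e"
    then obtain N where "\<forall>i\<ge>N. \<forall>j\<ge>N. \<nu> (s i - s j) < e" using cauchy_seqsD(2)[OF s] by blast
    then have "\<forall>i\<ge>N. \<forall>j\<ge>N. norm (\<tau> (s i) - \<tau> (s j)) < e"
      using cmod_functional_diff cauchy_seqsD(1)[OF s] by (meson order_le_less_trans)
    then show "\<exists>N. \<forall>i\<ge>N. \<forall>j\<ge>N. norm (\<tau> (s i) - \<tau> (s j)) < e" by blast
  qed
  then obtain z where z: "(\<lambda>i. \<tau> (s i)) \<longlonglongrightarrow> z"
    using Cauchy_convergent convergent_def by blast
  have "(\<lambda>i. \<tau> (t i)) \<longlonglongrightarrow> z" if "t \<in> cls s" for t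
  proof -
    note st = in_clsD[OF that]
    have "(\<lambda>i. \<tau> (t i) - \<tau> (s i)) \<longlonglongrightarrow> 0"
    proof (rule Lim_null_comparison[OF always_eventually null_relD(3)[OF st]], rule allI)
      fix i show "norm (\<tau> (t i) - \<tau> (s i)) \<le> \<nu> (s i - t i)"
        using cmod_functional_diff[of "s i" "t i"]
        by (simp add: cauchy_seqsD null_relD(1,2)[OF st] norm_minus_commute)
    qed
    from tendsto_add[OF this z] show ?thesis by simp
  qed
  then have "(THE z. \<forall>s\<in>cls s. (\<lambda>i. \<tau> (s i)) \<longlonglongrightarrow> z) = z"
    using in_cls_self[OF s] z LIMSEQ_unique by (intro the_equality) blast+
  with z show ?thesis by (simp add: extension_def cls_in_completion[OF s])
qed

lemma extension_const: "x \<in> V \<Longrightarrow> extension (cls (\<lambda>_. x)) = \<tau> x"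
  using extension_cls[OF cauchy_seqs_const] LIMSEQ_unique[OF tendsto_const] by metis

lemma extension_add:
  assumes "c \<in> completion V \<nu>" "d \<in> completion V \<nu>"
  shows "extension (completion_add V \<nu> c d) = extension c + extension d"
proof -
  obtain s where s: "s \<in> cauchy_seqs V \<nu>" "c = cls s" using assms(1) by (rule completionE)
  obtain t where t: "t \<in> cauchy_seqs V \<nu>" "d = cls t" using assms(2) by (rule completionE)
  have "(\<lambda>i. \<tau> (s i + t i)) \<longlonglongrightarrow> extension (cls s) + extension (cls t)"
    using tendsto_add[OF extension_cls[OF s(1)] extension_cls[OF t(1)]]
    by (simp add: functional_add cauchy_seqsD s(1) t(1))
  from LIMSEQ_unique[OF extension_cls[OF cauchy_seqs_add[OF s(1) t(1)]] this]
  show ?thesis by (simp add: s(2) t(2) completion_add_cls[OF s(1) t(1)])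
qed

lemma extension_in_dual: "extension \<in> completion_dual V \<nu>"
  unfolding completion_dual_def
proof (intro CollectI conjI ballI allI exI)
  show "extension \<in> extensional (completion V \<nu>)" by (simp add: extension_def)
  show "extension (completion_add V \<nu> c d) = extension c + extension d"
    if "c \<in> completion V \<nu>" "d \<in> completion V \<nu>" for c d using that by (rule extension_add)
  show "extension (completion_scale V \<nu> a c) = a * extension c" if c: "c \<in> completion V \<nu>" for a c
  proof -
    obtain s where s: "s \<in> cauchy_seqs V \<nu>" "c = cls s" using c by (rule completionE)
    have "(\<lambda>i. \<tau> (a *\<^sub>C s i)) \<longlonglongrightarrow> a * extension (cls s)"
      using tendsto_mult[OF tendsto_const extension_cls[OF s(1)]]
      by (simp add: functional_scale cauchy_seqsD s(1))
    from LIMSEQ_unique[OF extension_cls[OF completion_scale_cls(2)[OF s(1)]] this]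
    show ?thesis by (simp add: s(2) completion_scale_cls(1)[OF s(1)])
  qed
  show "cmod (extension c) \<le> 1 * completion_norm \<nu> c" if c: "c \<in> completion V \<nu>" for c
  proof -
    obtain s where s: "s \<in> cauchy_seqs V \<nu>" "c = cls s" using c by (rule completionE)
    have "cmod (extension (cls s)) \<le> completion_norm \<nu> (cls s)"
      by (rule LIMSEQ_le[OF tendsto_norm[OF extension_cls[OF s(1)]] completion_norm_cls[OF s(1)]])
        (use functional_bound cauchy_seqsD(1)[OF s(1)] in blast)
    then show ?thesis by (simp add: s(2))
  qed
qed

end

section \<open>The complex \<open>K\<close> and the trace\<close>

lemma K_weight_nonneg: "0 \<le> K_weight xs"
proof -
  have "0 \<le> prod_list (map op_norm ys)" for ys :: "'a bounded_op list"
    by (induction ys) (simp_all add: op_norm_nonneg)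
  then show ?thesis by (simp add: K_weight_def sum_nonneg trace_norm_nonneg)
qed

lemma K_norm_le:
  assumes "\<forall>xs\<in>set L. admissible m xs"
  shows "K_norm m (\<Sum>xs\<leftarrow>L. elem xs) \<le> (\<Sum>xs\<leftarrow>L. K_weight xs)"
  unfolding K_norm_def
proof (rule cInf_lower)
  show "bdd_below {\<Sum>xs\<leftarrow>L'. K_weight xs |L'. (\<forall>xs\<in>set L'. admissible m xs) \<and> (\<Sum>xs\<leftarrow>L. elem xs) = (\<Sum>xs\<leftarrow>L'. elem xs)}"
    by (rule bdd_belowI[where m = 0]) (auto intro!: sum_list_nonneg K_weight_nonneg)
qed (use assms in blast)

text \<open>Representations by elementary tensors carry no scalar coefficients; a scalar is absorbed by
  the first factor. The value at \<open>[]\<close> is arbitrary, as admissible lists are nonempty.\<close>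

fun scale_first :: "complex \<Rightarrow> 'a::complex_vector list \<Rightarrow> 'a list" where
  "scale_first c [] = []"
| "scale_first c (x # xs) = (c *\<^sub>C x) # xs"

lemma scale_first:
  fixes xs :: "'h::complex_hilbert bounded_op list"
  assumes "admissible m xs"
  shows "admissible m (scale_first c xs)" "elem (scale_first c xs) = c *\<^sub>C elem xs"
    "K_weight (scale_first c xs) \<le> cmod c * K_weight xs"
proof -
  obtain x ys where xs: "xs = x # ys" using assms by (cases xs) (simp_all add: admissible_def)
  show el: "elem (scale_first c xs) = c *\<^sub>C elem xs"
    by (simp add: xs elem_linear_simps)
  have "prod_list (drop i (scale_first c xs) @ take i (scale_first c xs)) =
    c *\<^sub>C prod_list (drop i xs @ take i xs)" for i
    by (cases i) (simp_all add: xs scaleC_mult_left scaleC_mult_right)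
  then show "admissible m (scale_first c xs)"
    using assms by (simp add: admissible_def trace_class_scaleC xs del: drop_append take_append)
  have "trace_norm (tensor_mult ((cyclic_t ^^ i) (elem (scale_first c xs)))) =
      cmod c * trace_norm (tensor_mult ((cyclic_t ^^ i) (elem xs)))" for i
    by (simp add: el cyclic_t_power_linear tensor_mult_linear trace_norm_scaleC)
  moreover have "prod_list (map op_norm (scale_first c xs)) \<le> cmod c * prod_list (map op_norm xs)"
  proof -
    have "0 \<le> prod_list (map op_norm zs)" for zs :: "'h bounded_op list"
      by (induction zs) (simp_all add: op_norm_nonneg)
    then show ?thesis
      using mult_right_mono[OF op_norm_scaleC_le[of c x]] by (simp add: xs mult.assoc)
  qed
  ultimately show "K_weight (scale_first c xs) \<le> cmod c * K_weight xs"
    by (simp add: K_weight_def distrib_left sum_distrib_left xs)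
qed

lemma scale_first_list:
  assumes "\<forall>xs\<in>set L. admissible m xs"
  shows "\<forall>xs\<in>set (map (scale_first c) L). admissible m xs"
    "(\<Sum>xs\<leftarrow>map (scale_first c) L. elem xs) = c *\<^sub>C (\<Sum>xs\<leftarrow>L. elem xs)"
    "(\<Sum>xs\<leftarrow>map (scale_first c) L. K_weight xs) \<le> cmod c * (\<Sum>xs\<leftarrow>L. K_weight xs)"
  using assms by (induction L) (auto simp: scale_first scaleC_add_right distrib_left intro: add_mono)

lemma K_pre_representation:
  assumes "x \<in> K_pre m"
  shows "\<exists>L. (\<forall>xs\<in>set L. admissible m xs) \<and> x = (\<Sum>xs\<leftarrow>L. elem xs)"
  using assms unfolding K_pre_def
proof (induction rule: cvec.span_induct_alt)
  case base
  show ?case by (intro exI[of _ "[]"]) simp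
next
  case (step c y z)
  then obtain xs L where xs: "y = elem xs" "admissible m xs"
    and L: "\<forall>xs\<in>set L. admissible m xs" "z = (\<Sum>xs\<leftarrow>L. elem xs)" by blast
  then show ?case by (intro exI[of _ "scale_first c xs # L"]) (simp add: scale_first)
qed

lemma K_norm_greatest:
  assumes "x \<in> K_pre m"
    and "\<And>L. \<forall>xs\<in>set L. admissible m xs \<Longrightarrow> x = (\<Sum>xs\<leftarrow>L. elem xs) \<Longrightarrow> r \<le> (\<Sum>xs\<leftarrow>L. K_weight xs)"
  shows "r \<le> K_norm m x"
  unfolding K_norm_def using K_pre_representation[OF assms(1)] assms(2)
  by (intro cInf_greatest) blast+

text \<open>Concatenating representations gives the triangle inequality, scaling them gives homogeneity.\<close>

interpretation K: seminormed_subspace "K_pre m :: 'h::complex_hilbert bounded_op tensor set" "K_norm m" for m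
proof
  show "cvec.subspace (K_pre m :: 'h bounded_op tensor set)" unfolding K_pre_def by (rule cvec.subspace_span)
next
  fix x :: "'h bounded_op tensor" assume "x \<in> K_pre m"
  then show "0 \<le> K_norm m x" by (rule K_norm_greatest) (auto intro!: sum_list_nonneg K_weight_nonneg)
next
  fix x y :: "'h bounded_op tensor" assume x: "x \<in> K_pre m" and y: "y \<in> K_pre m"
  have "K_norm m (x + y) - K_norm m y \<le> K_norm m x"
  proof (rule K_norm_greatest[OF x])
    fix L :: "'h bounded_op list list" assume L: "\<forall>xs\<in>set L. admissible m xs" "x = (\<Sum>xs\<leftarrow>L. elem xs)"
    have "K_norm m (x + y) - (\<Sum>xs\<leftarrow>L. K_weight xs) \<le> K_norm m y"
    proof (rule K_norm_greatest[OF y])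
      fix L' :: "'h bounded_op list list" assume L': "\<forall>xs\<in>set L'. admissible m xs" "y = (\<Sum>xs\<leftarrow>L'. elem xs)"
      have "K_norm m (\<Sum>xs\<leftarrow>L @ L'. elem xs) \<le> (\<Sum>xs\<leftarrow>L @ L'. K_weight xs)"
        by (rule K_norm_le) (use L(1) L'(1) in auto)
      then show "K_norm m (x + y) - (\<Sum>xs\<leftarrow>L. K_weight xs) \<le> (\<Sum>xs\<leftarrow>L'. K_weight xs)"
        by (simp add: L(2) L'(2))
    qed
    then show "K_norm m (x + y) - K_norm m y \<le> (\<Sum>xs\<leftarrow>L. K_weight xs)" by linarith
  qed
  then show "K_norm m (x + y) \<le> K_norm m x + K_norm m y" by linarith
next
  fix c and x :: "'h bounded_op tensor" assume x: "x \<in> K_pre m"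
  have le: "K_norm m (c *\<^sub>C x) \<le> cmod c * (\<Sum>xs\<leftarrow>L. K_weight xs)"
    if L: "\<forall>xs\<in>set L. admissible m xs" "x = (\<Sum>xs\<leftarrow>L. elem xs)" for L
    using K_norm_le[OF scale_first_list(1)[OF L(1), of c]] scale_first_list(2,3)[OF L(1), of c]
    unfolding L(2) by simp
  show "K_norm m (c *\<^sub>C x) \<le> cmod c * K_norm m x"
  proof (cases "c = 0")
    case True
    with le K_pre_representation[OF x] show ?thesis by auto
  next
    case False
    have "K_norm m (c *\<^sub>C x) / cmod c \<le> K_norm m x"
      by (rule K_norm_greatest[OF x]) (use le False in \<open>simp add: pos_divide_le_eq mult.commute\<close>)
    then show ?thesis using False by (simp add: pos_divide_le_eq mult.commute)
  qed
qed

lemma admissible_0_iff: "admissible 0 xs \<longleftrightarrow> (\<exists>A\<in>trace_class. xs = [A])"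
  by (auto simp: admissible_def length_Suc_conv)

lemma admissible_1_iff:
  "admissible 1 xs \<longleftrightarrow> (\<exists>A B. xs = [A, B] \<and> A * B \<in> trace_class \<and> B * A \<in> trace_class)"
  by (auto simp: admissible_def length_Suc_conv numeral_2_eq_2 le_Suc_eq all_conj_distrib)

lemma elem_in_K_pre: "admissible m xs \<Longrightarrow> elem xs \<in> K_pre m"
  unfolding K_pre_def by (rule cvec.span_base) blast

text \<open>The pre-completion consists of finite sums of trace class operators, and the trace is additive
  on operators with summable diagonal.\<close>

lemma K_pre_0_diagonal_summable:
  assumes "x \<in> K_pre 0"
  shows "(\<lambda>e. cinner (op_apply (tensor_mult x) e) e) summable_on some_onb"
  using assms unfolding K_pre_def
proof (induction rule: cvec.span_induct_alt)
  case base
  show ?case by (simp add: tensor_mult_linear op_apply_simps cinner_simps)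
next
  case (step c y z)
  then obtain A where A: "A \<in> trace_class" "y = elem [A]" by (auto simp: admissible_0_iff)
  then have "(\<lambda>e. c * cinner (op_apply A e) e + cinner (op_apply (tensor_mult z) e) e) summable_on some_onb"
    by (intro summable_on_add[OF summable_on_cmult_right step(2)] diagonal_summable trace_class_hs_product)
  then show ?case by (simp add: A(2) tensor_mult_linear tensor_mult_elem op_apply_simps cinner_simps)
qed

interpretation trace: bounded_functional "K_pre 0 :: 'h::complex_hilbert bounded_op tensor set" "K_norm 0"
  "\<lambda>x. op_trace (tensor_mult x)"
proof
  fix x y :: "'h bounded_op tensor" assume x: "x \<in> K_pre 0" and y: "y \<in> K_pre 0"
  show add: "op_trace (tensor_mult (x + y)) = op_trace (tensor_mult x) + op_trace (tensor_mult y)"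
    unfolding op_trace_def tensor_mult_linear(1) op_apply_simps cinner_simps
    by (intro infsum_add K_pre_0_diagonal_summable x y)
next
  fix x :: "'h bounded_op tensor" and c assume x: "x \<in> K_pre 0"
  show "op_trace (tensor_mult (c *\<^sub>C x)) = c * op_trace (tensor_mult x)"
    by (simp add: tensor_mult_linear op_trace_scaleC)
next
  fix x :: "'h bounded_op tensor" assume x: "x \<in> K_pre 0"
  show "cmod (op_trace (tensor_mult x)) \<le> K_norm 0 x"
  proof (rule K_norm_greatest[OF x])
    fix L :: "'h bounded_op list list" assume "\<forall>xs\<in>set L. admissible 0 xs" "x = (\<Sum>xs\<leftarrow>L. elem xs)"
    moreover have "(\<Sum>xs\<leftarrow>L. elem xs) \<in> K_pre 0 \<and>
        cmod (op_trace (tensor_mult (\<Sum>xs\<leftarrow>L. elem xs))) \<le> (\<Sum>xs\<leftarrow>L. K_weight xs)"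
      if "\<forall>xs\<in>set L. admissible 0 xs"
      using that
    proof (induction L)
      case Nil
      show ?case by (simp add: K.closed(1) tensor_mult_linear op_trace_def op_apply_simps cinner_simps)
    next
      case (Cons xs L)
      then obtain A where A: "A \<in> trace_class" "xs = [A]" by (auto simp: admissible_0_iff)
      let ?z = "\<Sum>xs\<leftarrow>L. elem xs"
      have z: "?z \<in> K_pre 0" and IH: "cmod (op_trace (tensor_mult ?z)) \<le> (\<Sum>xs\<leftarrow>L. K_weight xs)"
        using Cons by auto
      have "op_trace (tensor_mult (elem xs + ?z)) = op_trace A + op_trace (tensor_mult ?z)"
        unfolding op_trace_def tensor_mult_linear(1) op_apply_simps cinner_simps A(2) tensor_mult_elem
        using K_pre_0_diagonal_summable[OF z] diagonal_summable[OF trace_class_hs_product[OF A(1)]]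
        by (simp add: infsum_add)
      moreover have "cmod (op_trace A) \<le> K_weight xs"
        using cmod_op_trace_le[OF A(1)] op_norm_nonneg[of A]
        by (simp add: A(2) K_weight_def tensor_mult_elem)
      ultimately have "cmod (op_trace (tensor_mult (elem xs + ?z))) \<le> K_weight xs + (\<Sum>xs\<leftarrow>L. K_weight xs)"
        using norm_triangle_ineq[of "op_trace A" "op_trace (tensor_mult ?z)"] IH by simp
      moreover have "elem xs + ?z \<in> K_pre 0"
        using Cons.prems by (intro K.closed(2) z elem_in_K_pre) simp
      ultimately show ?case by simp
    qed
    ultimately show "cmod (op_trace (tensor_mult x)) \<le> (\<Sum>xs\<leftarrow>L. K_weight xs)" by blast
  qed
qed

lemma Tr_K_extension: "Tr_K = trace.extension"
  unfolding Tr_K_def trace.extension_def K_space_def ..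

text \<open>The sign of \<open>- (B * A)\<close> matches the cyclic operator: \<open>t\<close> maps \<open>A \<otimes> B\<close> to \<open>- B \<otimes> A\<close>, so both trace
  norms already occur in the weight of \<open>A \<otimes> B\<close>.\<close>

lemma hochschild_b_admissible:
  assumes "A * B \<in> trace_class" "B * A \<in> trace_class"
  shows "hochschild_b (elem [A, B]) \<in> K_pre 0"
    "K_norm 0 (hochschild_b (elem [A, B])) \<le> 2 * K_weight [A, B]"
    "op_trace (tensor_mult (hochschild_b (elem [A, B]))) = 0"
proof -
  have adm: "admissible 0 [A * B]" "admissible 0 [- (B * A)]"
    using assms trace_class_scaleC[of "B * A" "-1"] by (simp_all add: admissible_0_iff scaleC_algebra_simps scaleC_one)
  have b: "hochschild_b (elem [A, B]) = (\<Sum>xs\<leftarrow>[[A * B], [- (B * A)]]. elem xs)"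
    by (simp add: hochschild_b_elem elem_linear_simps)
  show "hochschild_b (elem [A, B]) \<in> K_pre 0"
    unfolding b using adm by (simp add: K.closed elem_in_K_pre)
  have weight: "K_weight [A, B] = trace_norm (A * B) + trace_norm (- (B * A)) + op_norm A * op_norm B"
    by (simp add: K_weight_def numeral_2_eq_2 cyclic_t_elem tensor_mult_elem tensor_mult_linear)
  have minus: "op_norm (- (B * A)) \<le> op_norm B * op_norm A"
    using op_norm_scaleC_le[of "-1" "B * A"] op_norm_mult[of B A]
    by (simp add: scaleC_algebra_simps scaleC_one)
  have "K_norm 0 (hochschild_b (elem [A, B])) \<le>
      trace_norm (A * B) + op_norm (A * B) + (trace_norm (- (B * A)) + op_norm (- (B * A)))"
    using K_norm_le[of "[[A * B], [- (B * A)]]" 0] adm unfolding b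
    by (simp add: K_weight_def tensor_mult_elem)
  also have "\<dots> \<le> 2 * K_weight [A, B]"
    using minus op_norm_mult[of A B] trace_norm_nonneg[of "A * B"] trace_norm_nonneg[of "- (B * A)"]
    unfolding weight by (simp add: mult.commute)
  finally show "K_norm 0 (hochschild_b (elem [A, B])) \<le> 2 * K_weight [A, B]" .
  show "op_trace (tensor_mult (hochschild_b (elem [A, B]))) = 0"
    using op_trace_diff[OF assms[THEN trace_class_hs_product]] op_trace_commute[OF assms]
    by (simp add: hochschild_b_elem tensor_mult_linear tensor_mult_elem)
qed

interpretation b: bounded_map "K_pre 1 :: 'h::complex_hilbert bounded_op tensor set" "K_norm 1"
  "K_pre 0" "K_norm 0" hochschild_b 2
proof
  fix x y :: "'h bounded_op tensor"
  show "hochschild_b (x - y) = hochschild_b x - hochschild_b y" by (rule hochschild_b_linear)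
next
  fix x :: "'h bounded_op tensor" assume "x \<in> K_pre 1"
  then show "hochschild_b x \<in> K_pre 0"
    unfolding K_pre_def[of 1]
  proof (induction rule: cvec.span_induct_alt)
    case base
    show ?case by (simp only: hochschild_b_linear K.closed)
  next
    case (step c y z)
    then obtain A B where "y = elem [A, B]" "A * B \<in> trace_class" "B * A \<in> trace_class"
      unfolding mem_Collect_eq admissible_1_iff by (elim exE conjE) simp
    then show ?case using step(2)
      by (simp only: hochschild_b_linear) (intro K.closed hochschild_b_admissible)
  qed
next
  fix x :: "'h bounded_op tensor" assume x: "x \<in> K_pre 1"
  have "K_norm 0 (hochschild_b x) / 2 \<le> K_norm 1 x"
  proof (rule K_norm_greatest[OF x])
    fix L :: "'h bounded_op list list" assume L: "\<forall>xs\<in>set L. admissible 1 xs" "x = (\<Sum>xs\<leftarrow>L. elem xs)"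
    have adm: "hochschild_b (elem xs) \<in> K_pre 0 \<and> K_norm 0 (hochschild_b (elem xs)) \<le> 2 * K_weight xs"
      if "xs \<in> set L" for xs
    proof -
      have "admissible 1 xs" using L(1) that by (rule bspec)
      then obtain A B where "xs = [A, B]" "A * B \<in> trace_class" "B * A \<in> trace_class"
        unfolding admissible_1_iff by (elim exE conjE)
      then show ?thesis by (simp only: hochschild_b_admissible simp_thms)
    qed
    then have "K_norm 0 (\<Sum>xs\<leftarrow>L. hochschild_b (elem xs)) \<le> (\<Sum>xs\<leftarrow>L. K_norm 0 (hochschild_b (elem xs)))"
      by (intro K.seminorm_sum_list[THEN conjunct2]) blast
    also have "\<dots> \<le> (\<Sum>xs\<leftarrow>L. 2 * K_weight xs)" using adm by (intro sum_list_mono) blast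
    finally show "K_norm 0 (hochschild_b x) / 2 \<le> (\<Sum>xs\<leftarrow>L. K_weight xs)"
      by (simp add: L(2) hochschild_b_linear sum_list_const_mult)
  qed
  then show "K_norm 0 (hochschild_b x) \<le> 2 * K_norm 1 x" by simp
qed simp

lemma op_trace_hochschild_b:
  assumes "x \<in> K_pre 1"
  shows "hochschild_b x \<in> K_pre 0 \<and> op_trace (tensor_mult (hochschild_b x)) = 0"
  using assms unfolding K_pre_def[of 1]
proof (induction rule: cvec.span_induct_alt)
  case base
  show ?case
    by (simp add: hochschild_b_linear K.closed tensor_mult_linear op_trace_def op_apply_simps cinner_simps)
next
  case (step c y z)
  then obtain A B where AB: "y = elem [A, B]" "A * B \<in> trace_class" "B * A \<in> trace_class"
    unfolding mem_Collect_eq admissible_1_iff by (elim exE conjE) simp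
  then show ?case
    using hochschild_b_admissible[OF AB(2,3)] step
    by (simp add: AB(1) hochschild_b_linear trace.functional_add trace.functional_scale K.closed)
qed

lemma K_b_in_K_space: "c \<in> K_space 1 \<Longrightarrow> K_b 0 c \<in> K_space 0"
  unfolding K_space_def K_b_def
  by (erule K.completionE) (simp only: b.completion_map_cls K.cls_in_completion b.cauchy_seqs_map)

lemma Tr_K_boundary:
  assumes "c \<in> K_space 1"
  shows "Tr_K (K_b 0 c) = 0"
proof -
  obtain s where s: "s \<in> cauchy_seqs (K_pre 1) (K_norm 1)" "c = K.cls 1 s"
    using assms unfolding K_space_def by (rule K.completionE)
  have "(\<lambda>i. op_trace (tensor_mult (hochschild_b (s i)))) \<longlonglongrightarrow> Tr_K (K_b 0 c)"
    unfolding Tr_K_extension K_b_def s(2) b.completion_map_cls[OF s(1)]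
    by (rule trace.extension_cls[OF b.cauchy_seqs_map[OF s(1)]])
  moreover have "op_trace (tensor_mult (hochschild_b (s i))) = 0" for i
    using op_trace_hochschild_b[OF K.cauchy_seqsD(1)[OF s(1)]] by (rule conjunct2)
  ultimately have "(\<lambda>i. 0) \<longlonglongrightarrow> Tr_K (K_b 0 c)" by simp
  then show ?thesis using LIMSEQ_unique[OF tendsto_const] by metis
qed

proposition Tr_K_cocycle: "(Tr_K :: 'h::complex_hilbert K_elt \<Rightarrow> complex) \<in> HC_upper_0"
  using trace.extension_in_dual Tr_K_boundary
  by (auto simp: HC_upper_0_def K_dual_def Tr_K_extension)

section \<open>The pairing in degree zero\<close>

lemma HC0_rel_refl:
  assumes "c \<in> K_space 0"
  shows "(c, c) \<in> HC0_rel"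
proof -
  obtain s where s: "s \<in> cauchy_seqs (K_pre 0) (K_norm 0)" "c = K.cls 0 s"
    using assms unfolding K_space_def by (rule K.completionE)
  define e where "e = (K.cls 1 (\<lambda>_. 0) :: 'a K_elt)"
  have zero: "(\<lambda>_. 0 :: 'a bounded_op tensor) \<in> cauchy_seqs (K_pre m) (K_norm m)" for m
    by (rule K.cauchy_seqs_const[OF K.closed(1)])
  have "e \<in> K_space 1" unfolding e_def K_space_def by (rule K.cls_in_completion[OF zero])
  moreover have "completion_add (K_pre 0) (K_norm 0) c (K_b 0 e) = c"
    unfolding e_def K_b_def s(2) b.completion_map_cls[OF zero]
    by (simp add: hochschild_b_linear K.completion_add_cls[OF s(1) zero])
  ultimately show ?thesis using assms by (auto simp: HC0_rel_def)
qed

lemma Tr_K_HC0_rel: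
  assumes "(c, d) \<in> HC0_rel"
  shows "Tr_K d = Tr_K c"
proof -
  obtain e where e: "c \<in> K_space 0" "e \<in> K_space 1" "d = completion_add (K_pre 0) (K_norm 0) c (K_b 0 e)"
    using assms by (auto simp: HC0_rel_def)
  then show ?thesis
    using trace.extension_add[of c "K_b 0 e"] K_b_in_K_space[OF e(2)] Tr_K_boundary[OF e(2)]
    by (simp add: Tr_K_extension K_space_def)
qed

lemma HC_pairing_Tr_K:
  assumes "c \<in> K_space 0"
  shows "HC_pairing Tr_K (HC0_class c) = Tr_K c"
proof -
  have "Tr_K ` HC0_class c = {Tr_K c}"
    using HC0_rel_refl[OF assms] Tr_K_HC0_rel by (auto simp: HC0_class_def)
  then show ?thesis by (simp add: HC_pairing_def)
qed

theorem proposition4p1: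
  fixes T :: "'h::complex_hilbert bounded_op" and n :: nat
    and \<pi> :: "free_alg \<Rightarrow> 'h bounded_op"
  assumes "n \<ge> 1"
    and "(1 - adj T * T) ^ n - (1 - T * adj T) ^ n \<in> trace_class"
    and "algebra_hom \<pi>" and "\<pi> fx = T" and "\<pi> fy = adj T"
  shows "gamma n \<in> B_cycles (ideal_I n) (ideal_J n) 2 \<and>
    periodicity_S (gamma n) \<in> B_chains (ideal_J n) (ideal_J n) 0 \<and>
    (Tr_K :: 'h K_elt \<Rightarrow> complex) \<in> HC_upper_0 \<and>
    HC0_class (pi_K \<pi> (periodicity_S (gamma n))) \<in> HC_lower_0 \<and>
    HC_pairing Tr_K (HC0_class (pi_K \<pi> (periodicity_S (gamma n))))
      = op_trace ((1 - adj T * T) ^ n - (1 - T * adj T) ^ n) \<and>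
    op_trace ((1 - adj T * T) ^ n - (1 - T * adj T) ^ n) = H_Ind n T"
proof -
  define G where "G = (1 - adj T * T) ^ n - (1 - T * adj T) ^ n"
  note \<pi> = algebra_homD[OF assms(3)]
  have "\<pi> (fw ^ n - fv ^ n) = G"
    by (simp add: \<pi> fw_def fv_def G_def assms(4,5))
  then have "pi_K \<pi> (periodicity_S (gamma n)) = K.cls 0 (\<lambda>_. elem [G])"
    by (simp add: pi_K_def K_emb_def completion_emb_def K.cls_def periodicity_S_def gamma_def gamma0_def
        tensor_map_elem[OF assms(3)])
  moreover have G: "elem [G] \<in> K_pre 0"
    using assms(2) by (intro elem_in_K_pre) (simp add: admissible_0_iff G_def)
  ultimately have chain: "pi_K \<pi> (periodicity_S (gamma n)) \<in> K_space 0"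
    and trace: "Tr_K (pi_K \<pi> (periodicity_S (gamma n))) = op_trace G"
    by (simp_all add: K_space_def K.cls_in_completion K.cauchy_seqs_const Tr_K_extension
        trace.extension_const tensor_mult_elem)
  have "HC0_class (pi_K \<pi> (periodicity_S (gamma n))) \<in> HC_lower_0"
    unfolding HC_lower_0_def HC0_class_def by (rule quotientI[OF chain])
  then show ?thesis
    using gamma_cycle periodicity_S_gamma Tr_K_cocycle HC_pairing_Tr_K[OF chain] trace
    by (simp add: G_def H_Ind_def)
qed

end
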